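(* Let $\mathcal{H}$ be a separable complex Hilbert space and let $\{S_\alpha \mid \alpha\in\mathcal{A}\}$ be a family of bounded linear operators on $\mathcal{H}$. Suppose there exists an (infinite) orthonormal sequence $\{e_n\}_{n=1}^\infty$ in $\mathcal{H}$ such that $$\lim_{n\to\infty}\sup_{\alpha\in\mathcal{A}}\|S_\alpha^* e_n\|_{\mathcal{H}}=0,\qquad \lim_{n\to\infty}\sup_{\alpha\in\mathcal{A}}\|S_\alpha e_n\|_{\mathcal{H}}=0 .$$ Then there exists a unitary operator $U_\infty:\mathcal{H}\to L_2(\mathbb{R})$ such that all the operators $U_\infty S_\alpha U_\infty^{-1}$ ($\alpha\in\mathcal{A}$) and their (finite) linear combinations are bi-Carleman operators having $K^\infty$-kernels of Mercer type.
   Context: Notation. $L_2=L_2(\mathbb{R})$ is the Hilbert space of (equivalence classes of) measurable complex-valued functions on $\mathbb{R}$ that are square-integrable with respect to Lebesgue measure, with inner product $\langle f,g\rangle=\int_{\mathbb{R}} f(s)\overline{g(s)}\,ds$. For a Hilbert space $\mathcal{H}$, $\mathfrak{R}(\mathcal{H})$ is the algebra of all bounded linear operators on $\mathcal{H}$, and $A^*$ is the adjoint of $A\in\mathfrak{R}(\mathcal{H})$. For a locally compact space $X$ and a Banach space $B$, $C(X,B)$ is the Banach space (with the sup norm) of continuous $B$-valued functions on $X$ vanishing at infinity: for every $\varepsilon>0$ there is a compact subset of $X$ outside of which $\|f(x)\|_B<\varepsilon$. Integral operators. A linear operator $T:L_2\to L_2$ is integral if there is a measurable function $\boldsymbol{T}$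 on $\mathbb{R}^2$ (a kernel) such that for every $f\in L_2$, $(Tf)(s)=\int_{\mathbb{R}}\boldsymbol{T}(s,t)f(t)\,dt$ for almost every $s\in\mathbb{R}$. The kernel $\boldsymbol{T}$ is Carleman if $\boldsymbol{T}(s,\cdot)\in L_2$ for almost every $s\in\mathbb{R}$. An integral operator with kernel $\boldsymbol{T}$ is bi-Carleman if both $\boldsymbol{T}$ and $\boldsymbol{T}^*$, where $\boldsymbol{T}^*(s,t)=\overline{\boldsymbol{T}(t,s)}$, are Carleman kernels. $K^m$-kernels. For a non-negative integer $m$, a function $\boldsymbol{K}:\mathbb{R}^2\to\mathbb{C}$ is a $K^m$-kernel if: (i) $\boldsymbol{K}$ and all its partial derivatives on $\mathbb{R}^2$ up to order $m$ are in $C(\mathbb{R}^2,\mathbb{C})$; (ii) the Carleman function $\boldsymbol{k}:\mathbb{R}\to L_2$, $\boldsymbol{k}(s)=\overline{\boldsymbol{K}(s,\cdot)}$, and all its strong (norm) derivatives on $\mathbb{R}$ up to order $m$ are in $C(\mathbb{R},L_2)$; (iii) the conjugate transpose $\boldsymbol{K}^*(s,t)=\overline{\boldsymbol{K}(t,s)}$ satisfies (ii), i.e. $\boldsymbol{k}^*(s)=\overline{\boldsymbol{K}^*(s,\cdot)}$ and all its strong derivatives on $\mathbb{R}$ up to order $m$ are in $C(\mathbb{R},L_2)$. A $K^\infty$-kernel is a function that is a $K^m$-kernel for every non-negative integer $m$. Mercer type. For $T\in\mathfrak{R}(\mathcal{H})$ put $$\mathcal{M}(T)=\bigl(T\mathfrak{R}(\mathcal{H})\cup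 T^*\mathfrak{R}(\mathcal{H})\bigr)\cap\bigl(\mathfrak{R}(\mathcal{H})T^*\cup\mathfrak{R}(\mathcal{H})T\bigr),$$ where $S\mathfrak{R}(\mathcal{H})=\{SA\mid A\in\mathfrak{R}(\mathcal{H})\}$ and $\mathfrak{R}(\mathcal{H})S=\{AS\mid A\in\mathfrak{R}(\mathcal{H})\}$. Let $\boldsymbol{K}$ be a $K^\infty$-kernel and let $T$ be the integral operator on $L_2$ it induces. The $K^\infty$-kernel $\boldsymbol{K}$ is of Mercer type if every operator $A\in\mathcal{M}(T)$ (taken with $\mathcal{H}=L_2$) is an integral operator having a $K^\infty$-kernel. *)

theory Defs
  imports "HOL-Analysis.Analysis"
begin

section \<open>Complex Hilbert spaces\<close>

class complex_inner = real_inner +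
  fixes scaleC :: "complex \<Rightarrow> 'a \<Rightarrow> 'a"  (infixr \<open>*\<^sub>C\<close> 75)
    and cinner :: "'a \<Rightarrow> 'a \<Rightarrow> complex"
  assumes scaleC_add_right: "c *\<^sub>C (x + y) = c *\<^sub>C x + c *\<^sub>C y"
    and scaleC_add_left: "(c + d) *\<^sub>C x = c *\<^sub>C x + d *\<^sub>C x"
    and scaleC_scaleC: "c *\<^sub>C d *\<^sub>C x = (c * d) *\<^sub>C x"
    and scaleR_scaleC: "r *\<^sub>R x = complex_of_real r *\<^sub>C x"
    and cinner_commute: "cinner x y = cnj (cinner y x)"
    and cinner_add_left: "cinner (x + y) z = cinner x z + cinner y z"
    and cinner_scaleC_left: "cinner (c *\<^sub>C x) y = c * cinner x y"
    and inner_eq_Re_cinner: "inner x y = Re (cinner x y)"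

class complex_hilbert = complex_inner + complete_space

lemma norm_eq_sqrt_cinner: "norm x = sqrt (Re (cinner x x))"
  for x :: "'a::complex_inner"
  by (simp add: norm_eq_sqrt_inner inner_eq_Re_cinner)

definition bounded_clinear :: "('a::complex_inner \<Rightarrow> 'b::complex_inner) \<Rightarrow> bool" where
  "bounded_clinear T \<longleftrightarrow> bounded_linear T \<and> (\<forall>c x. T (c *\<^sub>C x) = c *\<^sub>C T x)"

(* By the Riesz representation theorem this is well-defined for bounded operators
   between Hilbert spaces. *)
definition cadjoint :: "('a::complex_hilbert \<Rightarrow> 'b::complex_hilbert) \<Rightarrow> 'b \<Rightarrow> 'a" where
  "cadjoint T = (THE S. \<forall>x y. cinner (T x) y = cinner x (S y))"

definition unitary :: "('a::complex_hilbert \<Rightarrow> 'b::complex_hilbert) \<Rightarrow> bool" where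
  "unitary U \<longleftrightarrow> bounded_clinear U \<and> bij U \<and> (\<forall>x y. cinner (U x) (U y) = cinner x y)"

definition orthonormal_seq :: "(nat \<Rightarrow> 'a::complex_inner) \<Rightarrow> bool" where
  "orthonormal_seq e \<longleftrightarrow> (\<forall>m n. cinner (e m) (e n) = (if m = n then 1 else 0))"

section \<open>The Hilbert space of square-integrable functions on the real line\<close>

definition square_integrable :: "(real \<Rightarrow> complex) \<Rightarrow> bool" where
  "square_integrable f \<longleftrightarrow>
     f \<in> borel_measurable lebesgue \<and> integrable lebesgue (\<lambda>t. (cmod (f t))\<^sup>2)"

definition l2_rel :: "(real \<Rightarrow> complex) \<Rightarrow> (real \<Rightarrow> complex) \<Rightarrow> bool" where
  "l2_rel f g \<longleftrightarrow> square_integrable f \<and> square_integrable g \<and> (AE t in lebesgue. f t = g t)"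

lemma square_integrable_zero: "square_integrable (\<lambda>_. 0)"
  by (simp add: square_integrable_def)

lemma square_integrable_add:
  assumes "square_integrable f" "square_integrable g"
  shows "square_integrable (\<lambda>t. f t + g t)"
proof -
  have [measurable]: "f \<in> borel_measurable lebesgue" "g \<in> borel_measurable lebesgue"
    using assms by (auto simp: square_integrable_def)
  have "integrable lebesgue (\<lambda>t. (cmod (f t + g t))\<^sup>2)"
  proof (rule Bochner_Integration.integrable_bound)
    show "integrable lebesgue (\<lambda>t. 2 * (cmod (f t))\<^sup>2 + 2 * (cmod (g t))\<^sup>2)"
      using assms by (auto simp: square_integrable_def)
    have "(cmod (a + b))\<^sup>2 \<le> 2 * (cmod a)\<^sup>2 + 2 * (cmod b)\<^sup>2" for a b
    proof -
      have "(cmod (a + b))\<^sup>2 \<le> (cmod a + cmod b)\<^sup>2"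
        by (intro power_mono norm_triangle_ineq) auto
      also have "\<dots> \<le> 2 * (cmod a)\<^sup>2 + 2 * (cmod b)\<^sup>2"
        using sum_squares_bound[of "cmod a" "cmod b"] by (simp add: power2_sum)
      finally show ?thesis .
    qed
    then show "AE t in lebesgue. norm ((cmod (f t + g t))\<^sup>2)
                 \<le> norm (2 * (cmod (f t))\<^sup>2 + 2 * (cmod (g t))\<^sup>2)"
      by (intro AE_I2) (simp add: abs_of_nonneg)
  qed measurable
  then show ?thesis by (simp add: square_integrable_def)
qed

lemma square_integrable_scale:
  assumes "square_integrable f"
  shows "square_integrable (\<lambda>t. c * f t)"
  using assms by (auto simp: square_integrable_def norm_mult power_mult_distrib)

lemma square_integrable_diff:
  assumes "square_integrable f" "square_integrable g"
  shows "square_integrable (\<lambda>t. f t - g t)"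
  using square_integrable_add[OF assms(1) square_integrable_scale[OF assms(2), of "-1"]] by simp

lemma integrable_square_integrable_mult:
  assumes "square_integrable f" "square_integrable g"
  shows "integrable lebesgue (\<lambda>t. f t * cnj (g t))"
proof (rule Bochner_Integration.integrable_bound)
  have [measurable]: "f \<in> borel_measurable lebesgue" "g \<in> borel_measurable lebesgue"
    using assms by (auto simp: square_integrable_def)
  show "integrable lebesgue (\<lambda>t. (cmod (f t))\<^sup>2 + (cmod (g t))\<^sup>2)"
    using assms by (auto simp: square_integrable_def)
  show "(\<lambda>t. f t * cnj (g t)) \<in> borel_measurable lebesgue"
    by (intro borel_measurable_times borel_measurable_continuous_on[of cnj] continuous_intros) simp_all
  have "cmod a * cmod b \<le> (cmod a)\<^sup>2 + (cmod b)\<^sup>2" for a b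
  proof -
    have "0 \<le> cmod a * cmod b" by simp
    with sum_squares_bound[of "cmod a" "cmod b"] show ?thesis by linarith
  qed
  then show "AE t in lebesgue. norm (f t * cnj (g t)) \<le> norm ((cmod (f t))\<^sup>2 + (cmod (g t))\<^sup>2)"
    by (intro AE_I2) (simp add: norm_mult abs_of_nonneg)
qed

quotient_type l2 = "real \<Rightarrow> complex" / partial: l2_rel
proof (rule part_equivpI)
  show "\<exists>f. l2_rel f f"
    using square_integrable_zero by (auto simp: l2_rel_def)
  show "symp l2_rel"
    by (auto simp: symp_def l2_rel_def)
  show "transp l2_rel"
    by (auto simp: transp_def l2_rel_def)
qed

lemma square_integrable_rep_l2 [simp]: "square_integrable (rep_l2 x)"
  using Quotient_rep_reflp[OF Quotient_l2, of x] by (simp add: l2_rel_def)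

lemma abs_l2_rep_l2 [simp]: "abs_l2 (rep_l2 x) = x"
  by (rule Quotient_abs_rep[OF Quotient_l2])

lemma rep_l2_abs_l2:
  assumes "square_integrable f"
  shows "AE t in lebesgue. rep_l2 (abs_l2 f) t = f t"
  using Quotient_rep_abs[OF Quotient_l2, of f] assms by (simp add: l2_rel_def)

lemma l2_eq_iff: "x = y \<longleftrightarrow> (AE t in lebesgue. rep_l2 x t = rep_l2 y t)"
  using Quotient_rel_rep[OF Quotient_l2, of x y] by (simp add: l2_rel_def)

instantiation l2 :: complex_inner
begin

lift_definition zero_l2 :: l2 is "\<lambda>_. 0"
  by (simp add: l2_rel_def square_integrable_zero)

lift_definition plus_l2 :: "l2 \<Rightarrow> l2 \<Rightarrow> l2" is "\<lambda>f g t. f t + g t"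
  by (auto simp: l2_rel_def square_integrable_add)

lift_definition minus_l2 :: "l2 \<Rightarrow> l2 \<Rightarrow> l2" is "\<lambda>f g t. f t - g t"
  by (auto simp: l2_rel_def square_integrable_diff)

lift_definition scaleC_l2 :: "complex \<Rightarrow> l2 \<Rightarrow> l2" is "\<lambda>c f t. c * f t"
  by (auto simp: l2_rel_def square_integrable_scale)

definition uminus_l2 :: "l2 \<Rightarrow> l2" where "- x = (-1) *\<^sub>C x" for x :: l2

definition scaleR_l2 :: "real \<Rightarrow> l2 \<Rightarrow> l2" where
  "r *\<^sub>R x = complex_of_real r *\<^sub>C x" for x :: l2

definition cinner_l2 :: "l2 \<Rightarrow> l2 \<Rightarrow> complex" where
  "cinner x y = (\<integral>t. rep_l2 x t * cnj (rep_l2 y t) \<partial>lebesgue)"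

definition inner_l2 :: "l2 \<Rightarrow> l2 \<Rightarrow> real" where
  "inner x y = Re (cinner x y)" for x y :: l2

definition norm_l2 :: "l2 \<Rightarrow> real" where
  "norm x = sqrt (inner x x)" for x :: l2

definition sgn_l2 :: "l2 \<Rightarrow> l2" where
  "sgn x = inverse (norm x) *\<^sub>R x" for x :: l2

definition dist_l2 :: "l2 \<Rightarrow> l2 \<Rightarrow> real" where
  "dist x y = norm (x - y)" for x y :: l2

definition uniformity_l2 :: "(l2 \<times> l2) filter" where
  "uniformity_l2 = (INF e\<in>{0<..}. principal {(x, y). dist x y < e})"

definition open_l2 :: "l2 set \<Rightarrow> bool" where
  "open_l2 U \<longleftrightarrow> (\<forall>x\<in>U. \<forall>\<^sub>F (x', y) in uniformity. x' = x \<longrightarrow> y \<in> U)"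

lemma rep_l2_plus: "AE t in lebesgue. rep_l2 (x + y) t = rep_l2 x t + rep_l2 y t"
  using rep_l2_abs_l2[OF square_integrable_add[of "rep_l2 x" "rep_l2 y"]]
  by (simp add: plus_l2_def)

lemma rep_l2_minus: "AE t in lebesgue. rep_l2 (x - y) t = rep_l2 x t - rep_l2 y t"
  using rep_l2_abs_l2[OF square_integrable_diff[of "rep_l2 x" "rep_l2 y"]]
  by (simp add: minus_l2_def)

lemma rep_l2_zero: "AE t in lebesgue. rep_l2 0 t = 0"
  using rep_l2_abs_l2[OF square_integrable_zero] by (simp add: zero_l2_def)

lemma rep_l2_scaleC: "AE t in lebesgue. rep_l2 (c *\<^sub>C x) t = c * rep_l2 x t"
  using rep_l2_abs_l2[OF square_integrable_scale[of "rep_l2 x" c]]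
  by (simp add: scaleC_l2_def)

lemma cinner_l2_self:
  "cinner x x = complex_of_real (\<integral>t. (cmod (rep_l2 x t))\<^sup>2 \<partial>lebesgue)" for x :: l2
  by (simp add: cinner_l2_def complex_norm_square[symmetric] flip: integral_complex_of_real)

lemma rep_l2_measurable [measurable]: "rep_l2 x \<in> borel_measurable lebesgue"
  using square_integrable_rep_l2[of x] unfolding square_integrable_def by blast

lemma mult_cnj_rep_l2_measurable:
  "(\<lambda>t. rep_l2 x t * cnj (rep_l2 y t)) \<in> borel_measurable lebesgue"
  using integrable_square_integrable_mult[of "rep_l2 x" "rep_l2 y"] by auto

instance
proof
  fix x y z :: l2 and c d :: complex and r s :: real
  show "x + y + z = x + (y + z)"
    by transfer (auto simp: l2_rel_def algebra_simps square_integrable_add)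
  show "x + y = y + x"
    by transfer (auto simp: l2_rel_def algebra_simps square_integrable_add)
  show "0 + x = x"
    by transfer (auto simp: l2_rel_def)
  show "- x + x = 0"
    unfolding uminus_l2_def
    by transfer (auto simp: l2_rel_def square_integrable_zero)
  show "x - y = x + - y"
    unfolding uminus_l2_def
    by transfer (auto simp: l2_rel_def square_integrable_diff)
  show add_right: "c *\<^sub>C (x + y) = c *\<^sub>C x + c *\<^sub>C y" for c
    by transfer (auto simp: l2_rel_def algebra_simps square_integrable_add square_integrable_scale)
  show add_left: "(c + d) *\<^sub>C x = c *\<^sub>C x + d *\<^sub>C x" for c d
    by transfer (auto simp: l2_rel_def algebra_simps square_integrable_add square_integrable_scale)
  show assoc: "c *\<^sub>C d *\<^sub>C x = (c * d) *\<^sub>C x" for c d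
    by transfer (auto simp: l2_rel_def algebra_simps square_integrable_scale)
  have one: "1 *\<^sub>C x = x"
    by transfer (auto simp: l2_rel_def)
  show "r *\<^sub>R x = complex_of_real r *\<^sub>C x"
    by (rule scaleR_l2_def)
  show "r *\<^sub>R (x + y) = r *\<^sub>R x + r *\<^sub>R y"
    by (simp add: scaleR_l2_def add_right)
  show "(r + s) *\<^sub>R x = r *\<^sub>R x + s *\<^sub>R x"
    by (simp add: scaleR_l2_def add_left)
  show "r *\<^sub>R s *\<^sub>R x = (r * s) *\<^sub>R x"
    by (simp add: scaleR_l2_def assoc)
  show "1 *\<^sub>R x = x"
    by (simp add: scaleR_l2_def one)
  show "sgn x = inverse (norm x) *\<^sub>R x"
    by (rule sgn_l2_def)
  show "dist x y = norm (x - y)"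
    by (rule dist_l2_def)
  show "(uniformity :: (l2 \<times> l2) filter) = (INF e\<in>{0<..}. principal {(x, y). dist x y < e})"
    by (rule uniformity_l2_def)
  show "open U \<longleftrightarrow> (\<forall>x\<in>U. \<forall>\<^sub>F (x', y) in uniformity. x' = x \<longrightarrow> y \<in> U)" for U :: "l2 set"
    by (rule open_l2_def)
  show comm: "cinner x y = cnj (cinner y x)"
    by (simp add: cinner_l2_def mult.commute flip: Bochner_Integration.integral_cnj)
  show cadd: "cinner (x + y) z = cinner x z + cinner y z"
  proof -
    have "cinner (x + y) z
        = (\<integral>t. rep_l2 x t * cnj (rep_l2 z t) + rep_l2 y t * cnj (rep_l2 z t) \<partial>lebesgue)"
      unfolding cinner_l2_def
      by (intro integral_cong_AE borel_measurable_add mult_cnj_rep_l2_measurable)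
         (use rep_l2_plus[of x y] in \<open>auto simp: algebra_simps\<close>)
    then show ?thesis
      by (simp add: cinner_l2_def integrable_square_integrable_mult)
  qed
  show cscale: "cinner (c *\<^sub>C x) y = c * cinner x y" for c
  proof -
    have "cinner (c *\<^sub>C x) y = (\<integral>t. c * (rep_l2 x t * cnj (rep_l2 y t)) \<partial>lebesgue)"
      unfolding cinner_l2_def
      by (intro integral_cong_AE borel_measurable_times[OF borel_measurable_const]
            mult_cnj_rep_l2_measurable)
         (use rep_l2_scaleC[of c x] in \<open>auto simp: algebra_simps\<close>)
    then show ?thesis
      by (simp add: cinner_l2_def)
  qed
  show "inner x y = Re (cinner x y)"
    by (rule inner_l2_def)
  show "inner x y = inner y x"
    using comm by (simp add: inner_l2_def)
  show "inner (x + y) z = inner x z + inner y z"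
    by (simp add: inner_l2_def cadd)
  show "inner (r *\<^sub>R x) y = r * inner x y"
    by (simp add: inner_l2_def scaleR_l2_def cscale)
  show "0 \<le> inner x x"
    by (simp add: inner_l2_def cinner_l2_self)
  show "inner x x = 0 \<longleftrightarrow> x = 0"
  proof -
    have "inner x x = 0 \<longleftrightarrow> (AE t in lebesgue. (cmod (rep_l2 x t))\<^sup>2 = 0)"
      using integral_nonneg_eq_0_iff_AE[of lebesgue "\<lambda>t. (cmod (rep_l2 x t))\<^sup>2"]
        square_integrable_rep_l2[of x]
      by (simp add: inner_l2_def cinner_l2_self square_integrable_def)
    also have "\<dots> \<longleftrightarrow> x = 0"
      using rep_l2_zero by (auto simp: l2_eq_iff elim: AE_mp)
    finally show ?thesis .
  qed
  show "norm x = sqrt (inner x x)"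
    by (rule norm_l2_def)
qed

end

lemma nn_integral_l2: "(\<integral>\<^sup>+t. ennreal ((cmod (rep_l2 x t))\<^sup>2) \<partial>lebesgue) = ennreal ((norm x)\<^sup>2)"
proof -
  have "(norm x)\<^sup>2 = (\<integral>t. (cmod (rep_l2 x t))\<^sup>2 \<partial>lebesgue)"
    by (simp add: norm_l2_def inner_l2_def cinner_l2_self)
  moreover have "integrable lebesgue (\<lambda>t. (cmod (rep_l2 x t))\<^sup>2)"
    using square_integrable_rep_l2[of x] unfolding square_integrable_def by blast
  ultimately show ?thesis
    by (simp add: nn_integral_eq_integral)
qed

lemma l2_tendsto_I:
  fixes Y :: "nat \<Rightarrow> l2"
  assumes Y: "Cauchy Y"
    and lim: "AE t in lebesgue. convergent (\<lambda>k. rep_l2 (Y k) t)"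
  shows "\<exists>L. Y \<longlonglongrightarrow> L"
proof -
  define h where "h t = lim (\<lambda>k. rep_l2 (Y k) t)" for t
  have h_lim: "AE t in lebesgue. (\<lambda>k. rep_l2 (Y k) t) \<longlonglongrightarrow> h t"
    using lim by eventually_elim (simp add: h_def convergent_LIMSEQ_iff)
  have h_meas [measurable]: "h \<in> borel_measurable lebesgue"
    unfolding h_def by (intro borel_measurable_lim_metric rep_l2_measurable)
  have Fatou: "(\<integral>\<^sup>+t. ennreal ((cmod (rep_l2 (Y k) t - h t))\<^sup>2) \<partial>lebesgue) \<le> ennreal (e\<^sup>2)"
    if e: "0 < e" and N: "\<And>m n. N \<le> m \<Longrightarrow> N \<le> n \<Longrightarrow> dist (Y m) (Y n) < e" and k: "N \<le> k" for e N k
  proof -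
    let ?u = "\<lambda>n t. ennreal ((cmod (rep_l2 (Y k) t - rep_l2 (Y n) t))\<^sup>2)"
    have bound: "(\<integral>\<^sup>+t. ?u n t \<partial>lebesgue) \<le> ennreal (e\<^sup>2)" if "N \<le> n" for n
    proof -
      have "(\<integral>\<^sup>+t. ?u n t \<partial>lebesgue)
          = (\<integral>\<^sup>+t. ennreal ((cmod (rep_l2 (Y k - Y n) t))\<^sup>2) \<partial>lebesgue)"
        by (intro nn_integral_cong_AE) (use rep_l2_minus[of "Y k" "Y n"] in \<open>auto elim: eventually_mono\<close>)
      also have "\<dots> = ennreal ((dist (Y k) (Y n))\<^sup>2)"
        by (simp add: nn_integral_l2 dist_norm)
      also have "\<dots> \<le> ennreal (e\<^sup>2)"
        using N[OF k that] by (intro ennreal_leI power_mono) auto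
      finally show ?thesis .
    qed
    have "(\<integral>\<^sup>+t. ennreal ((cmod (rep_l2 (Y k) t - h t))\<^sup>2) \<partial>lebesgue)
        = (\<integral>\<^sup>+t. liminf (\<lambda>n. ?u n t) \<partial>lebesgue)"
    proof (intro nn_integral_cong_AE)
      show "AE t in lebesgue. ennreal ((cmod (rep_l2 (Y k) t - h t))\<^sup>2) = liminf (\<lambda>n. ?u n t)"
        using h_lim
      proof eventually_elim
        case (elim t)
        then have "(\<lambda>n. ?u n t) \<longlonglongrightarrow> ennreal ((cmod (rep_l2 (Y k) t - h t))\<^sup>2)"
          by (intro tendsto_intros)
        then show ?case
          by (intro lim_imp_Liminf[symmetric]) auto
      qed
    qed
    also have "\<dots> \<le> liminf (\<lambda>n. \<integral>\<^sup>+t. ?u n t \<partial>lebesgue)"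
      by (intro nn_integral_liminf) measurable
    also have "\<dots> \<le> liminf (\<lambda>n::nat. ennreal (e\<^sup>2))"
      by (intro Liminf_mono eventually_sequentiallyI[of N] bound)
    also have "\<dots> = ennreal (e\<^sup>2)"
      by (simp add: Liminf_const)
    finally show ?thesis .
  qed
  have diff: "square_integrable (\<lambda>t. rep_l2 (Y k) t - h t)"
    if "0 < e" and "\<And>m n. N \<le> m \<Longrightarrow> N \<le> n \<Longrightarrow> dist (Y m) (Y n) < e" and "N \<le> k" for e N k
    unfolding square_integrable_def
  proof
    show "(\<lambda>t. rep_l2 (Y k) t - h t) \<in> borel_measurable lebesgue"
      by measurable
    show "integrable lebesgue (\<lambda>t. (cmod (rep_l2 (Y k) t - h t))\<^sup>2)"
    proof (rule integrableI_nonneg)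
      show "(\<integral>\<^sup>+t. ennreal ((cmod (rep_l2 (Y k) t - h t))\<^sup>2) \<partial>lebesgue) < \<infinity>"
        using Fatou[OF that] by (metis ennreal_less_top infinity_ennreal_def le_less_trans)
    qed auto
  qed
  obtain N1 where N1: "\<And>m n. N1 \<le> m \<Longrightarrow> N1 \<le> n \<Longrightarrow> dist (Y m) (Y n) < 1"
    using Y unfolding Cauchy_def by (metis zero_less_one)
  have h: "square_integrable h"
    using square_integrable_diff[OF square_integrable_rep_l2[of "Y N1"] diff[of 1 N1 N1]] N1 by simp
  have "Y \<longlonglongrightarrow> abs_l2 h"
  proof (rule metric_LIMSEQ_I)
    fix e :: real
    assume "0 < e"
    then have e2: "0 < e / 2" by simp
    then obtain N where N: "\<And>m n. N \<le> m \<Longrightarrow> N \<le> n \<Longrightarrow> dist (Y m) (Y n) < e / 2"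
      using Y unfolding Cauchy_def by meson
    have "dist (Y k) (abs_l2 h) < e" if k: "N \<le> k" for k
    proof -
      have "ennreal ((norm (Y k - abs_l2 h))\<^sup>2)
          = (\<integral>\<^sup>+t. ennreal ((cmod (rep_l2 (Y k - abs_l2 h) t))\<^sup>2) \<partial>lebesgue)"
        by (rule nn_integral_l2[symmetric])
      also have "\<dots> = (\<integral>\<^sup>+t. ennreal ((cmod (rep_l2 (Y k) t - h t))\<^sup>2) \<partial>lebesgue)"
      proof (rule nn_integral_cong_AE)
        show "AE t in lebesgue. ennreal ((cmod (rep_l2 (Y k - abs_l2 h) t))\<^sup>2)
                = ennreal ((cmod (rep_l2 (Y k) t - h t))\<^sup>2)"
          using rep_l2_minus[of "Y k" "abs_l2 h"] rep_l2_abs_l2[OF h] by eventually_elim simp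
      qed
      also have "\<dots> \<le> ennreal ((e / 2)\<^sup>2)"
        by (rule Fatou[OF e2 N k])
      finally have "(norm (Y k - abs_l2 h))\<^sup>2 \<le> (e / 2)\<^sup>2"
        by simp
      then have "norm (Y k - abs_l2 h) \<le> e / 2"
        using e2 by (meson less_imp_le power2_le_imp_le)
      with \<open>0 < e\<close> show ?thesis
        by (simp add: dist_norm)
    qed
    then show "\<exists>N. \<forall>k\<ge>N. dist (Y k) (abs_l2 h) < e" by blast
  qed
  then show ?thesis by blast
qed

instance l2 :: complex_hilbert
proof
  fix X :: "nat \<Rightarrow> l2"
  assume X: "Cauchy X"
  have "\<exists>N. \<forall>m\<ge>N. \<forall>n\<ge>N. dist (X m) (X n) < (1/4) ^ k" for k :: nat
    using X unfolding Cauchy_def by simp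
  then obtain N where N: "\<And>k m n. N k \<le> m \<Longrightarrow> N k \<le> n \<Longrightarrow> dist (X m) (X n) < (1/4) ^ k"
    by metis
  define r where "r k = k + (\<Sum>i\<le>k. N i)" for k
  have r: "strict_mono r"
    by (rule strict_monoI_Suc) (simp add: r_def)
  have N_le_r: "N k \<le> r k" for k
    using member_le_sum[of k "{..k}" N] by (simp add: r_def)
  define Y where "Y = X \<circ> r"
  have Y_Cauchy: "Cauchy Y"
    unfolding Y_def by (rule Cauchy_subseq_Cauchy[OF X r])
  have step: "norm (Y (Suc k) - Y k) \<le> (1/4) ^ k" for k
    using N[of k "r (Suc k)" "r k"] N_le_r[of k] strict_mono_leD[OF r, of k "Suc k"]
    by (simp add: Y_def dist_norm)
  let ?d = "\<lambda>k t. rep_l2 (Y (Suc k)) t - rep_l2 (Y k) t"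
  have "AE t in lebesgue. (\<Sum>k. ennreal (4 ^ k * (cmod (?d k t))\<^sup>2)) \<noteq> \<infinity>"
  proof (rule nn_integral_PInf_AE)
    have "(\<integral>\<^sup>+t. (\<Sum>k. ennreal (4 ^ k * (cmod (?d k t))\<^sup>2)) \<partial>lebesgue)
        = (\<Sum>k. \<integral>\<^sup>+t. ennreal (4 ^ k * (cmod (?d k t))\<^sup>2) \<partial>lebesgue)"
      by (intro nn_integral_suminf) measurable
    also have "\<dots> \<le> (\<Sum>k. ennreal ((1/4) ^ k))"
    proof (intro suminf_le summableI)
      fix k
      have "(\<integral>\<^sup>+t. ennreal (4 ^ k * (cmod (?d k t))\<^sup>2) \<partial>lebesgue)
          = ennreal (4 ^ k) * (\<integral>\<^sup>+t. ennreal ((cmod (?d k t))\<^sup>2) \<partial>lebesgue)"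
        by (subst nn_integral_cmult[symmetric]) (auto simp: ennreal_mult)
      also have "(\<integral>\<^sup>+t. ennreal ((cmod (?d k t))\<^sup>2) \<partial>lebesgue)
          = (\<integral>\<^sup>+t. ennreal ((cmod (rep_l2 (Y (Suc k) - Y k) t))\<^sup>2) \<partial>lebesgue)"
        by (intro nn_integral_cong_AE)
           (use rep_l2_minus[of "Y (Suc k)" "Y k"] in \<open>auto elim: eventually_mono\<close>)
      also have "\<dots> \<le> ennreal (((1/4) ^ k)\<^sup>2)"
        unfolding nn_integral_l2 by (intro ennreal_leI power_mono step) auto
      also have "ennreal (4 ^ k) * ennreal (((1/4) ^ k)\<^sup>2) = ennreal ((1/4) ^ k)"
        by (simp add: power2_eq_square power_divide flip: ennreal_mult)
      finally show "(\<integral>\<^sup>+t. ennreal (4 ^ k * (cmod (?d k t))\<^sup>2) \<partial>lebesgue) \<le> ennreal ((1/4) ^ k)"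
        by (simp add: mult_left_mono)
    qed
    also have "\<dots> = ennreal (\<Sum>k. (1/4) ^ k)"
      by (intro suminf_ennreal2 summable_geometric) auto
    finally show "(\<integral>\<^sup>+t. (\<Sum>k. ennreal (4 ^ k * (cmod (?d k t))\<^sup>2)) \<partial>lebesgue) \<noteq> \<infinity>"
      by (metis ennreal_less_top infinity_ennreal_def le_less_trans less_irrefl)
  qed measurable
  then have "AE t in lebesgue. convergent (\<lambda>k. rep_l2 (Y k) t)"
  proof eventually_elim
    case (elim t)
    define C where "C = enn2real (\<Sum>k. ennreal (4 ^ k * (cmod (?d k t))\<^sup>2))"
    have C: "0 \<le> C" "(\<Sum>k. ennreal (4 ^ k * (cmod (?d k t))\<^sup>2)) = ennreal C"
      using elim by (simp_all add: C_def ennreal_enn2real_if)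
    have bound: "cmod (?d k t) \<le> sqrt C * (1/2) ^ k" for k
    proof -
      have four: "((2::real) ^ k)\<^sup>2 = 4 ^ k"
        by (simp add: power2_eq_square flip: power_mult_distrib)
      have "ennreal (4 ^ k * (cmod (?d k t))\<^sup>2) \<le> ennreal C"
        using sum_le_suminf[of "\<lambda>k. ennreal (4 ^ k * (cmod (?d k t))\<^sup>2)" "{k}"] C(2) by simp
      then have "4 ^ k * (cmod (?d k t))\<^sup>2 \<le> C"
        using C(1) by (simp add: ennreal_le_iff)
      then have "(2 ^ k * cmod (?d k t))\<^sup>2 \<le> C"
        unfolding power_mult_distrib four .
      then have "2 ^ k * cmod (?d k t) \<le> sqrt C"
        by (rule real_le_rsqrt)
      then show ?thesis
        by (simp add: field_simps power_divide)
    qed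
    have "summable (\<lambda>k. ?d k t)"
      by (rule summable_comparison_test'[of "\<lambda>k. sqrt C * (1/2) ^ k" 0])
         (use bound in \<open>auto intro!: summable_mult summable_geometric\<close>)
    then have "convergent (\<lambda>n. rep_l2 (Y n) t - rep_l2 (Y 0) t)"
      by (simp add: summable_iff_convergent sum_lessThan_telescope[of "\<lambda>k. rep_l2 (Y k) t"])
    then show ?case
      by (simp add: convergent_diff_const_right_iff)
  qed
  from l2_tendsto_I[OF Y_Cauchy this] obtain L where "Y \<longlonglongrightarrow> L" ..
  then have "X \<longlonglongrightarrow> L"
    unfolding Y_def by (rule Cauchy_converges_subseq[OF X r])
  then show "convergent X"
    by (auto simp: convergent_def)
qed

section \<open>Integral operators\<close>

definition kernel_of :: "(real \<times> real \<Rightarrow> complex) \<Rightarrow> (l2 \<Rightarrow> l2) \<Rightarrow> bool" where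
  "kernel_of K T \<longleftrightarrow> K \<in> borel_measurable lebesgue \<and>
     (\<forall>f. AE s in lebesgue.
        integrable lebesgue (\<lambda>t. K (s, t) * rep_l2 f t) \<and>
        rep_l2 (T f) s = (\<integral>t. K (s, t) * rep_l2 f t \<partial>lebesgue))"

definition carleman_kernel :: "(real \<times> real \<Rightarrow> complex) \<Rightarrow> bool" where
  "carleman_kernel K \<longleftrightarrow> K \<in> borel_measurable lebesgue \<and>
     (AE s in lebesgue. square_integrable (\<lambda>t. K (s, t)))"

definition conj_transpose :: "(real \<times> real \<Rightarrow> complex) \<Rightarrow> real \<times> real \<Rightarrow> complex" where
  "conj_transpose K = (\<lambda>(s, t). cnj (K (t, s)))"

definition bi_carleman_kernel :: "(real \<times> real \<Rightarrow> complex) \<Rightarrow> bool" where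
  "bi_carleman_kernel K \<longleftrightarrow> carleman_kernel K \<and> carleman_kernel (conj_transpose K)"

section \<open>Smooth kernels\<close>

definition C0 :: "('a::topological_space \<Rightarrow> 'b::real_normed_vector) \<Rightarrow> bool" where
  "C0 f \<longleftrightarrow> continuous_on UNIV f \<and>
     (\<forall>\<epsilon>>0. \<exists>S. compact S \<and> (\<forall>x. x \<notin> S \<longrightarrow> norm (f x) < \<epsilon>))"

(* All iterated partial derivatives of order at most m exist, in whatever order the
   differentiations are carried out, and lie in C(R^2, C). *)
fun C0_partials :: "nat \<Rightarrow> (real \<times> real \<Rightarrow> complex) \<Rightarrow> bool" where
  "C0_partials 0 K \<longleftrightarrow> C0 K"
| "C0_partials (Suc m) K \<longleftrightarrow> C0 K \<and>
     (\<exists>K1 K2.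
        (\<forall>s t. ((\<lambda>x. K (x, t)) has_vector_derivative K1 (s, t)) (at s)) \<and>
        (\<forall>s t. ((\<lambda>y. K (s, y)) has_vector_derivative K2 (s, t)) (at t)) \<and>
        C0_partials m K1 \<and> C0_partials m K2)"

fun C0_derivs :: "nat \<Rightarrow> (real \<Rightarrow> 'b::real_normed_vector) \<Rightarrow> bool" where
  "C0_derivs 0 k \<longleftrightarrow> C0 k"
| "C0_derivs (Suc m) k \<longleftrightarrow> C0 k \<and>
     (\<exists>k'. (\<forall>s. (k has_vector_derivative k' s) (at s)) \<and> C0_derivs m k')"

definition carleman_fun :: "(real \<times> real \<Rightarrow> complex) \<Rightarrow> real \<Rightarrow> l2" where
  "carleman_fun K s = abs_l2 (\<lambda>t. cnj (K (s, t)))"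

(* abs_l2 is meaningful only on square-integrable functions, hence the first conjunct. *)
definition smooth_carleman_fun :: "nat \<Rightarrow> (real \<times> real \<Rightarrow> complex) \<Rightarrow> bool" where
  "smooth_carleman_fun m K \<longleftrightarrow>
     (\<forall>s. square_integrable (\<lambda>t. cnj (K (s, t)))) \<and> C0_derivs m (carleman_fun K)"

definition Km_kernel :: "nat \<Rightarrow> (real \<times> real \<Rightarrow> complex) \<Rightarrow> bool" where
  "Km_kernel m K \<longleftrightarrow>
     C0_partials m K \<and> smooth_carleman_fun m K \<and> smooth_carleman_fun m (conj_transpose K)"

definition Kinf_kernel :: "(real \<times> real \<Rightarrow> complex) \<Rightarrow> bool" where
  "Kinf_kernel K \<longleftrightarrow> (\<forall>m. Km_kernel m K)"

section \<open>Kernels of Mercer type\<close>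

definition mercer_set :: "('a::complex_hilbert \<Rightarrow> 'a) \<Rightarrow> ('a \<Rightarrow> 'a) set" where
  "mercer_set T =
     ({T \<circ> A |A. bounded_clinear A} \<union> {cadjoint T \<circ> A |A. bounded_clinear A}) \<inter>
     ({A \<circ> cadjoint T |A. bounded_clinear A} \<union> {A \<circ> T |A. bounded_clinear A})"

(* A K-infinity kernel need not induce a bounded operator on all of L2; that it does is
   part of the notion.  The induced operator T is determined by K. *)
definition mercer_type :: "(real \<times> real \<Rightarrow> complex) \<Rightarrow> bool" where
  "mercer_type K \<longleftrightarrow> Kinf_kernel K \<and>
     (\<exists>T. bounded_clinear T \<and> kernel_of K T \<and>
        (\<forall>A\<in>mercer_set T. \<exists>K'. Kinf_kernel K' \<and> kernel_of K' A))"

definition bi_carleman_mercer_operator :: "(l2 \<Rightarrow> l2) \<Rightarrow> bool" where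
  "bi_carleman_mercer_operator T \<longleftrightarrow>
     (\<exists>K. kernel_of K T \<and> bi_carleman_kernel K \<and> mercer_type K)"

end

theory Submission
  imports Defs
begin

text \<open>
  The operators in question satisfy \<open>\<parallel>T (e n)\<parallel>, \<parallel>T\<^sup>* (e n)\<parallel> \<le> C\<^sub>T d n\<close> with a common null sequence \<open>d\<close>, and
  so does every \<open>A \<in> \<M>(T)\<close>, because \<open>A\<close> has \<open>T\<close> or \<open>T\<^sup>*\<close> as a right factor and \<open>A\<^sup>*\<close> does too. It
  therefore suffices to find one unitary operator carrying all operators with such a bound to
  integral operators with \<open>K\<^sup>\<infinity>\<close>-kernels.

  Take an orthonormal basis \<open>u\<close> of \<open>L\<^sub>2\<close> consisting of compactly supported smooth functions, half of
  which are such wide and flat bumps that the suprema of all their derivatives are summable;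
  everything orthogonal to these bumps is filled in by Gram-Schmidt, with no control on the size.
  A subsequence of \<open>e\<close> along which \<open>d\<close> decays fast enough is sent to the uncontrolled half of \<open>u\<close>,
  and the rest of an orthonormal basis of \<open>\<H>\<close>, on which the operators are merely bounded, is sent to
  the flat bumps. The matrix entries of \<open>A\<close> in the basis \<open>u\<close> are then bounded by \<open>C q\<^sub>m q\<^sub>n\<close>, where
  \<open>\<Sum> q\<^sub>n sup \<bar>u\<^sub>n\<^sup>(\<^sup>i\<^sup>)\<bar> < \<infinity>\<close> for every \<open>i\<close>, so \<open>\<Sum> \<langle>A u\<^sub>n, u\<^sub>m\<rangle> u\<^sub>m(s) cnj (u\<^sub>n(t))\<close> converges uniformly with
  all its derivatives.
\<close>

section \<open>Complex inner product spaces\<close>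

text \<open>Opens the Banach-space results on series, applied later to series with values in
  \<open>l2\<close>.\<close>

instance complex_hilbert \<subseteq> banach ..

lemma scaleC_one [simp]: "1 *\<^sub>C x = x" for x :: "'a::complex_inner"
  using scaleR_scaleC[of 1 x] by simp

lemma scaleC_zero_left [simp]: "0 *\<^sub>C x = 0" for x :: "'a::complex_inner"
  using scaleR_scaleC[of 0 x] by simp

lemma scaleC_zero_right [simp]: "c *\<^sub>C 0 = 0" for c
  using scaleC_add_right[of c 0 0] by simp

lemma scaleC_minus_one: "(- 1) *\<^sub>C x = - x" for x :: "'a::complex_inner"
  using scaleR_scaleC[of "-1" x] by simp

lemma cinner_add_right: "cinner x (y + z) = cinner x y + cinner x z"
  by (metis cinner_add_left cinner_commute complex_cnj_add)

lemma cinner_scaleC_right: "cinner x (c *\<^sub>C y) = cnj c * cinner x y"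
  by (metis cinner_commute cinner_scaleC_left complex_cnj_mult)

lemma cinner_zero_left [simp]: "cinner 0 y = 0"
  using cinner_scaleC_left[of 0 0 y] by simp

lemma cinner_zero_right [simp]: "cinner x 0 = 0"
  using cinner_scaleC_right[of x 0 0] by simp

lemma cinner_minus_left: "cinner (- x) y = - cinner x y"
  using cinner_scaleC_left[of "-1" x y] by (simp add: scaleC_minus_one)

lemma cinner_minus_right: "cinner x (- y) = - cinner x y"
  using cinner_scaleC_right[of x "-1" y] by (simp add: scaleC_minus_one)

lemma cinner_diff_left: "cinner (x - y) z = cinner x z - cinner y z"
  using cinner_add_left[of x "- y" z] by (simp add: cinner_minus_left)

lemma cinner_diff_right: "cinner x (y - z) = cinner x y - cinner x z"
  using cinner_add_right[of x y "- z"] by (simp add: cinner_minus_right)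

lemma cinner_self: "cinner x x = complex_of_real ((norm x)\<^sup>2)"
proof (rule complex_eqI)
  show "Re (cinner x x) = Re (complex_of_real ((norm x)\<^sup>2))"
    by (simp add: power2_norm_eq_inner inner_eq_Re_cinner)
  show "Im (cinner x x) = Im (complex_of_real ((norm x)\<^sup>2))"
    using arg_cong[OF cinner_commute[of x x], of Im] by simp
qed

lemma cinner_self_eq_0 [simp]: "cinner x x = 0 \<longleftrightarrow> x = 0"
  by (simp add: cinner_self)

lemma norm_scaleC [simp]: "norm (c *\<^sub>C x) = cmod c * norm x" for x :: "'a::complex_inner"
proof (rule power2_eq_imp_eq)
  have "complex_of_real ((norm (c *\<^sub>C x))\<^sup>2) = complex_of_real ((cmod c * norm x)\<^sup>2)"
    unfolding cinner_self[symmetric] cinner_scaleC_left cinner_scaleC_right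
    by (simp add: cinner_self power_mult_distrib complex_norm_square mult.commute del: of_real_power)
  then show "(norm (c *\<^sub>C x))\<^sup>2 = (cmod c * norm x)\<^sup>2"
    by (simp only: of_real_eq_iff)
qed auto

lemma norm_cinner_le: "cmod (cinner x y) \<le> norm x * norm y"
proof (cases "cinner x y = 0")
  case False
  \<comment> \<open>A unimodular factor that turns the inner product into its modulus, so that the
    real Cauchy-Schwarz inequality applies.\<close>
  define c where "c = cnj (cinner x y) / cmod (cinner x y)"
  have c: "cmod c = 1" using False by (simp add: c_def norm_divide)
  have "cinner (c *\<^sub>C x) y = cinner x y * cnj (cinner x y) / complex_of_real (cmod (cinner x y))"
    by (simp add: cinner_scaleC_left c_def mult.commute)
  also have "\<dots> = complex_of_real (cmod (cinner x y))"
    using False by (simp flip: complex_norm_square) (simp add: power2_eq_square)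
  finally have "cinner (c *\<^sub>C x) y = complex_of_real (cmod (cinner x y))" .
  then have "cmod (cinner x y) = inner (c *\<^sub>C x) y"
    by (simp add: inner_eq_Re_cinner)
  also have "\<dots> \<le> norm (c *\<^sub>C x) * norm y" by (rule norm_cauchy_schwarz)
  finally show ?thesis by (simp add: c)
qed simp

lemma bounded_linear_cinner_left: "bounded_linear (\<lambda>x. cinner x y)"
proof (rule bounded_linear_intro[where K="norm y"])
  show "cinner (r *\<^sub>R x) y = r *\<^sub>R cinner x y" for r x
    by (simp add: scaleR_scaleC cinner_scaleC_left scaleR_conv_of_real)
qed (auto simp: cinner_add_left norm_cinner_le)

lemma bounded_linear_cinner_right: "bounded_linear (\<lambda>y. cinner x y)"
proof (rule bounded_linear_intro[where K="norm x"])
  show "cinner x (r *\<^sub>R y) = r *\<^sub>R cinner x y" for r y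
    by (simp add: scaleR_scaleC cinner_scaleC_right scaleR_conv_of_real)
  show "cmod (cinner x y) \<le> norm y * norm x" for y
    using norm_cinner_le[of x y] by (simp add: mult.commute)
qed (auto simp: cinner_add_right)

lemma bounded_linear_scaleC_left: "bounded_linear (\<lambda>c. c *\<^sub>C x)" for x :: "'a::complex_inner"
proof (rule bounded_linear_intro[where K="norm x"])
  show "(r *\<^sub>R c) *\<^sub>C x = r *\<^sub>R c *\<^sub>C x" for r c
    by (simp add: scaleR_scaleC scaleC_scaleC scaleR_conv_of_real)
qed (auto simp: scaleC_add_left)

lemma bounded_linear_scaleC_right: "bounded_linear (\<lambda>x::'a::complex_inner. c *\<^sub>C x)"
proof (rule bounded_linear_intro[where K="cmod c"])
  show "c *\<^sub>C (r *\<^sub>R x) = r *\<^sub>R c *\<^sub>C x" for r and x :: 'a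
    by (simp add: scaleR_scaleC scaleC_scaleC mult.commute)
qed (auto simp: scaleC_add_right mult.commute)

lemmas cinner_sum_left = linear_sum[OF bounded_linear.linear[OF bounded_linear_cinner_left]]
lemmas cinner_sum_right = linear_sum[OF bounded_linear.linear[OF bounded_linear_cinner_right]]
lemmas sums_cinner_left = bounded_linear.sums[OF bounded_linear_cinner_left]
lemmas sums_cinner_right = bounded_linear.sums[OF bounded_linear_cinner_right]

section \<open>Orthonormal bases\<close>

lemma orthonormal_seq_norm: "orthonormal_seq b \<Longrightarrow> norm (b n) = 1"
  unfolding norm_eq_sqrt_cinner by (simp add: orthonormal_seq_def)

lemma orthonormal_cinner_sum:
  assumes "orthonormal_seq b" "finite F"
  shows "cinner (\<Sum>n\<in>F. a n *\<^sub>C b n) (b m) = (if m \<in> F then a m else 0)"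
proof -
  have "cinner (\<Sum>n\<in>F. a n *\<^sub>C b n) (b m) = (\<Sum>n\<in>F. if n = m then a n else 0)"
    using assms(1) unfolding cinner_sum_left
    by (intro sum.cong) (auto simp: cinner_scaleC_left orthonormal_seq_def)
  then show ?thesis using assms(2) by simp
qed

lemma orthonormal_cinner_sum_sum:
  assumes "orthonormal_seq b" "finite F"
  shows "cinner (\<Sum>n\<in>F. a n *\<^sub>C b n) (\<Sum>n\<in>F. c n *\<^sub>C b n) = (\<Sum>n\<in>F. a n * cnj (c n))"
  using assms by (simp add: cinner_sum_right cinner_scaleC_right orthonormal_cinner_sum mult.commute)

lemma orthonormal_norm_sum:
  assumes "orthonormal_seq b" "finite F"
  shows "(norm (\<Sum>n\<in>F. a n *\<^sub>C b n))\<^sup>2 = (\<Sum>n\<in>F. (cmod (a n))\<^sup>2)"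
proof -
  have "complex_of_real ((norm (\<Sum>n\<in>F. a n *\<^sub>C b n))\<^sup>2) = complex_of_real (\<Sum>n\<in>F. (cmod (a n))\<^sup>2)"
    unfolding cinner_self[symmetric] orthonormal_cinner_sum_sum[OF assms]
    by (simp add: complex_norm_square del: of_real_power)
  then show ?thesis by (simp only: of_real_eq_iff)
qed

text \<open>The partial Fourier sum p satisfies <p, p> = <x, p>, so Cauchy-Schwarz gives |p| \<le>
  |x|; by Pythagoras the left side is |p|^2.\<close>

lemma bessel:
  assumes b: "orthonormal_seq b" and F: "finite F"
  shows "(\<Sum>n\<in>F. (cmod (cinner x (b n)))\<^sup>2) \<le> (norm x)\<^sup>2"
proof -
  define p where "p = (\<Sum>n\<in>F. cinner x (b n) *\<^sub>C b n)"
  have "cinner p p = cinner x p"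
    unfolding p_def orthonormal_cinner_sum_sum[OF b F]
    by (simp add: cinner_sum_right cinner_scaleC_right mult.commute)
  then have "(norm p)\<^sup>2 = inner x p"
    unfolding inner_eq_Re_cinner by (metis cinner_self Re_complex_of_real)
  also have "\<dots> \<le> norm x * norm p" by (rule norm_cauchy_schwarz)
  finally have "norm p \<le> norm x"
    by (cases "norm p = 0") (auto simp: power2_eq_square)
  then have "(norm p)\<^sup>2 \<le> (norm x)\<^sup>2" by (simp add: power_mono)
  then show ?thesis unfolding p_def orthonormal_norm_sum[OF b F] .
qed

lemma summable_bessel:
  assumes "orthonormal_seq b"
  shows "summable (\<lambda>n. (cmod (cinner x (b n)))\<^sup>2)"
  by (rule bounded_imp_summable[where B="(norm x)\<^sup>2"]) (auto intro: bessel[OF assms])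

text \<open>Each block of the vector series has squared norm equal to the same block of the
  numerical series, so the Cauchy criterion carries over.\<close>

lemma summable_orthonormal:
  fixes b :: "nat \<Rightarrow> 'a::complex_hilbert"
  assumes b: "orthonormal_seq b" and a: "summable (\<lambda>n. (cmod (a n))\<^sup>2)"
  shows "summable (\<lambda>n. a n *\<^sub>C b n)"
  unfolding summable_Cauchy
proof (intro allI impI)
  fix e :: real assume "0 < e"
  then obtain N where N: "\<And>m n. N \<le> m \<Longrightarrow> norm (\<Sum>k=m..<n. (cmod (a k))\<^sup>2) < e\<^sup>2"
    using a unfolding summable_Cauchy by (meson zero_less_power)
  show "\<exists>N. \<forall>m\<ge>N. \<forall>n. norm (\<Sum>k=m..<n. a k *\<^sub>C b k) < e"
  proof (intro exI allI impI)
    fix m n assume "N \<le> m"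
    then have "(norm (\<Sum>k=m..<n. a k *\<^sub>C b k))\<^sup>2 < e\<^sup>2"
      using N[of m n] by (simp add: orthonormal_norm_sum[OF b])
    then show "norm (\<Sum>k=m..<n. a k *\<^sub>C b k) < e"
      using \<open>0 < e\<close> by (simp add: power_less_imp_less_base)
  qed
qed

lemma orthonormal_cinner_suminf:
  fixes b :: "nat \<Rightarrow> 'a::complex_hilbert"
  assumes b: "orthonormal_seq b" and a: "summable (\<lambda>n. (cmod (a n))\<^sup>2)"
  shows "cinner (\<Sum>n. a n *\<^sub>C b n) (b m) = a m"
proof -
  have "(\<lambda>n. cinner (a n *\<^sub>C b n) (b m)) sums cinner (\<Sum>n. a n *\<^sub>C b n) (b m)"
    by (intro sums_cinner_left summable_sums summable_orthonormal assms)
  moreover have "(\<lambda>n. cinner (a n *\<^sub>C b n) (b m)) = (\<lambda>n. if n = m then a n else 0)"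
    using b by (auto simp: cinner_scaleC_left orthonormal_seq_def fun_eq_iff)
  moreover have "(\<lambda>n. if n = m then a n else 0) sums a m" by (rule sums_single)
  ultimately show ?thesis using sums_unique2 by metis
qed

text \<open>Completeness is phrased as a trivial orthogonal complement, the form that the
  constructions below verify directly; \<open>orthonormal_expansion\<close> recovers convergent
  expansions.\<close>

definition orthonormal_basis :: "(nat \<Rightarrow> 'a::complex_inner) \<Rightarrow> bool" where
  "orthonormal_basis b \<longleftrightarrow> orthonormal_seq b \<and> (\<forall>x. (\<forall>n. cinner x (b n) = 0) \<longrightarrow> x = 0)"

lemma orthonormal_basisD: "orthonormal_basis b \<Longrightarrow> orthonormal_seq b"
  by (simp add: orthonormal_basis_def)

lemma orthonormal_basis_eqI:
  assumes "orthonormal_basis b" "\<And>n. cinner x (b n) = cinner y (b n)"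
  shows "x = y"
  using assms(1) assms(2)[THEN eq_iff_diff_eq_0[THEN iffD1]]
  unfolding orthonormal_basis_def cinner_diff_left[symmetric] by fastforce

text \<open>The Fourier series converges by Bessel, its sum has the same coefficients as x, and
  totality forces the two to coincide.\<close>

lemma orthonormal_expansion:
  fixes b :: "nat \<Rightarrow> 'a::complex_hilbert"
  assumes b: "orthonormal_basis b"
  shows "(\<lambda>n. cinner x (b n) *\<^sub>C b n) sums x"
proof -
  note b' = orthonormal_basisD[OF b]
  have "(\<Sum>n. cinner x (b n) *\<^sub>C b n) = x"
    by (rule orthonormal_basis_eqI[OF b])
       (simp add: orthonormal_cinner_suminf[OF b' summable_bessel[OF b']])
  then show ?thesis
    using summable_sums[OF summable_orthonormal[OF b' summable_bessel[OF b', of x]]] by simp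
qed

section \<open>Bounded complex-linear maps and the unitary operator between two bases\<close>

lemma bounded_clinearI:
  assumes "\<And>x y. T (x + y) = T x + T y" "\<And>c x. T (c *\<^sub>C x) = c *\<^sub>C T x"
    and "\<And>x. norm (T x) \<le> K * norm x"
  shows "bounded_clinear T"
  unfolding bounded_clinear_def
  by (intro conjI allI bounded_linear_intro[where K=K])
     (auto simp: assms scaleR_scaleC mult.commute)

lemma bounded_clinear_imp_bounded_linear: "bounded_clinear T \<Longrightarrow> bounded_linear T"
  by (simp add: bounded_clinear_def)

lemma bounded_clinear_scaleC: "bounded_clinear T \<Longrightarrow> T (c *\<^sub>C x) = c *\<^sub>C T x"
  by (simp add: bounded_clinear_def)

lemma bounded_clinear_add: "bounded_clinear T \<Longrightarrow> T (x + y) = T x + T y"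
  by (simp add: bounded_clinear_def bounded_linear.linear linear_add)

lemma bounded_clinear_bound:
  assumes "bounded_clinear T"
  obtains K where "0 \<le> K" "\<And>x. norm (T x) \<le> K * norm x"
  using bounded_linear.nonneg_bounded[of T] assms
  unfolding bounded_clinear_def by (metis mult.commute)

lemma bounded_clinear_compose:
  assumes "bounded_clinear S" "bounded_clinear T"
  shows "bounded_clinear (S \<circ> T)"
  using assms unfolding bounded_clinear_def comp_def
  by (auto intro: bounded_linear_compose)

text \<open>U and V carry Fourier coefficients from one basis to the other and back. Algebraic
  identities are checked coefficientwise; preservation of inner products is Parseval's identity in
  both bases.\<close>

lemma exists_unitary_between_bases:
  fixes b :: "nat \<Rightarrow> 'a::complex_hilbert" and u :: "nat \<Rightarrow> 'b::complex_hilbert"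
  assumes b: "orthonormal_basis b" and u: "orthonormal_basis u"
  shows "\<exists>U. unitary U \<and> (\<forall>n. U (b n) = u n)"
proof -
  note b' = orthonormal_basisD[OF b] and u' = orthonormal_basisD[OF u]
  define U where "U x = (\<Sum>n. cinner x (b n) *\<^sub>C u n)" for x
  define V where "V y = (\<Sum>n. cinner y (u n) *\<^sub>C b n)" for y
  have U: "cinner (U x) (u n) = cinner x (b n)" for x n
    unfolding U_def by (rule orthonormal_cinner_suminf[OF u' summable_bessel[OF b']])
  have V: "cinner (V y) (b n) = cinner y (u n)" for y n
    unfolding V_def by (rule orthonormal_cinner_suminf[OF b' summable_bessel[OF u']])
  have UV: "U (V y) = y" for y by (rule orthonormal_basis_eqI[OF u]) (simp add: U V)
  have VU: "V (U x) = x" for x by (rule orthonormal_basis_eqI[OF b]) (simp add: U V)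
  have Ub: "U (b n) = u n" for n
    by (rule orthonormal_basis_eqI[OF u]) (use b' u' in \<open>simp add: U orthonormal_seq_def\<close>)
  have add: "U (x + y) = U x + U y" for x y
    by (rule orthonormal_basis_eqI[OF u]) (simp add: U cinner_add_left)
  have scale: "U (c *\<^sub>C x) = c *\<^sub>C U x" for c x
    by (rule orthonormal_basis_eqI[OF u]) (simp add: U cinner_scaleC_left)
  have parseval: "(\<lambda>n. cinner x (b n) * cnj (cinner y (b n))) sums cinner x y" for x y
    using sums_cinner_left[OF orthonormal_expansion[OF b, of x], of y]
    by (simp add: cinner_scaleC_left cinner_commute[of "b _" y])
  have parseval': "(\<lambda>n. cinner x (u n) * cnj (cinner y (u n))) sums cinner x y" for x y
    using sums_cinner_left[OF orthonormal_expansion[OF u, of x], of y]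
    by (simp add: cinner_scaleC_left cinner_commute[of "u _" y])
  have iso: "cinner (U x) (U y) = cinner x y" for x y
    using parseval[of x y] parseval'[of "U x" "U y"] by (simp add: U sums_unique2)
  have "norm (U x) = norm x" for x by (simp add: norm_eq_sqrt_cinner iso)
  then have "bounded_clinear U" by (intro bounded_clinearI[where K=1]) (auto simp: add scale)
  moreover have "bij U" by (rule bijI') (metis VU, metis UV)
  ultimately show ?thesis using iso Ub unfolding unitary_def by blast
qed

section \<open>Adjoints\<close>

text \<open>Turns the definite description in \<open>cadjoint\<close> into an equation: the values
  of two candidates differ by a vector orthogonal to every vector, hence to itself.\<close>

lemma cadjoint_eqI:
  assumes "\<And>x y. cinner (T x) y = cinner x (S y)"
  shows "cadjoint T = S"
  unfolding cadjoint_def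
proof (rule the_equality)
  fix S' assume "\<forall>x y. cinner (T x) y = cinner x (S' y)"
  then have "cinner x (S' y) = cinner x (S y)" for x y using assms by simp
  then have "cinner (S' y - S y) (S' y - S y) = 0" for y by (simp add: cinner_diff_right)
  then show "S' = S" by (auto simp: fun_eq_iff)
qed (simp add: assms)

text \<open>The adjoint is written down from a basis of the domain: its Fourier coefficients have to
  be \<open>cinner y (T (b n))\<close>, and the work lies in their square summability.\<close>

lemma cinner_cadjoint:
  fixes b :: "nat \<Rightarrow> 'a::complex_hilbert" and T :: "'a \<Rightarrow> 'b::complex_hilbert"
  assumes b: "orthonormal_basis b" and T: "bounded_clinear T"
  shows "cinner (T x) y = cinner x (cadjoint T y)"
proof -
  note b' = orthonormal_basisD[OF b]
  interpret T: bounded_linear T using T by (rule bounded_clinear_imp_bounded_linear)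
  obtain K where K: "0 \<le> K" "\<And>x. norm (T x) \<le> K * norm x"
    using bounded_clinear_bound[OF T] by blast
  define S where "S y = (\<Sum>n. cinner y (T (b n)) *\<^sub>C b n)" for y
  \<comment> \<open>Testing T on the partial sum p gives |p|^2 = <y, T p> \<le> K |y| |p|, hence a
    bound independent of F.\<close>
  have bound: "(\<Sum>n\<in>F. (cmod (cinner y (T (b n))))\<^sup>2) \<le> (K * norm y)\<^sup>2" if F: "finite F" for F y
  proof -
    define p where "p = (\<Sum>n\<in>F. cinner y (T (b n)) *\<^sub>C b n)"
    have p: "(norm p)\<^sup>2 = (\<Sum>n\<in>F. (cmod (cinner y (T (b n))))\<^sup>2)"
      unfolding p_def by (rule orthonormal_norm_sum[OF b' F])
    have "T p = (\<Sum>n\<in>F. cinner y (T (b n)) *\<^sub>C T (b n))"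
      by (simp add: p_def T.sum bounded_clinear_scaleC[OF T])
    then have "cinner y (T p) = complex_of_real ((norm p)\<^sup>2)"
      unfolding p by (simp add: cinner_sum_right cinner_scaleC_right complex_norm_square mult.commute
          del: of_real_power)
    then have "(norm p)\<^sup>2 = cmod (cinner y (T p))" by (simp add: norm_power)
    also have "\<dots> \<le> norm y * (K * norm p)"
      by (rule order_trans[OF norm_cinner_le mult_left_mono[OF K(2)]]) simp
    finally have "norm p \<le> K * norm y"
      using K(1) by (cases "norm p = 0") (auto simp: power2_eq_square mult_ac)
    then show ?thesis unfolding p[symmetric] by (simp add: power_mono)
  qed
  have sm: "summable (\<lambda>n. (cmod (cinner y (T (b n))))\<^sup>2)" for y
    by (rule bounded_imp_summable[where B="(K * norm y)\<^sup>2"]) (auto intro: bound)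
  have "cinner (T x) y = cinner x (S y)" for x y
  proof -
    have "(\<lambda>n. cinner (T (cinner x (b n) *\<^sub>C b n)) y) sums cinner (T x) y"
      by (intro sums_cinner_left T.sums orthonormal_expansion b)
    moreover have "(\<lambda>n. cinner (cinner x (b n) *\<^sub>C b n) (S y)) sums cinner x (S y)"
      by (intro sums_cinner_left orthonormal_expansion b)
    moreover have "cinner (b n) (S y) = cinner (T (b n)) y" for n
      using orthonormal_cinner_suminf[OF b' sm] unfolding S_def by (metis cinner_commute)
    ultimately show ?thesis
      by (simp add: bounded_clinear_scaleC[OF T] cinner_scaleC_left sums_unique2)
  qed
  then show ?thesis using cadjoint_eqI[of T S] by simp
qed

lemma bounded_clinear_cadjoint:
  fixes b :: "nat \<Rightarrow> 'a::complex_hilbert" and T :: "'a \<Rightarrow> 'b::complex_hilbert"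
  assumes b: "orthonormal_basis b" and T: "bounded_clinear T"
  shows "bounded_clinear (cadjoint T)"
proof -
  note adj = cinner_cadjoint[OF assms]
  obtain K where K: "0 \<le> K" "\<And>x. norm (T x) \<le> K * norm x"
    using bounded_clinear_bound[OF T] by blast
  have eqI: "v = w" if "\<And>x. cinner x v = cinner x w" for v w :: 'a
    using that[of "v - w"] by (metis cinner_diff_right cinner_self_eq_0 eq_iff_diff_eq_0)
  show ?thesis
  proof (rule bounded_clinearI[where K=K])
    show "cadjoint T (x + y) = cadjoint T x + cadjoint T y" for x y
      by (rule eqI) (simp add: adj[symmetric] cinner_add_right)
    show "cadjoint T (c *\<^sub>C x) = c *\<^sub>C cadjoint T x" for c x
      by (rule eqI) (simp add: adj[symmetric] cinner_scaleC_right)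
    fix y
    have "(norm (cadjoint T y))\<^sup>2 = cmod (cinner (T (cadjoint T y)) y)"
      by (simp add: adj cinner_self norm_power)
    also have "\<dots> \<le> K * norm (cadjoint T y) * norm y"
      by (rule order_trans[OF norm_cinner_le mult_right_mono[OF K(2)]]) simp
    finally show "norm (cadjoint T y) \<le> K * norm y"
      using K(1) by (cases "norm (cadjoint T y) = 0") (auto simp: power2_eq_square mult_ac)
  qed
qed

section \<open>Completing orthonormal sequences to bases\<close>

text \<open>\<open>sgn\<close> normalises and sends 0 to 0, so a vector depending linearly on its
  predecessors yields 0 and dependent input is allowed.\<close>

fun gram_schmidt :: "(nat \<Rightarrow> 'a::complex_inner) \<Rightarrow> nat \<Rightarrow> 'a" where
  "gram_schmidt w n =
     sgn (w n - (\<Sum>k<n. cinner (w n) (gram_schmidt w k) *\<^sub>C gram_schmidt w k))"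

declare gram_schmidt.simps [simp del]

lemma sgn_eq_scaleC: "sgn x = complex_of_real (inverse (norm x)) *\<^sub>C x" for x :: "'a::complex_inner"
  by (simp add: sgn_div_norm scaleR_scaleC divide_inverse)

text \<open>Subtracting the projections leaves <w n, g m> (1 - |g m|^2), which vanishes because each
  g m is either 0 or a unit vector.\<close>

lemma gram_schmidt_orthogonal:
  assumes "m < n" shows "cinner (gram_schmidt w n) (gram_schmidt w m) = 0"
  using assms
proof (induction n arbitrary: m rule: less_induct)
  case (less n)
  let ?g = "gram_schmidt w"
  have orth: "cinner (?g k) (?g m) = (if k = m then complex_of_real ((norm (?g m))\<^sup>2) else 0)"
    if "k < n" for k
    using less.IH[of k m] less.IH[of m k] less.prems that cinner_commute[of "?g k" "?g m"]
    by (cases k m rule: linorder_cases) (auto simp: cinner_self)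
  have "cinner (w n - (\<Sum>k<n. cinner (w n) (?g k) *\<^sub>C ?g k)) (?g m)
      = cinner (w n) (?g m) * (1 - complex_of_real ((norm (?g m))\<^sup>2))"
  proof -
    have "(\<Sum>k<n. cinner (cinner (w n) (?g k) *\<^sub>C ?g k) (?g m))
        = (\<Sum>k<n. if k = m then cinner (w n) (?g m) * complex_of_real ((norm (?g m))\<^sup>2) else 0)"
      by (intro sum.cong) (auto simp: cinner_scaleC_left orth)
    then show ?thesis
      using less.prems by (simp add: cinner_diff_left cinner_sum_left algebra_simps)
  qed
  also have "\<dots> = 0"
    by (cases "?g m = 0") (auto simp: gram_schmidt.simps[of w m] norm_sgn split: if_splits)
  finally show ?case
    by (simp add: gram_schmidt.simps[of w n] sgn_eq_scaleC cinner_scaleC_left)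
qed

text \<open>\<open>w n\<close> is a linear combination of the Gram-Schmidt vectors with indices up
  to n.\<close>

lemma gram_schmidt_total:
  assumes "\<And>n. cinner x (gram_schmidt w n) = 0"
  shows "cinner x (w n) = 0"
proof -
  let ?v = "w n - (\<Sum>k<n. cinner (w n) (gram_schmidt w k) *\<^sub>C gram_schmidt w k)"
  have "cinner x ?v = 0"
    using assms[of n] by (auto simp: gram_schmidt.simps[of w n] sgn_eq_scaleC cinner_scaleC_right)
  then show ?thesis
    by (simp add: cinner_diff_right cinner_sum_right cinner_scaleC_right assms)
qed

lemma gram_schmidt_in_subspace:
  assumes "\<And>n. w n \<in> V" and add: "\<And>x y. x \<in> V \<Longrightarrow> y \<in> V \<Longrightarrow> x + y \<in> V"
    and scale: "\<And>c x. x \<in> V \<Longrightarrow> c *\<^sub>C x \<in> V"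
  shows "gram_schmidt w n \<in> V"
proof (induction n rule: less_induct)
  case (less n)
  have zero: "0 \<in> V" using scale[OF assms(1)[of 0], of 0] by simp
  have "(\<Sum>k\<in>F. cinner (w n) (gram_schmidt w k) *\<^sub>C gram_schmidt w k) \<in> V"
    if "finite F" "F \<subseteq> {..<n}" for F
    using that by (induction) (auto intro!: zero add scale less.IH)
  from add[OF assms(1)[of n] scale[OF this[of "{..<n}"], of "-1"]] show ?case
    unfolding gram_schmidt.simps[of w n] sgn_eq_scaleC by (intro scale) (simp add: scaleC_minus_one)
qed

lemma norm_gram_schmidt: "gram_schmidt w n \<noteq> 0 \<Longrightarrow> norm (gram_schmidt w n) = 1"
  by (auto simp: gram_schmidt.simps[of w n] norm_sgn)

text \<open>Takes the nonzero Gram-Schmidt vectors: a set rather than a sequence, since there may be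
  only finitely many. V is just a linear subspace, which suits spaces of test functions.\<close>

lemma exists_orthonormal_set:
  fixes w :: "nat \<Rightarrow> 'a::complex_inner"
  assumes "\<And>n. w n \<in> V" and "\<And>x y. x \<in> V \<Longrightarrow> y \<in> V \<Longrightarrow> x + y \<in> V"
    and "\<And>c x. x \<in> V \<Longrightarrow> c *\<^sub>C x \<in> V"
  shows "\<exists>B. countable B \<and> B \<subseteq> V \<and> (\<forall>x\<in>B. \<forall>y\<in>B. cinner x y = (if x = y then 1 else 0)) \<and>
    (\<forall>x. (\<forall>y\<in>B. cinner x y = 0) \<longrightarrow> (\<forall>n. cinner x (w n) = 0))"
proof (intro exI conjI)
  let ?B = "range (gram_schmidt w) - {0}"
  show "countable ?B" by auto
  show "?B \<subseteq> V" using gram_schmidt_in_subspace[OF assms] by auto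
  have "norm x = 1" if "x \<in> ?B" for x
    using that norm_gram_schmidt[of w] by auto
  moreover have "cinner (gram_schmidt w m) (gram_schmidt w n) = 0" if "m \<noteq> n" for m n
    using gram_schmidt_orthogonal[of m n w] gram_schmidt_orthogonal[of n m w] that
      cinner_commute[of "gram_schmidt w m" "gram_schmidt w n"]
    by (cases m n rule: linorder_cases) auto
  ultimately show "\<forall>x\<in>?B. \<forall>y\<in>?B. cinner x y = (if x = y then 1 else 0)"
    by (auto simp: cinner_self) (metis)
  show "\<forall>x. (\<forall>y\<in>?B. cinner x y = 0) \<longrightarrow> (\<forall>n. cinner x (w n) = 0)"
  proof (intro allI impI)
    fix x n assume *: "\<forall>y\<in>?B. cinner x y = 0"
    have "cinner x (gram_schmidt w k) = 0" for k
      using * by (cases "gram_schmidt w k = 0") auto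
    then show "cinner x (w n) = 0" by (rule gram_schmidt_total)
  qed
qed

text \<open>Gram-Schmidt is applied to a countable dense set after subtracting projections onto the
  closed span of e, so the new vectors stay orthogonal to e.\<close>

lemma separable_orthonormal_completion:
  fixes e :: "nat \<Rightarrow> 'a::complex_hilbert"
  assumes sep: "separable_space (euclidean :: 'a topology)" and e: "orthonormal_seq e"
  shows "\<exists>B. countable B \<and> (\<forall>x\<in>B. \<forall>y\<in>B. cinner x y = (if x = y then 1 else 0)) \<and>
    (\<forall>x\<in>B. \<forall>n. cinner x (e n) = 0) \<and>
    (\<forall>x. (\<forall>y\<in>B. cinner x y = 0) \<longrightarrow> (\<forall>n. cinner x (e n) = 0) \<longrightarrow> x = 0)"
proof -
  obtain D :: "'a set" where D: "countable D" "closure D = UNIV"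
    using sep unfolding separable_space_def by auto
  then have "D \<noteq> {}" by auto
  define d where "d = from_nat_into D"
  have d: "range d = D" unfolding d_def by (rule range_from_nat_into[OF \<open>D \<noteq> {}\<close> D(1)])
  define V where "V = {x. \<forall>n. cinner x (e n) = 0}"
  define P where "P x = (\<Sum>n. cinner x (e n) *\<^sub>C e n)" for x
  have P: "cinner (P x) (e n) = cinner x (e n)" for x n
    unfolding P_def by (rule orthonormal_cinner_suminf[OF e summable_bessel[OF e]])
  have PV: "d n - P (d n) \<in> V" for n by (simp add: V_def cinner_diff_left P)
  have VP: "cinner x (P y) = 0" if "x \<in> V" for x y
  proof -
    have "(\<lambda>n. cinner x (cinner y (e n) *\<^sub>C e n)) sums cinner x (P y)"
      unfolding P_def
      by (intro sums_cinner_right summable_sums summable_orthonormal e summable_bessel)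
    then show ?thesis using that sums_unique2[OF sums_zero] by (auto simp: V_def cinner_scaleC_right)
  qed
  have "x + y \<in> V" "c *\<^sub>C x \<in> V" if "x \<in> V" "y \<in> V" for x y c
    using that by (simp_all add: V_def cinner_add_left cinner_scaleC_left)
  with exists_orthonormal_set[of "\<lambda>n. d n - P (d n)" V, OF PV]
  obtain B where B: "countable B" "B \<subseteq> V" "\<forall>x\<in>B. \<forall>y\<in>B. cinner x y = (if x = y then 1 else 0)"
    and B_total: "\<forall>x. (\<forall>y\<in>B. cinner x y = 0) \<longrightarrow> (\<forall>n. cinner x (d n - P (d n)) = 0)"
    by (metis (no_types, lifting))
  have "x = 0" if "\<forall>y\<in>B. cinner x y = 0" "\<forall>n. cinner x (e n) = 0" for x
  proof -
    have "x \<in> V" using that by (simp add: V_def)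
    \<comment> \<open>\<open>d n\<close> splits into a part in V, handled by B, and
      \<open>P (d n)\<close>, to which every element of V is orthogonal.\<close>
    then have "cinner x (d n) = 0" for n
      using B_total that(1) VP[of x "d n"] by (simp add: cinner_diff_right)
    then have "D \<subseteq> {y. cinner x y = 0}" using d by auto
    moreover have "closed {y. cinner x y = 0}"
      by (intro closed_Collect_eq continuous_intros
          bounded_linear.continuous_on[OF bounded_linear_cinner_right])
    \<comment> \<open>The closed set of vectors orthogonal to x contains the dense set D, so it
      contains x itself.\<close>
    ultimately have "x \<in> {y. cinner x y = 0}"
      using closure_minimal[of D] D(2) by blast
    then show ?thesis by simp
  qed
  then show ?thesis using B by (intro exI[of _ B]) (auto simp: V_def)
qed

section \<open>Series of smooth functions\<close>

text \<open>A smooth function stored together with all its derivatives: \<open>D i\<close> is the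
  i-th derivative of \<open>D 0\<close>.\<close>

definition deriv_chain :: "(nat \<Rightarrow> real \<Rightarrow> 'b::real_normed_vector) \<Rightarrow> bool" where
  "deriv_chain D \<longleftrightarrow> (\<forall>i s. (D i has_vector_derivative D (Suc i) s) (at s))"

lemma deriv_chainD: "deriv_chain D \<Longrightarrow> (D i has_vector_derivative D (Suc i) s) (at s)"
  by (simp add: deriv_chain_def)

lemma deriv_chain_continuous: "deriv_chain D \<Longrightarrow> continuous_on A (D i)"
  by (meson deriv_chain_def continuous_at_imp_continuous_on has_vector_derivative_continuous)

lemma deriv_chain_bounded_linear:
  assumes "bounded_linear f" "deriv_chain D"
  shows "deriv_chain (\<lambda>i s. f (D i s))"
  using assms by (auto simp: deriv_chain_def intro: bounded_linear.has_vector_derivative)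

lemma C0_deriv_chain:
  assumes "deriv_chain D" "\<And>i. C0 (D i)"
  shows "C0_derivs m (D i)"
proof (induction m arbitrary: i)
  case (Suc m)
  show ?case using assms Suc[of "Suc i"]
    by (auto simp: deriv_chain_def intro!: exI[of _ "D (Suc i)"])
qed (use assms in auto)

text \<open>The Weierstrass test gives uniform convergence, under which both continuity and
  vanishing at infinity survive.\<close>

lemma C0_suminf:
  fixes f :: "nat \<Rightarrow> 'a::t2_space \<Rightarrow> 'b::banach"
  assumes C0: "\<And>n. C0 (f n)" and bound: "\<And>n x. norm (f n x) \<le> M n" and M: "summable M"
  shows "C0 (\<lambda>x. \<Sum>n. f n x)"
  unfolding C0_def
proof (intro conjI allI impI)
  have lim: "uniform_limit UNIV (\<lambda>n x. \<Sum>i<n. f i x) (\<lambda>x. \<Sum>n. f n x) sequentially"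
    by (rule Weierstrass_m_test[OF bound M])
  show "continuous_on UNIV (\<lambda>x. \<Sum>n. f n x)"
    by (rule uniform_limit_theorem[OF _ lim])
       (use C0 in \<open>auto simp: C0_def intro!: always_eventually continuous_on_sum\<close>)
  fix e :: real assume "0 < e"
  then obtain N where N: "\<And>x. dist (\<Sum>i<N. f i x) (\<Sum>n. f n x) < e / 2"
    using lim[unfolded uniform_limit_iff, rule_format, of "e / 2"]
    unfolding eventually_sequentially by auto
  \<comment> \<open>The N head terms share a budget of e / 2 outside the union of their compact
    sets; \<open>Suc N\<close> keeps the denominator positive.\<close>
  have "\<exists>S. compact S \<and> (\<forall>x. x \<notin> S \<longrightarrow> norm (f i x) < e / (2 * real (Suc N)))" for i
    using C0[of i] \<open>0 < e\<close> unfolding C0_def by auto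
  then obtain S where S: "\<And>i. compact (S i)"
    "\<And>i x. x \<notin> S i \<Longrightarrow> norm (f i x) < e / (2 * real (Suc N))"
    by metis
  show "\<exists>S. compact S \<and> (\<forall>x. x \<notin> S \<longrightarrow> norm (\<Sum>n. f n x) < e)"
  proof (intro exI conjI allI impI)
    show "compact (\<Union>i<N. S i)" by (intro compact_UN S) auto
    fix x assume "x \<notin> (\<Union>i<N. S i)"
    then have "norm (\<Sum>i<N. f i x) \<le> (\<Sum>i<N. e / (2 * real (Suc N)))"
      by (intro sum_norm_le less_imp_le S(2)) auto
    also have "\<dots> \<le> e / 2" using \<open>0 < e\<close> by (simp add: field_simps)
    finally have "norm (\<Sum>i<N. f i x) \<le> e / 2" .
    moreover have "norm (\<Sum>n. f n x) \<le> norm (\<Sum>i<N. f i x) + dist (\<Sum>i<N. f i x) (\<Sum>n. f n x)"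
      by (metis dist_norm norm_minus_commute norm_triangle_sub)
    ultimately show "norm (\<Sum>n. f n x) < e" using N[of x] by linarith
  qed
qed

text \<open>The majorant of the derivatives gives the uniform convergence required by
  \<open>has_derivative_series\<close>; for the series itself pointwise summability is
  enough.\<close>

lemma has_vector_derivative_suminf:
  fixes f f' :: "nat \<Rightarrow> real \<Rightarrow> 'b::banach"
  assumes deriv: "\<And>n x. (f n has_vector_derivative f' n x) (at x)"
    and f: "\<And>x. summable (\<lambda>n. f n x)"
    and bound: "\<And>n x. norm (f' n x) \<le> M n" and M: "summable M"
  shows "((\<lambda>x. \<Sum>n. f n x) has_vector_derivative (\<Sum>n. f' n x)) (at x)"
proof -
  let ?g' = "\<lambda>x. \<Sum>n. f' n x"
  have lim: "uniform_limit UNIV (\<lambda>n x. \<Sum>i<n. f' i x) ?g' sequentially"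
    by (rule Weierstrass_m_test[OF bound M])
  have "\<exists>g. \<forall>x\<in>UNIV. (\<lambda>n. f n x) sums g x \<and> (g has_derivative (\<lambda>h. h *\<^sub>R ?g' x)) (at x within UNIV)"
  proof (rule has_derivative_series[where x = 0 and f' = "\<lambda>n x h. h *\<^sub>R f' n x"])
    show "(f n has_derivative (\<lambda>h. h *\<^sub>R f' n x)) (at x within UNIV)" for n x
      using deriv[of n x] by (simp add: has_vector_derivative_def)
    fix e :: real assume "0 < e"
    show "\<forall>\<^sub>F n in sequentially. \<forall>x\<in>UNIV. \<forall>h. norm ((\<Sum>i<n. h *\<^sub>R f' i x) - h *\<^sub>R ?g' x) \<le> e * norm h"
      using lim[unfolded uniform_limit_iff, rule_format, OF \<open>0 < e\<close>]
    proof eventually_elim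
      case (elim n)
      have "norm ((\<Sum>i<n. h *\<^sub>R f' i x) - h *\<^sub>R ?g' x) \<le> e * norm h" for h x
      proof -
        have "norm ((\<Sum>i<n. h *\<^sub>R f' i x) - h *\<^sub>R ?g' x) = \<bar>h\<bar> * norm ((\<Sum>i<n. f' i x) - ?g' x)"
          by (simp flip: scaleR_sum_right scaleR_diff_right)
        also have "\<dots> \<le> \<bar>h\<bar> * e"
          using elim by (intro mult_left_mono) (auto simp: dist_norm less_imp_le)
        finally show ?thesis by (simp add: mult.commute)
      qed
      then show ?case by blast
    qed
  qed (use summable_sums[OF f] in auto)
  then obtain g where g: "\<And>x. (\<lambda>n. f n x) sums g x" "\<And>x. (g has_derivative (\<lambda>h. h *\<^sub>R ?g' x)) (at x)"
    by auto
  have "g = (\<lambda>x. \<Sum>n. f n x)" using g(1) by (simp add: fun_eq_iff sums_iff)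
  then show ?thesis using g(2) by (simp add: has_vector_derivative_def)
qed

text \<open>The majorants may depend on the order i without any uniformity in i. Every smooth series
  below is differentiated through this.\<close>

lemma deriv_chain_suminf:
  fixes D :: "nat \<Rightarrow> nat \<Rightarrow> real \<Rightarrow> 'b::banach"
  assumes D: "\<And>n. deriv_chain (D n)" and bound: "\<And>n i x. norm (D n i x) \<le> M n i"
    and M: "\<And>i. summable (\<lambda>n. M n i)"
  shows "deriv_chain (\<lambda>i x. \<Sum>n. D n i x)"
  unfolding deriv_chain_def
proof (intro allI)
  fix i x
  have "summable (\<lambda>n. D n i x)" for x
    by (rule summable_comparison_test'[OF M bound])
  then show "((\<lambda>x. \<Sum>n. D n i x) has_vector_derivative (\<Sum>n. D n (Suc i) x)) (at x)"
    using D bound M by (intro has_vector_derivative_suminf[where M="\<lambda>n. M n (Suc i)"])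
      (auto simp: deriv_chain_def)
qed

section \<open>Operations on functions vanishing at infinity\<close>

lemma C0_bounded:
  fixes f :: "'a::topological_space \<Rightarrow> 'b::real_normed_vector"
  assumes "C0 f" shows "\<exists>M\<ge>0. \<forall>x. norm (f x) \<le> M"
proof -
  obtain S where S: "compact S" "\<And>x. x \<notin> S \<Longrightarrow> norm (f x) < 1"
    using assms unfolding C0_def by (meson zero_less_one)
  have "compact (f ` S)"
    using assms S(1) unfolding C0_def by (meson compact_continuous_image continuous_on_subset subset_UNIV)
  then obtain B where "\<And>x. x \<in> S \<Longrightarrow> norm (f x) \<le> B"
    by (metis bounded_iff compact_imp_bounded imageI)
  then have "norm (f x) \<le> max 1 B" for x using S(2)[of x] by (cases "x \<in> S") force+
  then show ?thesis by (intro exI[of _ "max 1 B"]) auto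
qed

lemma C0_bounded_linear:
  assumes f: "bounded_linear f" and g: "C0 g"
  shows "C0 (\<lambda>x. f (g x))"
  unfolding C0_def
proof (intro conjI allI impI)
  show "continuous_on UNIV (\<lambda>x. f (g x))"
    using g by (auto simp: C0_def intro: bounded_linear.continuous_on[OF f])
  obtain K where K: "0 < K" "\<And>x. norm (f x) \<le> norm x * K"
    using bounded_linear.pos_bounded[OF f] by blast
  fix e :: real assume "0 < e"
  then obtain S where S: "compact S" "\<And>x. x \<notin> S \<Longrightarrow> norm (g x) < e / K"
    using g K(1) unfolding C0_def by (meson divide_pos_pos)
  have "norm (f (g x)) < e" if "x \<notin> S" for x
    using K(2)[of "g x"] S(2)[OF that] K(1) by (simp add: field_simps)
  then show "\<exists>S. compact S \<and> (\<forall>x. x \<notin> S \<longrightarrow> norm (f (g x)) < e)"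
    using S(1) by blast
qed

text \<open>Outside the product of two compact sets one factor is small while the other is
  bounded.\<close>

lemma C0_Times:
  fixes f :: "'a::topological_space \<Rightarrow> complex" and g :: "'b::topological_space \<Rightarrow> complex"
  assumes f: "C0 f" and g: "C0 g"
  shows "C0 (\<lambda>(s, t). f s * g t)"
  unfolding C0_def
proof (intro conjI allI impI)
  have "continuous_on UNIV (\<lambda>x. f (fst x))" "continuous_on UNIV (\<lambda>x. g (snd x))"
    using f g unfolding C0_def
    by (auto intro!: continuous_on_compose2[of UNIV f _ fst] continuous_on_compose2[of UNIV g _ snd]
        continuous_intros)
  then show "continuous_on UNIV (\<lambda>(s, t). f s * g t)"
    unfolding case_prod_beta by (intro continuous_intros)
  obtain M N where M: "0 \<le> M" "\<And>x. norm (f x) \<le> M" and N: "0 \<le> N" "\<And>x. norm (g x) \<le> N"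
    using C0_bounded[OF f] C0_bounded[OF g] by metis
  fix e :: real assume "0 < e"
  \<comment> \<open>One margin serves both factors; the added 1 keeps the denominator positive when
    both bounds are 0.\<close>
  then have "0 < e / (M + N + 1)" using M(1) N(1) by (intro divide_pos_pos) auto
  then obtain S T where S: "compact S" "\<And>x. x \<notin> S \<Longrightarrow> norm (f x) < e / (M + N + 1)"
    and T: "compact T" "\<And>x. x \<notin> T \<Longrightarrow> norm (g x) < e / (M + N + 1)"
    using f g unfolding C0_def by metis
  have less: "e / (M + N + 1) * N < e" "M * (e / (M + N + 1)) < e"
    using \<open>0 < e\<close> M(1) N(1) by (simp_all add: field_simps add_pos_nonneg)
  have "norm (f s * g t) < e" if "(s, t) \<notin> S \<times> T" for s t
  proof (cases "s \<in> S")
    case False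
    then have "norm (f s) * norm (g t) \<le> e / (M + N + 1) * N"
      using S(2)[of s] M N by (intro mult_mono) (auto intro: less_imp_le order_trans[OF norm_ge_zero])
    then show ?thesis using less by (simp add: norm_mult)
  next
    case True
    then have "norm (f s) * norm (g t) \<le> M * (e / (M + N + 1))"
      using that T(2)[of t] M by (intro mult_mono) (auto intro: less_imp_le)
    then show ?thesis using less by (simp add: norm_mult)
  qed
  then show "\<exists>S. compact S \<and> (\<forall>x. x \<notin> S \<longrightarrow> norm (case x of (s, t) \<Rightarrow> f s * g t) < e)"
    using S(1) T(1) by (intro exI[of _ "S \<times> T"]) (auto intro: compact_Times)
qed

text \<open>\<open>K i j\<close> plays the mixed derivative of order i in s and j in t. The family
  is closed under both differentiations, so one induction covers every order in which they are
  carried out.\<close>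

lemma C0_partials_chain:
  assumes "\<And>i j. C0 (K i j)"
    and "\<And>i j s t. ((\<lambda>x. K i j (x, t)) has_vector_derivative K (Suc i) j (s, t)) (at s)"
    and "\<And>i j s t. ((\<lambda>y. K i j (s, y)) has_vector_derivative K i (Suc j) (s, t)) (at t)"
  shows "C0_partials m (K i j)"
proof (induction m arbitrary: i j)
  case (Suc m)
  show ?case
    unfolding C0_partials.simps
    by (intro conjI exI[of _ "K (Suc i) j"] exI[of _ "K i (Suc j)"] allI assms Suc)
qed (use assms in auto)

section \<open>Compactly supported smooth functions\<close>

text \<open>The one-sided functions \<open>x \<mapsto> q (1/x) exp (-1/x)\<close> (extended by \<open>0\<close>) are closed under
  differentiation; multiplying two of them yields bumps.\<close>

definition exp_recip :: "real poly \<Rightarrow> real \<Rightarrow> real" where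
  "exp_recip q x = (if 0 < x then poly q (1 / x) * exp (- (1 / x)) else 0)"

lemma poly_times_exp_tendsto_0: "((\<lambda>y. poly q y * exp (- y)) \<longlongrightarrow> 0) at_top" for q :: "real poly"
proof -
  have "((\<lambda>y. \<Sum>i\<le>degree q. coeff q i * (y ^ i / exp y)) \<longlongrightarrow> (\<Sum>i\<le>degree q. coeff q i * 0)) at_top"
    by (intro tendsto_sum tendsto_mult tendsto_const tendsto_power_div_exp_0)
  then show ?thesis
    by (simp add: poly_altdef sum_distrib_right exp_minus divide_inverse mult.assoc)
qed

lemma exp_recip_at_right: "(exp_recip q \<longlongrightarrow> 0) (at_right 0)"
proof -
  have "((\<lambda>x. poly q (inverse x) * exp (- inverse x)) \<longlongrightarrow> 0) (at_right (0::real))"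
    using filterlim_compose[OF poly_times_exp_tendsto_0 filterlim_inverse_at_top_right] .
  then show ?thesis
  proof (rule Lim_transform_eventually)
    show "\<forall>\<^sub>F x in at_right 0. poly q (inverse x) * exp (- inverse x) = exp_recip q x"
      unfolding eventually_at_right_field by (intro exI[of _ 1]) (auto simp: exp_recip_def divide_inverse)
  qed
qed

lemma exp_recip_at_0: "(exp_recip q \<longlongrightarrow> 0) (at 0)"
proof (rule filterlim_split_at[OF _ exp_recip_at_right])
  have "\<forall>\<^sub>F x in at_left 0. 0 = exp_recip q x"
    unfolding eventually_at_left_field by (intro exI[of _ "-1"]) (auto simp: exp_recip_def)
  then show "(exp_recip q \<longlongrightarrow> 0) (at_left 0)" by (rule Lim_transform_eventually[OF tendsto_const])
qed

text \<open>With y = 1/x the derivative of q(y) exp(-y) in x is y^2 (q(y) - q'(y)) exp(-y);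
  \<open>[:0, 0, 1:]\<close> is y^2.\<close>

definition exp_recip_deriv :: "real poly \<Rightarrow> real poly" where
  "exp_recip_deriv q = [:0, 0, 1:] * (q - pderiv q)"

lemma exp_recip_has_derivative:
  "(exp_recip q has_real_derivative exp_recip (exp_recip_deriv q) x) (at x)"
proof (cases x "0::real" rule: linorder_cases)
  case less
  have "((\<lambda>x. 0) has_real_derivative 0) (at x)" by simp
  then have "(exp_recip q has_real_derivative 0) (at x)"
    by (rule has_field_derivative_transform_within_open[where S="{..<0}"])
       (use less in \<open>auto simp: exp_recip_def\<close>)
  then show ?thesis using less by (simp add: exp_recip_def)
next
  case greater
  have "((\<lambda>x. poly q (1 / x) * exp (- (1 / x))) has_real_derivative
      exp_recip (exp_recip_deriv q) x) (at x)"
    using greater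
    by (auto intro!: derivative_eq_intros DERIV_chain2[OF poly_DERIV]
        simp: exp_recip_def exp_recip_deriv_def field_simps power2_eq_square)
  then show ?thesis
    by (rule has_field_derivative_transform_within_open[where S="{0<..}"])
       (use greater in \<open>auto simp: exp_recip_def\<close>)
next
  case equal
  \<comment> \<open>At 0 the difference quotient is a function of the same kind, with q multiplied
    by y, so it tends to 0.\<close>
  have "exp_recip ([:0, 1:] * q) = (\<lambda>x. (exp_recip q x - exp_recip q 0) / (x - 0))"
    by (auto simp: exp_recip_def fun_eq_iff)
  then show ?thesis
    using exp_recip_at_0[of "[:0, 1:] * q"] equal
    by (simp add: has_field_derivative_iff exp_recip_def)
qed

lemma deriv_chain_exp_recip:
  "deriv_chain (\<lambda>i x. complex_of_real (exp_recip ((exp_recip_deriv ^^ i) q) x))"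
  unfolding deriv_chain_def has_vector_derivative_complex_iff using exp_recip_has_derivative by simp

lemma deriv_chain_affine:
  assumes "deriv_chain D"
  shows "deriv_chain (\<lambda>i s. c ^ i *\<^sub>R D i (c * s + d))"
  unfolding deriv_chain_def
proof (intro allI)
  fix i s
  have "((D i \<circ> (\<lambda>s. c * s + d)) has_vector_derivative c *\<^sub>R D (Suc i) (c * s + d)) (at s)"
    by (rule vector_diff_chain_at)
       (use deriv_chainD[OF assms] in \<open>auto intro!: derivative_eq_intros simp flip: has_real_derivative_iff_has_vector_derivative\<close>)
  from bounded_linear.has_vector_derivative[OF bounded_linear_scaleR_right[of "c ^ i"] this]
  show "((\<lambda>s. c ^ i *\<^sub>R D i (c * s + d)) has_vector_derivative c ^ Suc i *\<^sub>R D (Suc i) (c * s + d)) (at s)"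
    by (simp add: comp_def mult.commute)
qed

text \<open>A class closed under differentiation consists of smooth functions: iterate a choice of
  derivative within it.\<close>

lemma exists_deriv_chain:
  assumes "f \<in> S" "\<And>g. g \<in> S \<Longrightarrow> \<exists>g'\<in>S. \<forall>s. (g has_vector_derivative g' s) (at s)"
  shows "\<exists>D. D 0 = f \<and> deriv_chain D"
proof -
  obtain d where d: "\<And>g. g \<in> S \<Longrightarrow> d g \<in> S \<and> (\<forall>s. (g has_vector_derivative d g s) (at s))"
    using assms(2) by metis
  have "(d ^^ i) f \<in> S" for i by (induction i) (use assms(1) d in auto)
  then show ?thesis using d by (intro exI[of _ "\<lambda>i. (d ^^ i) f"]) (auto simp: deriv_chain_def)
qed

text \<open>Finite sums of products of entries of two chains. The product rule keeps this class
  closed under differentiation, so no binomial coefficients appear.\<close>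

inductive_set product_span :: "(nat \<Rightarrow> real \<Rightarrow> complex) \<Rightarrow> (nat \<Rightarrow> real \<Rightarrow> complex) \<Rightarrow> (real \<Rightarrow> complex) set"
  for F G where
  product: "(\<lambda>s. F i s * G j s) \<in> product_span F G"
| add: "f \<in> product_span F G \<Longrightarrow> g \<in> product_span F G \<Longrightarrow> (\<lambda>s. f s + g s) \<in> product_span F G"

lemma deriv_chain_product:
  fixes F G :: "nat \<Rightarrow> real \<Rightarrow> complex"
  assumes F: "deriv_chain F" and G: "deriv_chain G"
  shows "\<exists>D. D 0 = (\<lambda>s. F 0 s * G 0 s) \<and> deriv_chain D"
proof (rule exists_deriv_chain[where S="product_span F G"])
  show "\<exists>g'\<in>product_span F G. \<forall>s. (g has_vector_derivative g' s) (at s)" if "g \<in> product_span F G" for g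
    using that
  proof induction
    case (product i j)
    have "((\<lambda>s. F i s * G j s) has_vector_derivative F i s * G (Suc j) s + F (Suc i) s * G j s) (at s)" for s
      by (intro has_vector_derivative_mult deriv_chainD assms)
    then show ?case by (intro bexI[of _ "\<lambda>s. F i s * G (Suc j) s + F (Suc i) s * G j s"]
          product_span.intros) auto
  next
    case (add f g)
    then obtain f' g' where "f' \<in> product_span F G" "\<forall>s. (f has_vector_derivative f' s) (at s)"
      "g' \<in> product_span F G" "\<forall>s. (g has_vector_derivative g' s) (at s)" by blast
    then show ?case by (intro bexI[of _ "\<lambda>s. f' s + g' s"] product_span.intros)
        (auto intro: has_vector_derivative_add)
  qed
qed (rule product_span.product)

text \<open>Encodes the smooth functions of compact support, with one radius for all
  derivatives.\<close>

definition test_chain :: "(nat \<Rightarrow> real \<Rightarrow> complex) \<Rightarrow> bool" where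
  "test_chain D \<longleftrightarrow> deriv_chain D \<and> (\<exists>R. \<forall>i s. R < \<bar>s\<bar> \<longrightarrow> D i s = 0)"

text \<open>Checking \<open>D 0\<close> suffices: beyond the radius it vanishes on an open set, and
  so do its derivatives.\<close>

lemma test_chainI:
  assumes D: "deriv_chain D" and R: "\<And>s. R < \<bar>s\<bar> \<Longrightarrow> D 0 s = 0"
  shows "test_chain D"
proof -
  have "D i s = 0" if "R < \<bar>s\<bar>" for i s
    using that
  proof (induction i arbitrary: s)
    case (Suc i)
    have "((\<lambda>_. 0) has_vector_derivative D (Suc i) s) (at s)"
    proof (rule has_vector_derivative_transform_within_open[OF deriv_chainD[OF D]])
      show "open {s. R < \<bar>s\<bar>}" by (intro open_Collect_less continuous_intros)
    qed (use Suc in auto)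
    moreover have "((\<lambda>_. 0) has_vector_derivative (0::complex)) (at s)" by simp
    ultimately show ?case by (rule vector_derivative_unique_at)
  qed (rule R)
  then show ?thesis using D unfolding test_chain_def by blast
qed

lemma test_chain_C0:
  assumes "test_chain D" shows "C0 (D i)"
  unfolding C0_def
proof (intro conjI allI impI)
  show "continuous_on UNIV (D i)"
    using assms by (simp add: test_chain_def deriv_chain_continuous)
  obtain R where "\<And>s. R < \<bar>s\<bar> \<Longrightarrow> D i s = 0" using assms unfolding test_chain_def by blast
  then show "\<exists>S. compact S \<and> (\<forall>x. x \<notin> S \<longrightarrow> cmod (D i x) < e)" if "0 < e" for e
    using that by (intro exI[of _ "{-R..R}"]) (auto simp: abs_if)
qed

lemma test_chain_add:
  assumes "test_chain D" "test_chain E"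
  shows "test_chain (\<lambda>i s. D i s + E i s)"
proof -
  obtain R Q where R: "\<And>i s. R < \<bar>s\<bar> \<Longrightarrow> D i s = 0" and Q: "\<And>i s. Q < \<bar>s\<bar> \<Longrightarrow> E i s = 0"
    using assms unfolding test_chain_def by blast
  then have "\<forall>i s. max R Q < \<bar>s\<bar> \<longrightarrow> D i s + E i s = 0" by simp
  moreover have "deriv_chain (\<lambda>i s. D i s + E i s)"
    using assms by (auto simp: test_chain_def deriv_chain_def intro: has_vector_derivative_add)
  ultimately show ?thesis unfolding test_chain_def by blast
qed

lemma test_chain_scale:
  assumes "test_chain D" shows "test_chain (\<lambda>i s. c * D i s)"
proof -
  obtain R where "\<And>i s. R < \<bar>s\<bar> \<Longrightarrow> D i s = 0" using assms unfolding test_chain_def by blast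
  then have "\<forall>i s. R < \<bar>s\<bar> \<longrightarrow> c * D i s = 0" by simp
  moreover have "deriv_chain (\<lambda>i s. c * D i s)"
    using assms deriv_chain_bounded_linear[OF bounded_linear_mult_right] unfolding test_chain_def by blast
  ultimately show ?thesis unfolding test_chain_def by blast
qed

lemma test_chain_square_integrable:
  assumes "test_chain D" shows "square_integrable (D i)"
proof -
  have cont: "continuous_on UNIV (D i)"
    using assms by (simp add: test_chain_def deriv_chain_continuous)
  then have meas: "D i \<in> borel_measurable lebesgue"
    by (intro measurable_completion) (simp add: borel_measurable_continuous_onI)
  obtain R where R: "\<And>s. R < \<bar>s\<bar> \<Longrightarrow> D i s = 0" using assms unfolding test_chain_def by blast
  have "integrable lborel (\<lambda>s. indicator {-R..R} s *\<^sub>R (cmod (D i s))\<^sup>2)"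
    by (rule borel_integrable_compact) (auto intro!: continuous_intros continuous_on_subset[OF cont])
  moreover have "(\<lambda>s. indicator {-R..R} s *\<^sub>R (cmod (D i s))\<^sup>2) = (\<lambda>s. (cmod (D i s))\<^sup>2)"
  proof
    show "indicator {-R..R} s *\<^sub>R (cmod (D i s))\<^sup>2 = (cmod (D i s))\<^sup>2" for s
      using R[of s] by (cases "R < \<bar>s\<bar>") (auto simp: indicator_def)
  qed
  ultimately have "integrable lborel (\<lambda>s. (cmod (D i s))\<^sup>2)" by simp
  then have "integrable lebesgue (\<lambda>s. (cmod (D i s))\<^sup>2)"
    by (subst integrable_completion) auto
  with meas show ?thesis by (simp add: square_integrable_def)
qed

text \<open>Smooth and positive exactly on (a, b). The factor \<open>Suc n\<close> steepens both
  flanks, so the bumps tend to the indicator of (a, b) as n grows.\<close>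

definition bump :: "real \<Rightarrow> real \<Rightarrow> nat \<Rightarrow> real \<Rightarrow> real" where
  "bump a b n s = exp_recip 1 (real (Suc n) * (s - a)) * exp_recip 1 (real (Suc n) * (b - s))"

lemma bump_nonneg: "0 \<le> bump a b n s" and bump_le_1: "bump a b n s \<le> 1"
  by (auto simp: bump_def exp_recip_def mult_le_one)

lemma bump_pos: "a < s \<Longrightarrow> s < b \<Longrightarrow> 0 < bump a b n s"
  by (simp add: bump_def exp_recip_def)

lemma bump_eq_0: "s \<notin> {a<..<b} \<Longrightarrow> bump a b n s = 0"
  by (auto simp: bump_def exp_recip_def mult_less_0_iff zero_less_mult_iff)

lemma exists_bump_chain: "\<exists>D. D 0 = (\<lambda>s. complex_of_real (bump a b n s)) \<and> test_chain D"
proof -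
  define E where "E = (\<lambda>i x. complex_of_real (exp_recip ((exp_recip_deriv ^^ i) 1) x))"
  let ?n = "real (Suc n)"
  have E: "deriv_chain E" unfolding E_def by (rule deriv_chain_exp_recip)
  obtain D where D: "D 0 = (\<lambda>s. (?n ^ 0 *\<^sub>R E 0 (?n * s + - ?n * a)) * ((- ?n) ^ 0 *\<^sub>R E 0 (- ?n * s + ?n * b)))"
    "deriv_chain D"
    using deriv_chain_product[OF deriv_chain_affine[OF E] deriv_chain_affine[OF E]] by blast
  have "D 0 = (\<lambda>s. complex_of_real (bump a b n s))"
    unfolding D(1) by (simp add: fun_eq_iff E_def bump_def algebra_simps)
  moreover from this have "test_chain D"
    by (intro test_chainI[OF D(2), of "max \<bar>a\<bar> \<bar>b\<bar>"]) (auto intro!: bump_eq_0)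
  ultimately show ?thesis by blast
qed

section \<open>Pointwise representatives in \<open>L\<^sub>2\<close>\<close>

text \<open>Fatou's lemma bounds the integral of |y - h|^2 by the lower limit of |y - Y n|^2, which
  is 0.\<close>

lemma l2_limit_pointwise:
  fixes Y :: "nat \<Rightarrow> l2"
  assumes Y: "Y \<longlonglongrightarrow> y" and h: "AE t in lebesgue. (\<lambda>k. rep_l2 (Y k) t) \<longlonglongrightarrow> h t"
  shows "AE t in lebesgue. rep_l2 y t = h t"
proof -
  let ?u = "\<lambda>n t. ennreal ((cmod (rep_l2 y t - rep_l2 (Y n) t))\<^sup>2)"
  have "(\<integral>\<^sup>+t. liminf (\<lambda>n. ?u n t) \<partial>lebesgue) \<le> liminf (\<lambda>n. \<integral>\<^sup>+t. ?u n t \<partial>lebesgue)"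
    by (intro nn_integral_liminf) measurable
  also have "(\<lambda>n. \<integral>\<^sup>+t. ?u n t \<partial>lebesgue) = (\<lambda>n. ennreal ((norm (y - Y n))\<^sup>2))"
  proof
    fix n
    have "(\<integral>\<^sup>+t. ?u n t \<partial>lebesgue) = (\<integral>\<^sup>+t. ennreal ((cmod (rep_l2 (y - Y n) t))\<^sup>2) \<partial>lebesgue)"
      by (intro nn_integral_cong_AE) (use rep_l2_minus[of y "Y n"] in \<open>auto elim: eventually_mono\<close>)
    then show "(\<integral>\<^sup>+t. ?u n t \<partial>lebesgue) = ennreal ((norm (y - Y n))\<^sup>2)"
      by (simp add: nn_integral_l2)
  qed
  also have "liminf \<dots> = 0"
  proof (rule lim_imp_Liminf)
    have "(\<lambda>n. ennreal ((norm (y - Y n))\<^sup>2)) \<longlonglongrightarrow> ennreal ((norm (y - y))\<^sup>2)"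
      by (intro tendsto_intros Y)
    then show "(\<lambda>n. ennreal ((norm (y - Y n))\<^sup>2)) \<longlonglongrightarrow> 0" by simp
  qed simp
  finally have "AE t in lebesgue. liminf (\<lambda>n. ?u n t) = 0"
    by (subst nn_integral_0_iff_AE[symmetric]) (auto simp: le_zero_eq)
  with h show ?thesis
  proof eventually_elim
    case (elim t)
    have "(\<lambda>n. ?u n t) \<longlonglongrightarrow> ennreal ((cmod (rep_l2 y t - h t))\<^sup>2)"
      by (intro tendsto_intros elim)
    then have "liminf (\<lambda>n. ?u n t) = ennreal ((cmod (rep_l2 y t - h t))\<^sup>2)"
      by (intro lim_imp_Liminf) auto
    then show ?case using elim by simp
  qed
qed

lemma rep_l2_sum:
  assumes "finite F" "\<And>n. AE t in lebesgue. rep_l2 (x n) t = f n t"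
  shows "AE t in lebesgue. rep_l2 (\<Sum>n\<in>F. c n *\<^sub>C x n) t = (\<Sum>n\<in>F. c n * f n t)"
  using assms(1)
proof (induction F)
  case (insert n F)
  have "AE t in lebesgue. rep_l2 (c n *\<^sub>C x n + (\<Sum>n\<in>F. c n *\<^sub>C x n)) t
      = c n * f n t + (\<Sum>n\<in>F. c n * f n t)"
    using insert.IH assms(2)[of n] rep_l2_scaleC[of "c n" "x n"]
      rep_l2_plus[of "c n *\<^sub>C x n" "\<Sum>n\<in>F. c n *\<^sub>C x n"]
    by eventually_elim simp
  then show ?case using insert.hyps by simp
qed (use rep_l2_zero in simp)

text \<open>The bridge by which norm-convergent expansions in \<open>l2\<close> are matched with the
  pointwise series for the kernel.\<close>

lemma rep_l2_sums:
  assumes y: "(\<lambda>n. c n *\<^sub>C x n) sums y" and x: "\<And>n. AE t in lebesgue. rep_l2 (x n) t = f n t"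
    and h: "\<And>t. (\<lambda>n. c n * f n t) sums h t"
  shows "AE t in lebesgue. rep_l2 y t = h t"
proof (rule l2_limit_pointwise)
  show "(\<lambda>N. \<Sum>n<N. c n *\<^sub>C x n) \<longlonglongrightarrow> y" using y by (simp add: sums_def)
  \<comment> \<open>There are countably many partial sums, hence one common null set.\<close>
  have "AE t in lebesgue. \<forall>N. rep_l2 (\<Sum>n<N. c n *\<^sub>C x n) t = (\<Sum>n<N. c n * f n t)"
    unfolding AE_all_countable by (intro allI rep_l2_sum x) auto
  then show "AE t in lebesgue. (\<lambda>N. rep_l2 (\<Sum>n<N. c n *\<^sub>C x n) t) \<longlonglongrightarrow> h t"
    by eventually_elim (use h in \<open>simp add: sums_def\<close>)
qed

lemma l2_rel_refl: "l2_rel f f \<longleftrightarrow> square_integrable f"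
  by (auto simp: l2_rel_def)

lemma abs_l2_add: "square_integrable f \<Longrightarrow> square_integrable g \<Longrightarrow>
    abs_l2 f + abs_l2 g = abs_l2 (\<lambda>t. f t + g t)"
  by (rule plus_l2.abs_eq) (simp_all add: l2_rel_refl)

lemma abs_l2_scaleC: "square_integrable f \<Longrightarrow> c *\<^sub>C abs_l2 f = abs_l2 (\<lambda>t. c * f t)"
  by (rule scaleC_l2.abs_eq) (simp_all add: l2_rel_refl)

lemma abs_l2_eqI:
  assumes "square_integrable f" "AE t in lebesgue. rep_l2 x t = f t"
  shows "x = abs_l2 f"
  unfolding l2_eq_iff using assms(2) rep_l2_abs_l2[OF assms(1)] by eventually_elim simp

lemma square_integrable_cong_AE:
  assumes "AE t in lebesgue. rep_l2 x t = f t" "f \<in> borel_measurable lebesgue"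
  shows "square_integrable f"
proof -
  have "integrable lebesgue (\<lambda>t. (cmod (rep_l2 x t))\<^sup>2)"
    using square_integrable_rep_l2[of x] unfolding square_integrable_def by blast
  moreover have "integrable lebesgue (\<lambda>t. (cmod (rep_l2 x t))\<^sup>2) \<longleftrightarrow> integrable lebesgue (\<lambda>t. (cmod (f t))\<^sup>2)"
    by (rule integrable_cong_AE) (use assms in \<open>auto elim: eventually_mono\<close>)
  ultimately show ?thesis using assms(2) by (simp add: square_integrable_def)
qed

lemma cinner_abs_l2_right:
  assumes "square_integrable g"
  shows "cinner x (abs_l2 g) = (\<integral>t. rep_l2 x t * cnj (g t) \<partial>lebesgue)"
  unfolding cinner_l2_def
proof (rule integral_cong_AE)
  show "(\<lambda>t. rep_l2 x t * cnj (rep_l2 (abs_l2 g) t)) \<in> borel_measurable lebesgue"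
    by (rule mult_cnj_rep_l2_measurable)
  show "(\<lambda>t. rep_l2 x t * cnj (g t)) \<in> borel_measurable lebesgue"
    using integrable_square_integrable_mult[OF square_integrable_rep_l2 assms] by auto
  show "AE t in lebesgue. rep_l2 x t * cnj (rep_l2 (abs_l2 g) t) = rep_l2 x t * cnj (g t)"
    using rep_l2_abs_l2[OF assms] by eventually_elim simp
qed

lemma cinner_abs_l2:
  assumes "square_integrable f" "square_integrable g"
  shows "cinner (abs_l2 f) (abs_l2 g) = (\<integral>t. f t * cnj (g t) \<partial>lebesgue)"
  unfolding cinner_abs_l2_right[OF assms(2)]
proof (rule integral_cong_AE)
  show "(\<lambda>t. rep_l2 (abs_l2 f) t * cnj (g t)) \<in> borel_measurable lebesgue"
    using integrable_square_integrable_mult[OF square_integrable_rep_l2 assms(2)] by auto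
  show "(\<lambda>t. f t * cnj (g t)) \<in> borel_measurable lebesgue"
    using integrable_square_integrable_mult[OF assms] by auto
  show "AE t in lebesgue. rep_l2 (abs_l2 f) t * cnj (g t) = f t * cnj (g t)"
    using rep_l2_abs_l2[OF assms(1)] by eventually_elim simp
qed

section \<open>Bumps are total\<close>

lemma sigma_finite_lebesgue: "sigma_finite_measure (lebesgue :: real measure)"
proof
  obtain A :: "real set set" where A: "countable A" "A \<subseteq> sets lborel" "\<Union> A = space lborel"
    "\<forall>a\<in>A. emeasure lborel a \<noteq> \<infinity>"
    using lborel.sigma_finite_countable by blast
  then show "\<exists>A. countable A \<and> A \<subseteq> sets lebesgue \<and> \<Union> A = space (lebesgue :: real measure) \<and>
      (\<forall>a\<in>A. emeasure lebesgue a \<noteq> \<infinity>)"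
    by (intro exI[of _ A]) (auto simp: subset_iff)
qed

text \<open>Open intervals are an intersection-stable generator of the Borel sets, and the sets over
  which f integrates to 0 are closed under countable disjoint unions and, since the total integral
  is 0, under complements.\<close>

lemma AE_zero_if_interval_integrals_zero:
  fixes f :: "real \<Rightarrow> complex"
  assumes f: "integrable lebesgue f"
    and zero: "\<And>a b. (LINT t:{a<..<b}|lebesgue. f t) = 0" and total: "(\<integral>t. f t \<partial>lebesgue) = 0"
  shows "AE t in lebesgue. f t = 0"
proof (rule sigma_finite_measure.density_zero[OF sigma_finite_lebesgue f])
  have si: "set_integrable lebesgue A f" if "A \<in> sets lebesgue" for A
    using integrable_mult_indicator[OF that f] by (simp add: set_integrable_def)
  let ?G = "range (\<lambda>(a::real, b). {a<..<b})"
  have borel: "(LINT t:A|lebesgue. f t) = 0" if "A \<in> sets borel" for A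
  proof -
    have "Int_stable ?G"
    proof (rule Int_stableI)
      fix A B assume "A \<in> ?G" "B \<in> ?G"
      then obtain a b c d where "A = {a<..<b}" "B = {c<..<d}" by auto
      then have "A \<inter> B = (\<lambda>(a, b). {a<..<b}) (max a c, min b d)" by auto
      then show "A \<inter> B \<in> ?G" by (metis rangeI)
    qed
    moreover have "?G \<subseteq> Pow UNIV" by simp
    moreover have "A \<in> sigma_sets UNIV ?G"
      using that by (simp add: borel_eq_box box_real)
    ultimately show ?thesis
    proof (induction rule: sigma_sets_induct_disjoint)
      case (basic A)
      then show ?case using zero by auto
    next
      case empty
      then show ?case by (simp add: set_lebesgue_integral_def)
    next
      case (compl A)
      then have A: "A \<in> sets lebesgue"
        by (simp add: sets_completionI_sets borel_eq_box box_real)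
      have "(LINT t:A \<union> (UNIV - A)|lebesgue. f t) = (LINT t:A|lebesgue. f t) + (LINT t:UNIV - A|lebesgue. f t)"
        using A by (intro set_integral_Un si) auto
      then show ?case using compl total by (simp add: set_lebesgue_integral_def)
    next
      case (union A)
      then have "A i \<in> sigma_sets UNIV ?G" for i by auto
      then have A: "A i \<in> sets lebesgue" for i
        by (simp add: sets_completionI_sets borel_eq_box box_real)
      have "(LINT t:(\<Union>i. A i)|lebesgue. f t) = (\<Sum>i. LINT t:A i|lebesgue. f t)"
        using union A by (intro lebesgue_integral_countable_add si) (auto simp: disjoint_family_on_def)
      then show ?case using union by simp
    qed
  qed
  fix A :: "real set" assume A: "A \<in> sets lebesgue"
  \<comment> \<open>A Lebesgue set differs from a Borel set only inside a null set, so the Borel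
    case carries over.\<close>
  then obtain S N N' where S: "A = S \<union> N" "N \<subseteq> N'" "N' \<in> null_sets lborel" "S \<in> sets lborel"
    by (rule sets_completionE)
  have "N' \<in> null_sets lebesgue" using S(3) by (rule null_sets_completionI)
  then have "AE t in lebesgue. t \<notin> N'" by (rule AE_not_in)
  then have "AE t in lebesgue. t \<in> A \<longleftrightarrow> t \<in> S"
    by eventually_elim (use S in auto)
  then have AS: "AE t in lebesgue. indicat_real A t *\<^sub>R f t = indicat_real S t *\<^sub>R f t"
    by eventually_elim (simp add: indicator_def)
  have "S \<in> sets lebesgue" using S(4) by (rule sets_completionI_sets)
  then have "(LINT t:A|lebesgue. f t) = (LINT t:S|lebesgue. f t)"
    unfolding set_lebesgue_integral_def using f A
    by (intro integral_cong_AE AS borel_measurable_scaleR borel_measurable_indicator) auto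
  then show "(LINT t:A|lebesgue. f t) = 0" using borel[of S] S(4) by simp
qed

text \<open>Gives the pointwise limit of bumps with moving endpoints. For l = 0 the limit would
  depend on how c approaches 0.\<close>

lemma exp_recip_scaled_tendsto:
  assumes "c \<longlonglongrightarrow> l" "l \<noteq> 0"
  shows "(\<lambda>k. exp_recip 1 (real (Suc k) * c k)) \<longlonglongrightarrow> (if 0 < l then 1 else 0)"
proof (cases "0 < l")
  case True
  have "filterlim (\<lambda>k. real (Suc k)) at_top sequentially"
    by (rule filterlim_compose[OF filterlim_real_sequentially filterlim_Suc])
  then have lim: "filterlim (\<lambda>k. c k * real (Suc k)) at_top sequentially"
    by (rule filterlim_tendsto_pos_mult_at_top[OF assms(1) True])
  then have "(\<lambda>k. exp (- inverse (c k * real (Suc k)))) \<longlonglongrightarrow> exp (- 0)"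
    by (intro tendsto_exp tendsto_minus tendsto_inverse_0_at_top lim)
  moreover have "\<forall>\<^sub>F k in sequentially. exp (- inverse (c k * real (Suc k))) = exp_recip 1 (real (Suc k) * c k)"
    using order_tendstoD(1)[OF assms(1) True]
    by eventually_elim (simp add: exp_recip_def divide_inverse mult.commute)
  ultimately have "(\<lambda>k. exp_recip 1 (real (Suc k) * c k)) \<longlonglongrightarrow> exp (- 0)"
    by (rule Lim_transform_eventually)
  then show ?thesis using True by simp
next
  case False
  then have "\<forall>\<^sub>F k in sequentially. c k < 0" using order_tendstoD(2)[OF assms(1)] assms(2) by simp
  then have "\<forall>\<^sub>F k in sequentially. 0 = exp_recip 1 (real (Suc k) * c k)"
    by eventually_elim (auto simp: exp_recip_def zero_less_mult_iff)
  then have "(\<lambda>k. exp_recip 1 (real (Suc k) * c k)) \<longlonglongrightarrow> 0"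
    by (rule Lim_transform_eventually[OF tendsto_const])
  then show ?thesis using False by simp
qed

lemma exists_rat_seq: "\<exists>q :: nat \<Rightarrow> rat. (\<lambda>k. real_of_rat (q k)) \<longlonglongrightarrow> a \<and> (\<forall>k. \<bar>real_of_rat (q k) - a\<bar> \<le> 1)"
proof -
  have "\<exists>q. a - 1 / real (Suc k) < real_of_rat q \<and> real_of_rat q < a + 1 / real (Suc k)" for k
    by (rule of_rat_dense) (simp add: field_simps)
  then obtain q where q: "\<And>k. a - 1 / real (Suc k) < real_of_rat (q k) \<and> real_of_rat (q k) < a + 1 / real (Suc k)"
    by metis
  then have bound: "\<bar>real_of_rat (q k) - a\<bar> \<le> 1 / real (Suc k)" for k
    using q[of k] by linarith
  have "(\<lambda>k. real_of_rat (q k) - a) \<longlonglongrightarrow> 0"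
    by (rule tendsto_rabs_zero_cancel, rule tendsto_sandwich[OF _ _ tendsto_const LIMSEQ_inverse_real_of_nat])
       (use bound in \<open>auto simp: divide_inverse\<close>)
  then have "(\<lambda>k. real_of_rat (q k)) \<longlonglongrightarrow> a" by (simp add: LIM_zero_iff)
  moreover have "1 / real (Suc k) \<le> 1" for k by simp
  ultimately show ?thesis using bound by (meson order_trans)
qed

text \<open>The indicator of a bounded interval is itself square integrable, so its product with an
  L2 function is integrable.\<close>

lemma integrable_rep_l2_interval: "integrable lebesgue (\<lambda>t. indicator {a..b} t *\<^sub>R rep_l2 x t)"
proof -
  have "square_integrable (\<lambda>t. complex_of_real (indicator {a..b} t))"
    unfolding square_integrable_def
  proof
    have "(\<lambda>t. (cmod (complex_of_real (indicator {a..b} t)))\<^sup>2) = indicat_real {a..b}"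
      by (auto simp: indicator_def)
    moreover have "integrable lebesgue (indicat_real {a..b})"
      by (rule integrable_real_indicator) (simp_all add: emeasure_lborel_Icc_eq)
    ultimately show "integrable lebesgue (\<lambda>t. (cmod (complex_of_real (indicator {a..b} t)))\<^sup>2)"
      by simp
    show "(\<lambda>t. complex_of_real (indicator {a..b} t)) \<in> borel_measurable lebesgue"
      by (rule measurable_compose[OF borel_measurable_indicator borel_measurable_of_real]) simp
  qed
  from integrable_square_integrable_mult[OF square_integrable_rep_l2 this]
  show ?thesis by (simp add: scaleR_conv_of_real mult.commute)
qed

text \<open>Bumps approximate interval indicators boundedly, so all interval integrals of x vanish.
  Rational endpoints make the family countable, ready for Gram-Schmidt.\<close>

lemma bump_total:
  assumes zero: "\<And>(a::rat) (b::rat) n. (\<integral>t. rep_l2 x t * bump (of_rat a) (of_rat b) n t \<partial>lebesgue) = 0"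
  shows "x = 0"
proof -
  have interval: "(\<integral>t. indicator {a<..<b} t *\<^sub>R rep_l2 x t \<partial>lebesgue) = 0" for a b
  proof -
    obtain p q :: "nat \<Rightarrow> rat" where p: "(\<lambda>k. real_of_rat (p k)) \<longlonglongrightarrow> a" "\<And>k. \<bar>real_of_rat (p k) - a\<bar> \<le> 1"
      and q: "(\<lambda>k. real_of_rat (q k)) \<longlonglongrightarrow> b" "\<And>k. \<bar>real_of_rat (q k) - b\<bar> \<le> 1"
      using exists_rat_seq by metis
    let ?f = "\<lambda>k t. rep_l2 x t * complex_of_real (bump (of_rat (p k)) (of_rat (q k)) k t)"
    have "(\<lambda>k. \<integral>t. ?f k t \<partial>lebesgue) \<longlonglongrightarrow> (\<integral>t. indicator {a<..<b} t *\<^sub>R rep_l2 x t \<partial>lebesgue)"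
    proof (rule integral_dominated_convergence)
      \<comment> \<open>The approximating endpoints stay within distance 1 of a and b, so all bumps
        live in \<open>{a-1..b+1}\<close> and are at most 1.\<close>
      show "integrable lebesgue (\<lambda>t. norm (indicator {a-1..b+1} t *\<^sub>R rep_l2 x t))"
        by (intro integrable_norm integrable_rep_l2_interval)
      show "(\<lambda>t. indicator {a<..<b} t *\<^sub>R rep_l2 x t) \<in> borel_measurable lebesgue"
        by (intro borel_measurable_scaleR rep_l2_measurable borel_measurable_indicator) simp
      show "?f k \<in> borel_measurable lebesgue" for k
      proof -
        obtain D where D: "D 0 = (\<lambda>t. complex_of_real (bump (of_rat (p k)) (of_rat (q k)) k t))" "test_chain D"
          using exists_bump_chain by blast
        have "D 0 \<in> borel_measurable lebesgue"
          using test_chain_square_integrable[OF D(2), of 0] by (simp add: square_integrable_def)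
        then show ?thesis unfolding D(1) by (intro borel_measurable_times rep_l2_measurable)
      qed
      show "AE t in lebesgue. norm (?f k t) \<le> norm (indicator {a-1..b+1} t *\<^sub>R rep_l2 x t)" for k
      proof (rule AE_I2)
        fix t
        show "norm (?f k t) \<le> norm (indicator {a-1..b+1} t *\<^sub>R rep_l2 x t)"
        proof (cases "t \<in> {a-1..b+1}")
          case True
          then show ?thesis
            using bump_nonneg[of "of_rat (p k)" "of_rat (q k)" k t] bump_le_1[of "of_rat (p k)" "of_rat (q k)" k t]
            by (simp add: norm_mult mult_left_le)
        next
          case False
          then have "t \<notin> {of_rat (p k)<..<of_rat (q k)}"
            using p(2)[of k] q(2)[of k] by (auto simp: abs_le_iff)
          then show ?thesis by (simp add: bump_eq_0)
        qed
      qed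
      \<comment> \<open>At the two endpoints the limit of the bumps is not determined; they form a
        null set.\<close>
      have "AE t in lebesgue. t \<notin> {a, b}" by (intro AE_not_in negligible_iff_null_sets[THEN iffD1]) simp
      then show "AE t in lebesgue. (\<lambda>k. ?f k t) \<longlonglongrightarrow> indicator {a<..<b} t *\<^sub>R rep_l2 x t"
      proof eventually_elim
        case (elim t)
        have "(\<lambda>k. exp_recip 1 (real (Suc k) * (t - of_rat (p k)))) \<longlonglongrightarrow> (if 0 < t - a then 1 else 0)"
          "(\<lambda>k. exp_recip 1 (real (Suc k) * (of_rat (q k) - t))) \<longlonglongrightarrow> (if 0 < b - t then 1 else 0)"
          using elim by (intro exp_recip_scaled_tendsto tendsto_intros p q; simp)+
        from tendsto_mult[OF this]
        have "(\<lambda>k. bump (of_rat (p k)) (of_rat (q k)) k t) \<longlonglongrightarrow> indicator {a<..<b} t"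
          by (simp add: bump_def indicator_def split: if_splits)
        then have "(\<lambda>k. ?f k t) \<longlonglongrightarrow> rep_l2 x t * complex_of_real (indicator {a<..<b} t)"
          by (intro tendsto_intros)
        then show ?case by (simp add: scaleR_conv_of_real mult.commute)
      qed
    qed
    then show ?thesis using zero by (simp add: LIMSEQ_const_iff)
  qed
  \<comment> \<open>An L2 function may fail to be integrable on the line, so the criterion is
    applied to its truncations to (-N, N).\<close>
  have "AE t in lebesgue. indicator {- real N<..<real N} t *\<^sub>R rep_l2 x t = 0" for N :: nat
  proof (rule AE_zero_if_interval_integrals_zero)
    have "(\<lambda>t. indicat_real {- real N<..<real N} t *\<^sub>R rep_l2 x t)
        = (\<lambda>t. indicat_real {- real N<..<real N} t *\<^sub>R indicat_real {- real N..real N} t *\<^sub>R rep_l2 x t)"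
      by (auto simp: indicator_def)
    then show "integrable lebesgue (\<lambda>t. indicator {- real N<..<real N} t *\<^sub>R rep_l2 x t)"
      using integrable_mult_indicator[OF _ integrable_rep_l2_interval[of "- real N" "real N" x], of "{- real N<..<real N}"]
      by (simp del: scaleR_scaleR)
    show "(LINT t:{a<..<b}|lebesgue. indicator {- real N<..<real N} t *\<^sub>R rep_l2 x t) = 0" for a b
    proof -
      have "indicat_real {a<..<b} t *\<^sub>R indicat_real {- real N<..<real N} t *\<^sub>R rep_l2 x t
          = indicat_real {max a (- real N)<..<min b (real N)} t *\<^sub>R rep_l2 x t" for t
        by (auto simp: indicator_def)
      then show ?thesis unfolding set_lebesgue_integral_def by (simp only: interval)
    qed
    show "(\<integral>t. indicator {- real N<..<real N} t *\<^sub>R rep_l2 x t \<partial>lebesgue) = 0" by (rule interval)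
  qed
  then have "AE t in lebesgue. \<forall>N::nat. indicator {- real N<..<real N} t *\<^sub>R rep_l2 x t = 0"
    unfolding AE_all_countable by blast
  then have "AE t in lebesgue. rep_l2 x t = 0"
  proof eventually_elim
    case (elim t)
    obtain N where "\<bar>t\<bar> < real N" using reals_Archimedean2 by blast
    then show ?case using elim[rule_format, of N] by (simp add: indicator_def abs_less_iff split: if_splits)
  qed
  then show ?thesis unfolding l2_eq_iff using rep_l2_zero by eventually_elim simp
qed

section \<open>An orthonormal basis of test functions\<close>

text \<open>\<open>G j\<close> is a normalised copy of one bump, dilated by 4^j and moved to the
  interval from 4^j to twice 4^j. Disjoint supports give orthogonality; normalisation makes the
  height of order 2^-j, and each differentiation contributes a further factor 4^-j \<le> 1.\<close>

lemma exists_spreading_bumps: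
  "\<exists>G M. (\<forall>j::nat. test_chain (G j)) \<and> orthonormal_seq (\<lambda>j. abs_l2 (G j 0)) \<and>
    (\<forall>j i s. cmod (G j i s) \<le> (1/2) ^ j * M i) \<and> (\<forall>j s. G j 0 s \<noteq> 0 \<longrightarrow> 4 ^ j < s)"
proof -
  obtain R where R0: "R 0 = (\<lambda>s. complex_of_real (bump 0 1 0 s))" and R: "test_chain R"
    using exists_bump_chain by blast
  have "\<exists>N. \<forall>s. cmod (R i s) \<le> N" for i using C0_bounded[OF test_chain_C0[OF R]] by blast
  then obtain N where N: "\<And>i s. cmod (R i s) \<le> N i" by metis
  let ?\<phi> = "\<lambda>s. (cmod (R 0 s))\<^sup>2"
  define c2 where "c2 = (\<integral>s. ?\<phi> s \<partial>lborel)"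
  have contR: "continuous_on UNIV (R 0)" using test_chain_C0[OF R] by (simp add: C0_def)
  then have R_borel [measurable]: "R 0 \<in> borel_measurable borel"
    by (simp add: borel_measurable_continuous_onI)
  have int: "integrable lborel ?\<phi>"
    using test_chain_square_integrable[OF R, of 0]
    by (simp add: square_integrable_def integrable_completion)
  \<comment> \<open>The bump is positive on (0, 1), so its squared norm can be divided out.\<close>
  have "c2 \<noteq> 0"
  proof
    assume "c2 = 0"
    then have "AE s in lborel. ?\<phi> s = 0"
      unfolding c2_def by (subst (asm) integral_nonneg_eq_0_iff_AE[OF int]) auto
    then have "AE s in lborel. s \<notin> {0<..<1::real}"
      by eventually_elim (use bump_pos[of 0 _ 1 0] in \<open>force simp: R0\<close>)
    then have "{0<..<1::real} \<in> null_sets lborel"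
      by (subst AE_iff_null_sets) auto
    then show False by (simp add: null_sets_def)
  qed
  moreover have "0 \<le> c2" unfolding c2_def by simp
  ultimately have c2: "0 < c2" by simp
  define G where "G j i s = complex_of_real ((1/2) ^ j / sqrt c2) * (((1/4) ^ j) ^ i *\<^sub>R R i ((1/4) ^ j * s + - 1))"
    for j i s
  have supp: "4 ^ j < s \<and> s < 2 * 4 ^ j" if "G j 0 s \<noteq> 0" for j s
  proof -
    have "bump 0 1 0 ((1/4) ^ j * s + - 1) \<noteq> 0" using that by (auto simp: G_def R0)
    then have "(1/4) ^ j * s + - 1 \<in> {0<..<1}" by (rule contrapos_np) (rule bump_eq_0)
    then show ?thesis by (simp add: power_divide field_simps)
  qed
  have chain: "test_chain (G j)" for j
  proof (rule test_chainI)
    have "deriv_chain R" using R by (simp add: test_chain_def)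
    from deriv_chain_bounded_linear[OF bounded_linear_mult_right deriv_chain_affine[OF this, of "(1/4) ^ j" "- 1"]]
    show "deriv_chain (G j)" unfolding G_def .
    fix s :: real assume "2 * 4 ^ j < \<bar>s\<bar>"
    moreover have "(0::real) < 4 ^ j" by simp
    ultimately show "G j 0 s = 0" using supp[of j s] by (cases "G j 0 s = 0") auto
  qed
  have bound: "cmod (G j i s) \<le> (1/2) ^ j * (N i / sqrt c2)" for j i s
  proof -
    have "cmod (G j i s) = (1/2) ^ j / sqrt c2 * (((1/4) ^ j) ^ i * cmod (R i ((1/4) ^ j * s + - 1)))"
      using c2 by (simp add: G_def norm_mult norm_divide norm_power)
    also have "\<dots> \<le> (1/2) ^ j / sqrt c2 * (1 * N i)"
      using c2 N by (intro mult_left_mono mult_mono power_le_one) auto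
    finally show ?thesis by simp
  qed
  have sq: "square_integrable (G j 0)" for j by (rule test_chain_square_integrable[OF chain])
  have norm: "cinner (abs_l2 (G j 0)) (abs_l2 (G j 0)) = 1" for j
  proof -
    \<comment> \<open>The dilation multiplies the squared norm by 4^j, which the squared height
      factor 4^-j cancels.\<close>
    have affine: "c2 = (1/4) ^ j * (\<integral>s. ?\<phi> (- 1 + (1/4) ^ j * s) \<partial>lborel)"
      unfolding c2_def by (subst lborel_integral_real_affine[of "(1/4) ^ j" ?\<phi> "- 1"]) simp_all
    have "G j 0 s * cnj (G j 0 s) = complex_of_real (((1/4) ^ j / c2) * ?\<phi> (- 1 + (1/4) ^ j * s))" for s
    proof -
      have "((1/2::real) ^ j / sqrt c2)\<^sup>2 = (1/4) ^ j / c2"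
      proof -
        have "((1/2::real) ^ j)\<^sup>2 = (1/4) ^ j"
          by (simp add: power2_eq_square flip: power_mult_distrib)
        then show ?thesis using c2 by (simp only: power_divide[of "(1/2) ^ j"]) simp
      qed
      moreover have "G j 0 s * cnj (G j 0 s)
          = complex_of_real ((((1/2) ^ j / sqrt c2) * cmod (R 0 (- 1 + (1/4) ^ j * s)))\<^sup>2)"
        using c2 by (simp only: complex_norm_square[symmetric])
          (simp add: G_def norm_mult norm_divide norm_power add.commute)
      ultimately show ?thesis by (simp only: power_mult_distrib)
    qed
    then have "cinner (abs_l2 (G j 0)) (abs_l2 (G j 0))
        = (\<integral>s. complex_of_real (((1/4) ^ j / c2) * ?\<phi> (- 1 + (1/4) ^ j * s)) \<partial>lebesgue)"
      by (simp only: cinner_abs_l2[OF sq sq])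
    also have "\<dots> = complex_of_real ((1/4) ^ j / c2 * (\<integral>s. ?\<phi> (- 1 + (1/4) ^ j * s) \<partial>lborel))"
    proof -
      have "(\<lambda>s. ?\<phi> (- 1 + (1/4) ^ j * s)) \<in> borel_measurable lborel" by measurable
      then show ?thesis
        by (simp only: integral_complex_of_real integral_mult_right_zero integral_completion)
    qed
    also have "\<dots> = 1" using affine c2 by (simp only: times_divide_eq_left flip: affine) simp
    finally show ?thesis .
  qed
  have orth: "cinner (abs_l2 (G i 0)) (abs_l2 (G j 0)) = 0" if "i < j" for i j
  proof -
    have "G i 0 s * cnj (G j 0 s) = 0" for s
    proof (rule ccontr)
      assume "G i 0 s * cnj (G j 0 s) \<noteq> 0"
      then have "s < 2 * 4 ^ i" "4 ^ j < s" using supp by auto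
      moreover have "(2::real) * 4 ^ i \<le> 4 ^ Suc i" by simp
      moreover have "(4::real) ^ Suc i \<le> 4 ^ j" using that by (intro power_increasing) auto
      ultimately show False by linarith
    qed
    then show ?thesis by (simp only: cinner_abs_l2[OF sq sq]) simp
  qed
  have "orthonormal_seq (\<lambda>j. abs_l2 (G j 0))"
    unfolding orthonormal_seq_def
  proof (intro allI)
    fix m n
    show "cinner (abs_l2 (G m 0)) (abs_l2 (G n 0)) = (if m = n then 1 else 0)"
      using norm[of m] orth[of m n] orth[of n m] cinner_commute[of "abs_l2 (G m 0)" "abs_l2 (G n 0)"]
      by (cases m n rule: linorder_cases) auto
  qed
  then show ?thesis
    using chain bound supp by (intro exI[of _ G] exI[of _ "\<lambda>i. N i / sqrt c2"]) simp
qed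

definition test_space :: "l2 set" where
  "test_space = {abs_l2 (D 0) |D. test_chain D}"

lemma test_spaceI: "test_chain D \<Longrightarrow> abs_l2 (D 0) \<in> test_space"
  by (auto simp: test_space_def)

lemma test_spaceE:
  assumes "x \<in> test_space"
  obtains D where "test_chain D" "x = abs_l2 (D 0)"
  using assms by (auto simp: test_space_def)

lemma test_space_add:
  assumes "x \<in> test_space" "y \<in> test_space" shows "x + y \<in> test_space"
proof -
  obtain D E where D: "test_chain D" "x = abs_l2 (D 0)" and E: "test_chain E" "y = abs_l2 (E 0)"
    using assms by (auto elim!: test_spaceE)
  show ?thesis
    using test_spaceI[OF test_chain_add[OF D(1) E(1)]]
    by (simp add: D(2) E(2) abs_l2_add test_chain_square_integrable D(1) E(1))
qed

lemma test_space_scaleC: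
  assumes "x \<in> test_space" shows "c *\<^sub>C x \<in> test_space"
proof -
  obtain D where D: "test_chain D" "x = abs_l2 (D 0)" using assms by (rule test_spaceE)
  show ?thesis
    using test_spaceI[OF test_chain_scale[OF D(1)], of c]
    by (simp add: D(2) abs_l2_scaleC test_chain_square_integrable D(1))
qed

lemma test_space_sum:
  assumes "finite F" "0 \<in> test_space" "\<And>n. n \<in> F \<Longrightarrow> x n \<in> test_space"
  shows "(\<Sum>n\<in>F. x n) \<in> test_space"
  using assms by (induction F) (auto intro: test_space_add)

text \<open>Both bases, in the Hilbert space and in \<open>l2\<close>, are built in this two-halves
  shape, so that they can be matched position by position.\<close>

lemma orthonormal_basis_interleave:
  assumes E: "\<And>x y. x \<in> E \<Longrightarrow> y \<in> E \<Longrightarrow> cinner x y = (if x = y then 1 else 0)"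
    and total: "\<And>x. (\<And>y. y \<in> E \<Longrightarrow> cinner x y = 0) \<Longrightarrow> x = 0"
    and f: "inj f" and g: "inj g" and disj: "range f \<inter> range g = {}" and un: "range f \<union> range g = E"
  shows "orthonormal_basis (\<lambda>n. if even n then f (n div 2) else g (n div 2))"
    (is "orthonormal_basis ?u")
proof -
  have mem: "?u n \<in> E" for n using un by auto
  have "inj ?u"
  proof (rule injI)
    fix m n assume *: "?u m = ?u n"
    have fg: "f i \<noteq> g j" for i j using disj by (metis disjoint_iff rangeI)
    show "m = n"
    proof (cases "even m"; cases "even n")
      assume "even m" "even n"
      then show ?thesis using * injD[OF f] by (metis dvd_mult_div_cancel)
    next
      assume "odd m" "odd n"
      then show ?thesis using * injD[OF g] by (metis odd_two_times_div_two_succ)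
    qed (use * fg fg[symmetric] in auto)
  qed
  then have "?u m = ?u n \<longleftrightarrow> m = n" for m n by (rule inj_eq)
  then have "orthonormal_seq ?u"
    unfolding orthonormal_seq_def by (intro allI) (simp only: E[OF mem mem])
  moreover have "x = 0" if x: "\<And>n. cinner x (?u n) = 0" for x
  proof (rule total)
    fix y assume "y \<in> E"
    then consider i where "y = f i" | i where "y = g i" using un by blast
    then show "cinner x y = 0"
    proof cases
      case (1 i)
      then show ?thesis using x[of "2 * i"] by simp
    next
      case (2 i)
      then show ?thesis using x[of "2 * i + 1"] by simp
    qed
  qed
  ultimately show ?thesis unfolding orthonormal_basis_def by blast
qed

text \<open>Only the odd positions carry a summability claim: they receive the spreading bumps
  \<open>g (2 * k)\<close>. Everything else goes to the even positions with arbitrary finite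
  bounds.\<close>

lemma exists_test_basis:
  "\<exists>D M. (\<forall>n. test_chain (D n)) \<and> orthonormal_basis (\<lambda>n. abs_l2 (D n 0)) \<and>
    (\<forall>n i s. cmod (D n i s) \<le> M n i) \<and> (\<forall>i. summable (\<lambda>k. M (2 * k + 1) i))"
proof -
  obtain G M where G: "\<And>j::nat. test_chain (G j)" and g: "orthonormal_seq (\<lambda>j. abs_l2 (G j 0))"
    and M: "\<And>j i s. cmod (G j i s) \<le> (1/2) ^ j * M i" and supp: "\<And>j s. G j 0 s \<noteq> 0 \<Longrightarrow> 4 ^ j < s"
    using exists_spreading_bumps by metis
  define g where "g j = abs_l2 (G j 0)" for j
  have gg: "cinner (g i) (g j) = (if i = j then 1 else 0)" for i j
    using g unfolding orthonormal_seq_def g_def by blast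
  have sq: "square_integrable (D 0)" if "test_chain D" for D
    using that by (rule test_chain_square_integrable)
  have g_test: "g j \<in> test_space" for j unfolding g_def by (intro test_spaceI G)
  then have zero_test: "0 \<in> test_space" using test_space_scaleC[of "g 0" 0] by simp
  define V where "V = {x \<in> test_space. \<forall>j. cinner x (g j) = 0}"
  \<comment> \<open>The support of \<open>G j\<close> lies beyond 4^j, so a bump meets only finitely
    many of them; removing its components along all the \<open>g j\<close> is a finite subtraction
    and leaves a test function.\<close>
  have bumps: "\<exists>v\<in>V. \<forall>x. cinner x v = 0 \<longrightarrow> (\<forall>j. cinner x (g j) = 0) \<longrightarrow>
      (\<integral>t. rep_l2 x t * bump a b n t \<partial>lebesgue) = 0" for a b n
  proof -
    obtain D where D: "D 0 = (\<lambda>s. complex_of_real (bump a b n s))" "test_chain D"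
      using exists_bump_chain by blast
    obtain R where R: "\<And>s. R < \<bar>s\<bar> \<Longrightarrow> D 0 s = 0" using D(2) unfolding test_chain_def by blast
    obtain J where J: "R < 4 ^ J" using real_arch_pow[of 4 R] by auto
    define w where "w = abs_l2 (D 0)"
    define v where "v = w - (\<Sum>j<J. cinner w (g j) *\<^sub>C g j)"
    have far: "cinner w (g j) = 0" if "J \<le> j" for j
    proof -
      have "D 0 s * cnj (G j 0 s) = 0" for s
      proof (rule ccontr)
        assume "D 0 s * cnj (G j 0 s) \<noteq> 0"
        then have "4 ^ j < s" "\<not> R < \<bar>s\<bar>" using supp R by auto
        moreover have "(4::real) ^ J \<le> 4 ^ j" using that by (intro power_increasing) auto
        ultimately show False using J by linarith
      qed
      then show ?thesis unfolding w_def g_def by (simp only: cinner_abs_l2[OF sq[OF D(2)] sq[OF G]]) simp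
    qed
    have "cinner v (g j) = 0" for j
    proof -
      have "(\<Sum>i<J. cinner (cinner w (g i) *\<^sub>C g i) (g j)) = (\<Sum>i<J. if i = j then cinner w (g j) else 0)"
        by (intro sum.cong) (auto simp: cinner_scaleC_left gg)
      then show ?thesis using far[of j] by (simp add: v_def cinner_diff_left cinner_sum_left)
    qed
    moreover have "v \<in> test_space"
    proof -
      have "w \<in> test_space" unfolding w_def by (intro test_spaceI D)
      moreover have "(\<Sum>j<J. cinner w (g j) *\<^sub>C g j) \<in> test_space"
        by (intro test_space_sum zero_test test_space_scaleC g_test) simp
      ultimately have "w + (- 1) *\<^sub>C (\<Sum>j<J. cinner w (g j) *\<^sub>C g j) \<in> test_space"
        by (intro test_space_add test_space_scaleC)
      then show ?thesis by (simp add: v_def scaleC_minus_one)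
    qed
    moreover have "(\<integral>t. rep_l2 x t * bump a b n t \<partial>lebesgue) = 0"
      if "cinner x v = 0" "\<forall>j. cinner x (g j) = 0" for x
    proof -
      have "cinner x w = 0"
        using that by (simp add: v_def cinner_diff_right cinner_sum_right cinner_scaleC_right)
      then show ?thesis by (simp add: w_def cinner_abs_l2_right[OF sq[OF D(2)]] D(1)[THEN fun_cong])
    qed
    ultimately show ?thesis unfolding V_def by blast
  qed
  \<comment> \<open>\<open>from_nat\<close> reaches every triple, turning the rational bumps into a
    single sequence for Gram-Schmidt.\<close>
  define params :: "nat \<Rightarrow> rat \<times> rat \<times> nat" where "params = from_nat"
  have "\<exists>v\<in>V. \<forall>x. cinner x v = 0 \<longrightarrow> (\<forall>j. cinner x (g j) = 0) \<longrightarrow>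
      (\<forall>a b n. params k = (a, b, n) \<longrightarrow> (\<integral>t. rep_l2 x t * bump (of_rat a) (of_rat b) n t \<partial>lebesgue) = 0)" for k
    using bumps by (cases "params k") auto
  then obtain w where w: "\<And>k. w k \<in> V" and w_total: "\<And>k x a b n. cinner x (w k) = 0 \<Longrightarrow>
      \<forall>j. cinner x (g j) = 0 \<Longrightarrow> params k = (a, b, n) \<Longrightarrow>
      (\<integral>t. rep_l2 x t * bump (of_rat a) (of_rat b) n t \<partial>lebesgue) = 0"
    by metis
  have "x + y \<in> V" "c *\<^sub>C x \<in> V" if "x \<in> V" "y \<in> V" for x y c
    using that unfolding V_def
    by (simp_all add: cinner_add_left cinner_scaleC_left test_space_add test_space_scaleC)
  with exists_orthonormal_set[of w V, OF w]
  obtain B where B: "countable B" "B \<subseteq> V" "\<forall>x\<in>B. \<forall>y\<in>B. cinner x y = (if x = y then 1 else 0)"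
    and B_total: "\<forall>x. (\<forall>y\<in>B. cinner x y = 0) \<longrightarrow> (\<forall>n. cinner x (w n) = 0)"
    by (metis (no_types, lifting))
  have total: "x = 0" if "\<forall>y\<in>B. cinner x y = 0" "\<forall>j. cinner x (g j) = 0" for x
  proof (rule bump_total)
    fix a b n
    have "params (to_nat (a, b, n)) = (a, b, n)" by (simp add: params_def)
    then show "(\<integral>t. rep_l2 x t * bump (of_rat a) (of_rat b) n t \<partial>lebesgue) = 0"
      using w_total B_total that by blast
  qed
  have g_inj: "inj g" by (rule injI) (metis gg zero_neq_one)
  \<comment> \<open>The bumps with odd index join B to make the even half infinite whatever the size
    of B.\<close>
  define H where "H = B \<union> range (\<lambda>k. g (2 * k + 1))"
  have "inj (\<lambda>k. g (2 * k + 1))" by (rule injI) (auto dest: injD[OF g_inj])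
  then have "infinite H" "countable H"
    using B(1) by (auto simp: H_def range_inj_infinite)
  then have "bij_betw (from_nat_into H) UNIV H" by (intro bij_betw_from_nat_into)
  then have h: "inj (from_nat_into H)" "range (from_nat_into H) = H" by (auto simp: bij_betw_def)
  define u where "u = (\<lambda>n. if even n then from_nat_into H (n div 2) else g (2 * (n div 2)))"
  have Bg: "cinner y (g j) = 0" "cinner (g j) y = 0" if "y \<in> B" for y j
    using that B(2) cinner_commute[of "g j" y] by (auto simp: V_def)
  have g_notin_B: "g j \<notin> B" for j using Bg(1)[of "g j" j] gg by auto
  have basis: "orthonormal_basis u"
    unfolding u_def
  proof (rule orthonormal_basis_interleave[where E = "B \<union> range g"])
    show "cinner x y = (if x = y then 1 else 0)" if "x \<in> B \<union> range g" "y \<in> B \<union> range g" for x y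
      using that B(3) Bg gg g_notin_B by (auto simp: inj_eq[OF g_inj])
    show "x = 0" if "\<And>y. y \<in> B \<union> range g \<Longrightarrow> cinner x y = 0" for x
      using that by (intro total) auto
    show "inj (\<lambda>k. g (2 * k))" by (rule injI) (auto dest: injD[OF g_inj])
    have "g (2 * l) \<noteq> g (2 * k + 1)" for k l
      unfolding inj_eq[OF g_inj] by presburger
    then show "range (from_nat_into H) \<inter> range (\<lambda>k. g (2 * k)) = {}"
      using g_notin_B unfolding h(2) by (auto simp: H_def)
    have "g j \<in> range (\<lambda>k. g (2 * k + 1)) \<union> range (\<lambda>k. g (2 * k))" for j
      by (cases "even j") (auto elim!: evenE oddE)
    then show "range (from_nat_into H) \<union> range (\<lambda>k. g (2 * k)) = B \<union> range g"
      unfolding h(2) by (auto simp: H_def)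
  qed (rule h)
  have "\<exists>D N. test_chain D \<and> u n = abs_l2 (D 0) \<and> (\<forall>i s. cmod (D i s) \<le> N i) \<and>
      (odd n \<longrightarrow> N = (\<lambda>i. (1/2) ^ (2 * (n div 2)) * M i))" for n
  proof (cases "even n")
    case True
    have "H \<subseteq> test_space" using B(2) g_test by (auto simp: H_def V_def)
    then have "u n \<in> test_space" using True h(2) by (auto simp: u_def)
    then obtain D where D: "test_chain D" "u n = abs_l2 (D 0)" by (rule test_spaceE)
    have "\<exists>N. \<forall>s. cmod (D i s) \<le> N" for i using C0_bounded[OF test_chain_C0[OF D(1)]] by blast
    then obtain N where "\<And>i s. cmod (D i s) \<le> N i" by metis
    then show ?thesis using D True by blast
  next
    case False
    then show ?thesis
      using G[of "2 * (n div 2)"] M[of "2 * (n div 2)"]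
      by (intro exI[of _ "G (2 * (n div 2))"] exI[of _ "\<lambda>i. (1/2) ^ (2 * (n div 2)) * M i"])
        (auto simp: u_def g_def)
  qed
  then obtain D N where D: "\<And>n. test_chain (D n)" "\<And>n. u n = abs_l2 (D n 0)"
    "\<And>n i s. cmod (D n i s) \<le> N n i" "\<And>n. odd n \<Longrightarrow> N n = (\<lambda>i. (1/2) ^ (2 * (n div 2)) * M i)"
    by metis
  have "summable (\<lambda>k. N (2 * k + 1) i)" for i
  proof -
    have "(\<lambda>k. N (2 * k + 1) i) = (\<lambda>k. (1/4) ^ k * M i)"
      by (simp add: D(4) power_mult power2_eq_square)
    then show ?thesis by (auto intro!: summable_mult2 summable_geometric)
  qed
  moreover have "(\<lambda>n. abs_l2 (D n 0)) = u" using D(2) by auto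
  ultimately show ?thesis using D basis by metis
qed

section \<open>Kernels of operators that are small on a weighted test basis\<close>

lemma measurable_cnj: "f \<in> borel_measurable N \<Longrightarrow> (\<lambda>t. cnj (f t)) \<in> borel_measurable N"
  by (rule borel_measurable_continuous_on[OF continuous_on_cnj[OF continuous_on_id]])

text \<open>Square integrability of the sections is inherited from \<open>k s\<close>, after which
  the value of \<open>abs_l2\<close> is forced.\<close>

lemma carleman_eqI:
  assumes K: "\<And>s. AE t in lebesgue. rep_l2 (k s) t = cnj (K (s, t))"
    and meas: "\<And>s. (\<lambda>t. cnj (K (s, t))) \<in> borel_measurable lebesgue"
  shows "square_integrable (\<lambda>t. cnj (K (s, t)))" "carleman_fun K = k"
proof -
  show sq: "square_integrable (\<lambda>t. cnj (K (s, t)))" for s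
    by (rule square_integrable_cong_AE[OF K meas])
  show "carleman_fun K = k"
    unfolding carleman_fun_def by (rule ext) (rule abs_l2_eqI[OF sq K, symmetric])
qed

lemma Kinf_kernel_imp_bi_carleman:
  assumes "Kinf_kernel K" "K \<in> borel_measurable lebesgue" shows "bi_carleman_kernel K"
proof -
  have "Km_kernel 0 K" using assms(1) by (simp add: Kinf_kernel_def)
  then have C0: "C0 K" and sq: "\<And>s. square_integrable (\<lambda>t. cnj (K (s, t)))"
    "\<And>s. square_integrable (\<lambda>t. cnj (conj_transpose K (s, t)))"
    by (simp_all add: Km_kernel_def smooth_carleman_fun_def)
  have cnj: "square_integrable f" if "square_integrable (\<lambda>t. cnj (f t))" for f
    using that measurable_cnj[of "\<lambda>t. cnj (f t)"] unfolding square_integrable_def by simp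
  have "continuous_on UNIV (\<lambda>p. cnj (K (snd p, fst p)))"
    using C0 unfolding C0_def
    by (intro continuous_on_cnj continuous_on_compose2[of UNIV K UNIV "\<lambda>p. (snd p, fst p)"])
       (auto intro!: continuous_on_Pair continuous_on_fst continuous_on_snd continuous_on_id)
  then have "conj_transpose K \<in> borel_measurable borel"
    by (simp add: conj_transpose_def case_prod_beta borel_measurable_continuous_onI)
  then have "conj_transpose K \<in> borel_measurable lebesgue"
    by (intro measurable_completion) simp
  then show ?thesis
    using assms(2) cnj[OF sq(1)] cnj[OF sq(2)] by (simp add: bi_carleman_kernel_def carleman_kernel_def)
qed

text \<open>The weights q damp the sup norms M of the basis functions and their derivatives;
  \<open>summable_qM\<close> for every i permits termwise differentiation of the kernel series to
  any order.\<close>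

locale weighted_test_basis =
  fixes D :: "nat \<Rightarrow> nat \<Rightarrow> real \<Rightarrow> complex" and M :: "nat \<Rightarrow> nat \<Rightarrow> real" and q :: "nat \<Rightarrow> real"
  assumes test: "test_chain (D n)" and basis: "orthonormal_basis (\<lambda>n. abs_l2 (D n 0))"
    and bound: "cmod (D n i s) \<le> M n i"
    and q_nonneg: "0 \<le> q n" and q_le_1: "q n \<le> 1"
    and summable_qM: "summable (\<lambda>n. q n * M n i)"
begin

abbreviation u :: "nat \<Rightarrow> l2" where "u n \<equiv> abs_l2 (D n 0)"

text \<open>The square leaves one factor q for each matrix index once the bounds for A and its
  adjoint are combined in \<open>coef_le\<close>.\<close>

definition small :: "(l2 \<Rightarrow> l2) \<Rightarrow> bool" where
  "small A \<longleftrightarrow> bounded_clinear A \<and>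
     (\<exists>C\<ge>0. \<forall>n. norm (A (u n)) \<le> C * (q n)\<^sup>2 \<and> norm (cadjoint A (u n)) \<le> C * (q n)\<^sup>2)"

lemma M_nonneg: "0 \<le> M n i"
  using bound[of n i 0] norm_ge_zero order_trans by blast

lemma norm_u: "norm (u n) = 1"
  by (rule orthonormal_seq_norm[OF orthonormal_basisD[OF basis]])

lemma q_sq_le: "(q n)\<^sup>2 \<le> q n"
  using q_nonneg[of n] q_le_1[of n] by (simp add: power2_eq_square mult_left_le)

lemma chain_D: "deriv_chain (D n)"
  using test by (simp add: test_chain_def)

section \<open>The kernel of a single operator with rapid decay on the basis\<close>

context
  fixes A :: "l2 \<Rightarrow> l2" and C :: real
  assumes A: "bounded_clinear A" and C: "0 \<le> C"
    and A_le: "norm (A (u n)) \<le> C * (q n)\<^sup>2" and A_adj_le: "norm (cadjoint A (u n)) \<le> C * (q n)\<^sup>2"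
begin

definition coef :: "nat \<Rightarrow> nat \<Rightarrow> complex" where
  "coef m n = cinner (A (u n)) (u m)"

text \<open>The j-th derivative of the m-th row function; \<open>row m 0\<close> is a pointwise
  version of the conjugate of \<open>cadjoint A (u m)\<close>.\<close>

definition row :: "nat \<Rightarrow> nat \<Rightarrow> real \<Rightarrow> complex" where
  "row m j t = (\<Sum>n. coef m n * cnj (D n j t))"

text \<open>The derivative of order i in s and j in t of the kernel \<open>kernel 0 0\<close>.
  Summing by rows makes every step a series in one index.\<close>

definition kernel :: "nat \<Rightarrow> nat \<Rightarrow> real \<times> real \<Rightarrow> complex" where
  "kernel i j = (\<lambda>(s, t). \<Sum>m. D m i s * row m j t)"

definition row_sum :: "nat \<Rightarrow> real" where "row_sum j = (\<Sum>n. q n * M n j)"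

lemma coef_adjoint: "coef m n = cinner (u n) (cadjoint A (u m))"
  by (simp add: coef_def cinner_cadjoint[OF basis A])

text \<open>The entries are bounded by both \<open>C (q m)\<^sup>2\<close> and \<open>C (q n)\<^sup>2\<close>, hence by the geometric mean.\<close>

lemma coef_le: "cmod (coef m n) \<le> C * q m * q n"
proof (rule power2_le_imp_le)
  have "cmod (coef m n) \<le> C * (q n)\<^sup>2"
    using norm_cinner_le[of "A (u n)" "u m"] A_le[of n] by (simp add: coef_def norm_u)
  moreover have "cmod (coef m n) \<le> C * (q m)\<^sup>2"
    using norm_cinner_le[of "u n" "cadjoint A (u m)"] A_adj_le[of m] by (simp add: coef_adjoint norm_u)
  ultimately have "cmod (coef m n) * cmod (coef m n) \<le> (C * (q n)\<^sup>2) * (C * (q m)\<^sup>2)"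
    using C by (intro mult_mono) auto
  then show "(cmod (coef m n))\<^sup>2 \<le> (C * q m * q n)\<^sup>2"
    by (simp add: power2_eq_square mult_ac)
qed (use C q_nonneg in auto)

lemma row_term_le: "cmod (coef m n * cnj (D n j t)) \<le> C * q m * (q n * M n j)"
proof -
  have "cmod (coef m n) * cmod (D n j t) \<le> (C * q m * q n) * M n j"
    using C q_nonneg by (intro mult_mono coef_le bound) auto
  then show ?thesis by (simp add: norm_mult mult.assoc)
qed

lemma summable_row_bound: "summable (\<lambda>n. C * q m * (q n * M n j))"
  by (intro summable_mult summable_qM)

lemma row_sums: "(\<lambda>n. coef m n * cnj (D n j t)) sums row m j t"
  unfolding row_def
  by (rule summable_sums, rule summable_comparison_test'[OF summable_row_bound row_term_le])

text \<open>The inner sum consumes the factor \<open>q n\<close> of each entry; the remaining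
  \<open>q m\<close> makes the outer series converge.\<close>

lemma row_le: "cmod (row m j t) \<le> C * row_sum j * q m"
proof -
  have "cmod (row m j t) \<le> (\<Sum>n. C * q m * (q n * M n j))"
    unfolding row_def by (rule norm_suminf_le[OF row_term_le summable_row_bound])
  also have "\<dots> = C * q m * row_sum j"
    unfolding row_sum_def by (rule suminf_mult[OF summable_qM])
  finally show ?thesis by (simp add: mult_ac)
qed

lemma bounded_linear_coef_cnj: "bounded_linear (\<lambda>z. coef m n * cnj z)"
  by (rule bounded_linear_compose[OF bounded_linear_mult_right bounded_linear_cnj])

lemma row_chain: "deriv_chain (row m)"
proof -
  have "deriv_chain (\<lambda>j t. coef m n * cnj (D n j t))" for n
    by (rule deriv_chain_bounded_linear[OF bounded_linear_coef_cnj chain_D])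
  from deriv_chain_suminf[OF this row_term_le summable_row_bound]
  show ?thesis unfolding row_def .
qed

lemma row_C0: "C0 (row m j)"
  unfolding row_def
proof (rule C0_suminf[OF _ row_term_le summable_row_bound])
  show "C0 (\<lambda>t. coef m n * cnj (D n j t))" for n
    by (rule C0_bounded_linear[OF bounded_linear_coef_cnj test_chain_C0[OF test]])
qed

lemma kernel_term_le: "cmod (D m i s * row m j t) \<le> C * row_sum j * (q m * M m i)"
proof -
  have "cmod (D m i s) * cmod (row m j t) \<le> M m i * (C * row_sum j * q m)"
    using M_nonneg by (intro mult_mono bound row_le) auto
  then show ?thesis by (simp add: norm_mult mult_ac)
qed

lemma summable_kernel_bound: "summable (\<lambda>m. C * row_sum j * (q m * M m i))"
  by (intro summable_mult summable_qM)

lemma kernel_sums: "(\<lambda>m. D m i s * row m j t) sums kernel i j (s, t)"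
  unfolding kernel_def prod.case
  by (rule summable_sums, rule summable_comparison_test'[OF summable_kernel_bound kernel_term_le])

lemma kernel_C0: "C0 (kernel i j)"
proof -
  have "C0 (\<lambda>p. \<Sum>m. case p of (s, t) \<Rightarrow> D m i s * row m j t)"
    by (rule C0_suminf[OF C0_Times[OF test_chain_C0[OF test] row_C0] _ summable_kernel_bound])
       (auto intro: kernel_term_le)
  then show ?thesis by (simp add: kernel_def case_prod_beta')
qed

lemma kernel_chain_left: "deriv_chain (\<lambda>i s. kernel i j (s, t))"
proof -
  have "deriv_chain (\<lambda>i s. D m i s * row m j t)" for m
    by (rule deriv_chain_bounded_linear[OF bounded_linear_mult_left chain_D])
  from deriv_chain_suminf[OF this kernel_term_le summable_kernel_bound]
  show ?thesis by (simp add: kernel_def)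
qed

lemma kernel_chain_right: "deriv_chain (\<lambda>j t. kernel i j (s, t))"
proof -
  have "deriv_chain (\<lambda>j t. D m i s * row m j t)" for m
    by (rule deriv_chain_bounded_linear[OF bounded_linear_mult_right row_chain])
  from deriv_chain_suminf[OF this kernel_term_le summable_kernel_bound]
  show ?thesis by (simp add: kernel_def)
qed

lemma kernel_C0_partials: "C0_partials m (kernel i j)"
  by (rule C0_partials_chain)
     (auto intro: kernel_C0 deriv_chainD[OF kernel_chain_left] deriv_chainD[OF kernel_chain_right])

text \<open>For \<open>x m = A\<^sup>* (u m)\<close> these are the derivatives of the Carleman function of the kernel, for
  \<open>x m = A (u m)\<close> those of the Carleman function of its conjugate transpose.\<close>

definition carleman_chain :: "(nat \<Rightarrow> l2) \<Rightarrow> nat \<Rightarrow> real \<Rightarrow> l2" where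
  "carleman_chain x i s = (\<Sum>m. cnj (D m i s) *\<^sub>C x m)"

context
  fixes x :: "nat \<Rightarrow> l2"
  assumes x: "norm (x m) \<le> C * (q m)\<^sup>2"
begin

lemma carleman_term_le: "norm (cnj (D m i s) *\<^sub>C x m) \<le> C * (q m * M m i)"
proof -
  \<comment> \<open>Only a single series is summed here, so one of the two factors q is given
    up.\<close>
  have "norm (x m) \<le> C * q m"
    using x[of m] mult_left_mono[OF q_sq_le C, of m] by (rule order_trans)
  then have "cmod (D m i s) * norm (x m) \<le> M m i * (C * q m)"
    using M_nonneg by (intro mult_mono bound) auto
  then show ?thesis by (simp add: mult_ac)
qed

lemma carleman_sums: "(\<lambda>m. cnj (D m i s) *\<^sub>C x m) sums carleman_chain x i s"
  unfolding carleman_chain_def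
  by (rule summable_sums, rule summable_comparison_test'[OF summable_mult[OF summable_qM] carleman_term_le])

lemma carleman_C0_derivs: "C0_derivs m (carleman_chain x i)"
proof (rule C0_deriv_chain)
  have lin: "bounded_linear (\<lambda>c. cnj c *\<^sub>C x m)" for m
    by (rule bounded_linear_compose[OF bounded_linear_scaleC_left bounded_linear_cnj])
  have "deriv_chain (\<lambda>i s. cnj (D m i s) *\<^sub>C x m)" for m
    by (rule deriv_chain_bounded_linear[OF lin chain_D])
  from deriv_chain_suminf[OF this carleman_term_le summable_mult[OF summable_qM]]
  show "deriv_chain (carleman_chain x)" unfolding carleman_chain_def .
  have "C0 (\<lambda>s. cnj (D m i s) *\<^sub>C x m)" for m i
    by (rule C0_bounded_linear[OF lin test_chain_C0[OF test]])
  from C0_suminf[OF this carleman_term_le summable_mult[OF summable_qM]]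
  show "C0 (carleman_chain x i)" for i unfolding carleman_chain_def .
qed

end

lemma kernel_continuous: "continuous_on S (kernel i j)"
  using kernel_C0[of i j] unfolding C0_def by (meson continuous_on_subset subset_UNIV)

lemma measurable_kernel_section:
  "(\<lambda>t. kernel i j (s, t)) \<in> borel_measurable lebesgue" "(\<lambda>t. kernel i j (t, s)) \<in> borel_measurable lebesgue"
  by (intro measurable_completion; simp;
      intro borel_measurable_continuous_onI continuous_on_compose2[OF kernel_continuous[of UNIV]] continuous_intros; simp)+

text \<open>The Fourier coefficients of \<open>cadjoint A (u m)\<close> are the conjugated entries
  of row m, so its expansion is the conjugated row series.\<close>

lemma rep_l2_adjoint: "AE t in lebesgue. rep_l2 (cadjoint A (u m)) t = cnj (row m 0 t)"
proof (rule rep_l2_sums)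
  have "cinner (cadjoint A (u m)) (u n) = cnj (coef m n)" for n
    unfolding coef_adjoint by (rule cinner_commute)
  then show "(\<lambda>n. cnj (coef m n) *\<^sub>C u n) sums cadjoint A (u m)"
    using orthonormal_expansion[OF basis, of "cadjoint A (u m)"] by simp
  show "AE t in lebesgue. rep_l2 (u n) t = D n 0 t" for n
    by (rule rep_l2_abs_l2[OF test_chain_square_integrable[OF test]])
  show "(\<lambda>n. cnj (coef m n) * D n 0 t) sums cnj (row m 0 t)" for t
    using row_sums[of m 0 t, THEN sums_cnj[THEN iffD2]] by simp
qed

text \<open>Inserting the pointwise rows into the \<open>l2\<close> series of the Carleman function
  reproduces the conjugated kernel series.\<close>

lemma kernel_carleman:
  "square_integrable (\<lambda>t. cnj (kernel 0 0 (s, t)))"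
  "carleman_fun (kernel 0 0) = carleman_chain (\<lambda>m. cadjoint A (u m)) 0"
proof -
  have rep: "AE t in lebesgue. rep_l2 (carleman_chain (\<lambda>m. cadjoint A (u m)) 0 s) t = cnj (kernel 0 0 (s, t))" for s
  proof (rule rep_l2_sums[OF carleman_sums[OF A_adj_le] rep_l2_adjoint])
    show "(\<lambda>m. cnj (D m 0 s) * cnj (row m 0 t)) sums cnj (kernel 0 0 (s, t))" for t
      using kernel_sums[of 0 s 0 t, THEN sums_cnj[THEN iffD2]] by simp
  qed
  note * = carleman_eqI[OF rep measurable_cnj[OF measurable_kernel_section(1)]]
  show "square_integrable (\<lambda>t. cnj (kernel 0 0 (s, t)))"
    "carleman_fun (kernel 0 0) = carleman_chain (\<lambda>m. cadjoint A (u m)) 0"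
    by (rule *)+
qed

text \<open>The vectors \<open>A (u m)\<close> correspond to columns, while the kernel is summed by
  rows. Expanding the sum of the \<open>l2\<close> series in the basis yields the coefficients
  \<open>row m 0 s\<close> and hence the kernel series.\<close>

lemma kernel_transpose_carleman:
  "square_integrable (\<lambda>t. cnj (conj_transpose (kernel 0 0) (s, t)))"
  "carleman_fun (conj_transpose (kernel 0 0)) = carleman_chain (\<lambda>m. A (u m)) 0"
proof -
  have rep: "AE t in lebesgue. rep_l2 (carleman_chain (\<lambda>m. A (u m)) 0 s) t
      = cnj (conj_transpose (kernel 0 0) (s, t))" for s
  proof (rule rep_l2_sums[where f = "\<lambda>m. D m 0" and c = "\<lambda>m. row m 0 s" and x = u])
    have "(\<lambda>n. coef m n * cnj (D n 0 s)) sums cinner (carleman_chain (\<lambda>m. A (u m)) 0 s) (u m)" for m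
      using sums_cinner_left[OF carleman_sums[OF A_le]]
      by (simp add: cinner_scaleC_left coef_def mult.commute)
    then have "cinner (carleman_chain (\<lambda>m. A (u m)) 0 s) (u m) = row m 0 s" for m
      using row_sums sums_unique2 by blast
    then show "(\<lambda>m. row m 0 s *\<^sub>C u m) sums carleman_chain (\<lambda>m. A (u m)) 0 s"
      using orthonormal_expansion[OF basis, of "carleman_chain (\<lambda>m. A (u m)) 0 s"] by simp
    show "AE t in lebesgue. rep_l2 (u n) t = D n 0 t" for n
      by (rule rep_l2_abs_l2[OF test_chain_square_integrable[OF test]])
    show "(\<lambda>m. row m 0 s * D m 0 t) sums cnj (conj_transpose (kernel 0 0) (s, t))" for t
      using kernel_sums[of 0 t 0 s] by (simp add: conj_transpose_def mult.commute)
  qed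
  have meas: "(\<lambda>t. cnj (conj_transpose (kernel 0 0) (s, t))) \<in> borel_measurable lebesgue" for s
    using measurable_kernel_section(2) by (simp add: conj_transpose_def)
  show "square_integrable (\<lambda>t. cnj (conj_transpose (kernel 0 0) (s, t)))"
    "carleman_fun (conj_transpose (kernel 0 0)) = carleman_chain (\<lambda>m. A (u m)) 0"
    by (rule carleman_eqI[OF rep meas])+
qed

lemma Kinf_kernel_kernel: "Kinf_kernel (kernel 0 0)"
  unfolding Kinf_kernel_def Km_kernel_def smooth_carleman_fun_def
  by (intro allI conjI kernel_C0_partials kernel_carleman(1) kernel_transpose_carleman(1))
     (simp_all only: kernel_carleman(2) kernel_transpose_carleman(2)
        carleman_C0_derivs[OF A_le] carleman_C0_derivs[OF A_adj_le])

text \<open>The expansion of A f at s has terms <f, \<open>cadjoint A (u m)\<close>> u_m(s), which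
  sum to the inner product of f with the Carleman function at s, that is, to the integral against
  the kernel.\<close>

lemma kernel_of_kernel: "kernel_of (kernel 0 0) A"
  unfolding kernel_of_def
proof (intro conjI allI)
  show "kernel 0 0 \<in> borel_measurable lebesgue"
    by (intro measurable_completion) (simp add: borel_measurable_continuous_onI kernel_continuous)
  fix f
  have int: "integrable lebesgue (\<lambda>t. kernel 0 0 (s, t) * rep_l2 f t)" for s
    using integrable_square_integrable_mult[OF square_integrable_rep_l2 kernel_carleman(1), of f s]
    by (simp add: mult.commute)
  have "AE s in lebesgue. rep_l2 (A f) s = (\<integral>t. kernel 0 0 (s, t) * rep_l2 f t \<partial>lebesgue)"
  proof (rule rep_l2_sums[OF orthonormal_expansion[OF basis]])
    show "AE t in lebesgue. rep_l2 (u n) t = D n 0 t" for n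
      by (rule rep_l2_abs_l2[OF test_chain_square_integrable[OF test]])
    fix s
    have "(\<lambda>m. cinner f (cnj (D m 0 s) *\<^sub>C cadjoint A (u m))) sums
        cinner f (carleman_chain (\<lambda>m. cadjoint A (u m)) 0 s)"
      by (intro sums_cinner_right carleman_sums A_adj_le)
    moreover have "cinner f (carleman_chain (\<lambda>m. cadjoint A (u m)) 0 s)
        = (\<integral>t. rep_l2 f t * cnj (cnj (kernel 0 0 (s, t))) \<partial>lebesgue)"
      unfolding kernel_carleman(2)[symmetric] carleman_fun_def
      by (rule cinner_abs_l2_right[OF kernel_carleman(1)])
    ultimately show "(\<lambda>m. cinner (A f) (u m) * D m 0 s) sums (\<integral>t. kernel 0 0 (s, t) * rep_l2 f t \<partial>lebesgue)"
      by (simp add: cinner_scaleC_right cinner_cadjoint[OF basis A] mult.commute)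
  qed
  then show "AE s in lebesgue. integrable lebesgue (\<lambda>t. kernel 0 0 (s, t) * rep_l2 f t) \<and>
      rep_l2 (A f) s = (\<integral>t. kernel 0 0 (s, t) * rep_l2 f t \<partial>lebesgue)"
    using int by simp
qed

end

lemma small_imp_Kinf_kernel:
  assumes "small A" shows "\<exists>K. Kinf_kernel K \<and> kernel_of K A"
proof -
  obtain C where "0 \<le> C" "\<And>n. norm (A (u n)) \<le> C * (q n)\<^sup>2" "\<And>n. norm (cadjoint A (u n)) \<le> C * (q n)\<^sup>2"
    using assms unfolding small_def by blast
  moreover have "bounded_clinear A" using assms unfolding small_def by blast
  ultimately show ?thesis using Kinf_kernel_kernel[of A C] kernel_of_kernel[of A C] by blast
qed

section \<open>Stability of smallness: adjoints, Mercer factorizations and linear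
  combinations\<close>

lemma smallI:
  assumes A: "bounded_clinear A" and A_le: "\<And>n. norm (A (u n)) \<le> C * (q n)\<^sup>2"
    and B_le: "\<And>n. norm (cadjoint A (u n)) \<le> B * (q n)\<^sup>2"
  shows "small A"
  unfolding small_def
proof (intro conjI exI allI)
  fix n
  \<comment> \<open>C and B carry no sign condition; the maximum with 0 is one nonnegative constant
    for both bounds.\<close>
  show "norm (A (u n)) \<le> max 0 (max C B) * (q n)\<^sup>2"
    by (rule order_trans[OF A_le]) (intro mult_right_mono, auto)
  show "norm (cadjoint A (u n)) \<le> max 0 (max C B) * (q n)\<^sup>2"
    by (rule order_trans[OF B_le]) (intro mult_right_mono, auto)
qed (use A in auto)

lemma cadjoint_cadjoint: "bounded_clinear T \<Longrightarrow> cadjoint (cadjoint T) = T" for T :: "l2 \<Rightarrow> l2"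
  by (rule cadjoint_eqI) (metis cinner_cadjoint[OF basis] cinner_commute)

lemma cadjoint_compose:
  fixes S T :: "l2 \<Rightarrow> l2"
  assumes "bounded_clinear S" "bounded_clinear T"
  shows "cadjoint (S \<circ> T) = cadjoint T \<circ> cadjoint S"
  by (rule cadjoint_eqI) (simp add: cinner_cadjoint[OF basis] assms)

lemma small_cadjoint: "small T \<Longrightarrow> small (cadjoint T)"
  unfolding small_def using bounded_clinear_cadjoint[OF basis] cadjoint_cadjoint by metis

lemma compose_le:
  assumes "bounded_clinear B" "small T"
  shows "\<exists>C. \<forall>n. norm (B (T (u n))) \<le> C * (q n)\<^sup>2"
proof -
  obtain C where C: "\<And>n. norm (T (u n)) \<le> C * (q n)\<^sup>2" using assms(2) unfolding small_def by blast
  obtain K where K: "0 \<le> K" "\<And>x. norm (B x) \<le> K * norm x"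
    using bounded_clinear_bound[OF assms(1)] by blast
  have "norm (B (T (u n))) \<le> K * C * (q n)\<^sup>2" for n
    using order_trans[OF K(2) mult_left_mono[OF C K(1)]] by (simp add: mult.assoc)
  then show ?thesis by blast
qed

text \<open>The small right factor \<open>T'\<close> controls X on the basis; the small left factor
  T becomes a right factor of the adjoint and controls that.\<close>

lemma small_factorizations:
  assumes T: "small T" "small T'" and A: "bounded_clinear A" "bounded_clinear B"
    and X: "X = T \<circ> A" "X = B \<circ> T'"
  shows "small X"
proof -
  have bc: "bounded_clinear T" "bounded_clinear T'" using T by (simp_all add: small_def)
  obtain C where C: "\<And>n. norm (X (u n)) \<le> C * (q n)\<^sup>2"
    using compose_le[OF A(2) T(2)] X(2) by auto
  have "cadjoint X = cadjoint A \<circ> cadjoint T" unfolding X(1) by (rule cadjoint_compose[OF bc(1) A(1)])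
  moreover have "\<exists>C. \<forall>n. norm (cadjoint A (cadjoint T (u n))) \<le> C * (q n)\<^sup>2"
    by (rule compose_le[OF bounded_clinear_cadjoint[OF basis A(1)] small_cadjoint[OF T(1)]])
  ultimately obtain C' where "\<And>n. norm (cadjoint X (u n)) \<le> C' * (q n)\<^sup>2" by auto
  with C show ?thesis
    using bounded_clinear_compose[OF bc(1) A(1)] X(1) by (intro smallI) auto
qed

text \<open>Each of the two factorizations may involve T or its adjoint independently; both
  operators are small.\<close>

lemma small_mercer_set:
  assumes "small T" "X \<in> mercer_set T" shows "small X"
proof -
  have "\<exists>T1 A. X = T1 \<circ> A \<and> bounded_clinear A \<and> small T1"
    using assms small_cadjoint unfolding mercer_set_def by auto
  moreover have "\<exists>T2 B. X = B \<circ> T2 \<and> bounded_clinear B \<and> small T2"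
    using assms small_cadjoint unfolding mercer_set_def by auto
  ultimately show ?thesis using small_factorizations by blast
qed

lemma small_add:
  assumes "small S" "small T" shows "small (\<lambda>f. S f + T f)"
proof -
  have bc: "bounded_clinear S" "bounded_clinear T" using assms by (simp_all add: small_def)
  obtain C C' where C: "\<And>n. norm (S (u n)) \<le> C * (q n)\<^sup>2 \<and> norm (cadjoint S (u n)) \<le> C * (q n)\<^sup>2"
    and C': "\<And>n. norm (T (u n)) \<le> C' * (q n)\<^sup>2 \<and> norm (cadjoint T (u n)) \<le> C' * (q n)\<^sup>2"
    using assms unfolding small_def by blast
  have adj: "cadjoint (\<lambda>f. S f + T f) = (\<lambda>f. cadjoint S f + cadjoint T f)"
    by (rule cadjoint_eqI) (simp add: cinner_add_left cinner_add_right cinner_cadjoint[OF basis] bc)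
  show ?thesis
  proof (rule smallI[where C = "C + C'" and B = "C + C'"])
    show "bounded_clinear (\<lambda>f. S f + T f)"
      using bc by (auto simp: bounded_clinear_def scaleC_add_right intro: bounded_linear_add)
    show "norm (S (u n) + T (u n)) \<le> (C + C') * (q n)\<^sup>2" for n
      using C[of n] C'[of n] norm_triangle_ineq[of "S (u n)" "T (u n)"]
      by (simp add: distrib_right)
    show "norm (cadjoint (\<lambda>f. S f + T f) (u n)) \<le> (C + C') * (q n)\<^sup>2" for n
      unfolding adj using C[of n] C'[of n] norm_triangle_ineq[of "cadjoint S (u n)" "cadjoint T (u n)"]
      by (simp add: distrib_right)
  qed
qed

lemma small_scaleC:
  assumes "small T" shows "small (\<lambda>f. c *\<^sub>C T f)"
proof -
  have bc: "bounded_clinear T" using assms by (simp add: small_def)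
  obtain C where C: "\<And>n. norm (T (u n)) \<le> C * (q n)\<^sup>2 \<and> norm (cadjoint T (u n)) \<le> C * (q n)\<^sup>2"
    using assms unfolding small_def by blast
  have adj: "cadjoint (\<lambda>f. c *\<^sub>C T f) = (\<lambda>f. cnj c *\<^sub>C cadjoint T f)"
    by (rule cadjoint_eqI) (simp add: cinner_scaleC_left cinner_scaleC_right cinner_cadjoint[OF basis bc])
  show ?thesis
  proof (rule smallI[where C = "cmod c * C" and B = "cmod c * C"])
    show "bounded_clinear (\<lambda>f. c *\<^sub>C T f)"
      using bc bounded_linear_compose[OF bounded_linear_scaleC_right]
      by (auto simp: bounded_clinear_def scaleC_scaleC mult.commute)
    show "norm (c *\<^sub>C T (u n)) \<le> cmod c * C * (q n)\<^sup>2" for n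
      using C[of n] by (simp add: mult.assoc mult_left_mono)
    show "norm (cadjoint (\<lambda>f. c *\<^sub>C T f) (u n)) \<le> cmod c * C * (q n)\<^sup>2" for n
      unfolding adj using C[of n] by (simp add: mult.assoc mult_left_mono)
  qed
qed

lemma small_sum:
  assumes "finite F" "\<And>\<alpha>. \<alpha> \<in> F \<Longrightarrow> small (T \<alpha>)"
  shows "small (\<lambda>f. \<Sum>\<alpha>\<in>F. c \<alpha> *\<^sub>C T \<alpha> f)"
  using assms
proof (induction F)
  case empty
  have "cadjoint (\<lambda>_::l2. 0::l2) = (\<lambda>_. 0)" by (rule cadjoint_eqI) simp
  then show ?case
    by (auto intro!: smallI[where C=0 and B=0] bounded_clinearI[where K=0])
next
  case (insert \<alpha> F)
  then show ?case by (simp add: small_add small_scaleC)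
qed

lemma small_imp_bi_carleman_mercer_operator:
  assumes "small T" shows "bi_carleman_mercer_operator T"
proof -
  obtain K where K: "Kinf_kernel K" "kernel_of K T" using small_imp_Kinf_kernel[OF assms] by blast
  have "bounded_clinear T" using assms by (simp add: small_def)
  then have "mercer_type K"
    unfolding mercer_type_def using K small_imp_Kinf_kernel small_mercer_set[OF assms] by blast
  moreover have "bi_carleman_kernel K"
    using K by (intro Kinf_kernel_imp_bi_carleman) (auto simp: kernel_of_def)
  ultimately show ?thesis using K(2) unfolding bi_carleman_mercer_operator_def by blast
qed

end

section \<open>Choice of the unitary operator\<close>

lemma summable_even_odd:
  fixes f :: "nat \<Rightarrow> real"
  assumes even: "summable (\<lambda>k. f (2 * k))" and odd: "summable (\<lambda>k. f (2 * k + 1))"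
    and nonneg: "\<And>n. 0 \<le> f n"
  shows "summable f"
proof (rule summableI_nonneg_bounded[OF nonneg])
  fix n
  have "(\<Sum>i<n. f i) \<le> (\<Sum>i<2 * n. f i)"
    using nonneg by (intro sum_mono2) auto
  also have "(\<Sum>i<2 * n. f i) = (\<Sum>k<n. f (2 * k)) + (\<Sum>k<n. f (2 * k + 1))"
    by (induction n) simp_all
  also have "\<dots> \<le> (\<Sum>k. f (2 * k)) + (\<Sum>k. f (2 * k + 1))"
    using assms by (intro add_mono sum_le_suminf) auto
  finally show "(\<Sum>i<n. f i) \<le> (\<Sum>k. f (2 * k)) + (\<Sum>k. f (2 * k + 1))" .
qed

lemma exists_even_subsequence:
  assumes "\<And>k. eventually (P k) sequentially"
  shows "\<exists>r :: nat \<Rightarrow> nat. inj r \<and> (\<forall>k. even (r k) \<and> P k (r k))"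
proof -
  obtain N where N: "\<And>k n. N k \<le> n \<Longrightarrow> P k n"
    using assms unfolding eventually_sequentially by metis
  define r where "r k = 2 * (k + (\<Sum>i\<le>k. N i))" for k
  have "strict_mono r" by (rule strict_monoI_Suc) (simp add: r_def)
  moreover have "N k \<le> r k" for k
    using member_le_sum[of k "{..k}" N] by (simp add: r_def)
  ultimately show ?thesis
    using N by (intro exI[of _ r]) (auto simp: r_def dest: strict_mono_imp_inj_on)
qed

lemma orthonormal_seq_inj: "orthonormal_seq e \<Longrightarrow> inj e"
  unfolding orthonormal_seq_def by (rule injI) (metis zero_neq_one)

lemma exists_basis_through_subsequence:
  fixes e :: "nat \<Rightarrow> 'a::complex_hilbert"
  assumes sep: "separable_space (euclidean :: 'a topology)" and e: "orthonormal_seq e"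
    and r: "inj r" "\<And>k. even (r k)"
  shows "\<exists>b. orthonormal_basis b \<and> (\<forall>k. b (2 * k) = e (r k))"
proof -
  obtain B where B: "countable B" "\<forall>x\<in>B. \<forall>y\<in>B. cinner x y = (if x = y then 1 else 0)"
    "\<forall>x\<in>B. \<forall>n. cinner x (e n) = 0"
    "\<forall>x. (\<forall>y\<in>B. cinner x y = 0) \<longrightarrow> (\<forall>n. cinner x (e n) = 0) \<longrightarrow> x = 0"
    using separable_orthonormal_completion[OF sep e] by (elim exE conjE)
  have ee: "cinner (e m) (e n) = (if m = n then 1 else 0)" for m n
    using e by (simp add: orthonormal_seq_def)
  note e_inj = orthonormal_seq_inj[OF e]
  have eB: "cinner (e n) x = 0" if "x \<in> B" for x n
    using that B(3) cinner_commute[of "e n" x] by auto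
  have e_notin_B: "e n \<notin> B" for n using eB[of "e n" n] ee[of n n] by auto
  \<comment> \<open>H contains every \<open>e n\<close> with n odd, so it is infinite even for
    finite B and the naturals enumerate it bijectively.\<close>
  define H where "H = B \<union> e ` (UNIV - range r)"
  have "range (\<lambda>k::nat. 2 * k + 1) \<subseteq> UNIV - range r"
  proof
    fix n assume "n \<in> range (\<lambda>k::nat. 2 * k + 1)"
    then have "odd n" by auto
    then show "n \<in> UNIV - range r" using r(2) by auto
  qed
  moreover have "infinite (range (\<lambda>k::nat. 2 * k + 1))"
    by (intro range_inj_infinite injI) simp
  ultimately have "infinite (UNIV - range r)" using finite_subset by blast
  then have "infinite (e ` (UNIV - range r))"
    using finite_imageD inj_on_subset[OF e_inj] by blast
  then have "infinite H" "countable H" using B(1) by (auto simp: H_def)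
  then have "bij_betw (from_nat_into H) UNIV H" by (intro bij_betw_from_nat_into)
  then have h: "inj (from_nat_into H)" "range (from_nat_into H) = H" by (auto simp: bij_betw_def)
  have "orthonormal_basis (\<lambda>n. if even n then (e \<circ> r) (n div 2) else from_nat_into H (n div 2))"
  proof (rule orthonormal_basis_interleave[where E = "B \<union> range e"])
    show "cinner x y = (if x = y then 1 else 0)" if "x \<in> B \<union> range e" "y \<in> B \<union> range e" for x y
      using that B(2,3) eB ee e_notin_B by (auto simp: inj_eq[OF e_inj])
    show "x = 0" if "\<And>y. y \<in> B \<union> range e \<Longrightarrow> cinner x y = 0" for x
      using that B(4) by simp
    show "inj (e \<circ> r)" by (rule inj_compose[OF e_inj r(1)])
    show "range (e \<circ> r) \<inter> range (from_nat_into H) = {}"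
      unfolding h(2) using e_notin_B by (auto simp: H_def inj_eq[OF e_inj])
    show "range (e \<circ> r) \<union> range (from_nat_into H) = B \<union> range e"
      unfolding h(2) by (auto simp: H_def)
  qed (rule h)
  then show ?thesis by (intro exI conjI) auto
qed

lemma unitary_inv:
  assumes "unitary U"
  shows "U (inv U y) = y" "inv U (U x) = x" "cinner (U x) y = cinner x (inv U y)"
    "norm (U x) = norm x" "bounded_clinear (inv U)"
proof -
  have U: "bounded_clinear U" "bij U" "\<And>x y. cinner (U x) (U y) = cinner x y"
    using assms by (auto simp: unitary_def)
  show r: "U (inv U y) = y" for y using U(2) by (simp add: bij_is_surj surj_f_inv_f)
  show l: "inv U (U x) = x" for x using U(2) by (simp add: bij_is_inj)
  show "cinner (U x) y = cinner x (inv U y)" using U(3)[of x "inv U y"] by (simp add: r)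
  show n: "norm (U x) = norm x" for x by (simp add: norm_eq_sqrt_cinner U(3))
  show "bounded_clinear (inv U)"
  proof (rule bounded_clinearI[where K=1])
    show "inv U (x + y) = inv U x + inv U y" for x y
      by (metis l r bounded_clinear_add[OF U(1)])
    show "inv U (c *\<^sub>C x) = c *\<^sub>C inv U x" for c x
      by (metis l r bounded_clinear_scaleC[OF U(1)])
    show "norm (inv U x) \<le> 1 * norm x" for x using n[of "inv U x"] by (simp add: r)
  qed
qed

lemma cadjoint_unitary_conjugate:
  fixes U :: "'a::complex_hilbert \<Rightarrow> 'b::complex_hilbert" and S :: "'a \<Rightarrow> 'a" and b :: "nat \<Rightarrow> 'a"
  assumes U: "unitary U" and b: "orthonormal_basis b" and S: "bounded_clinear S"
  shows "cadjoint (U \<circ> S \<circ> inv U) = U \<circ> cadjoint S \<circ> inv U"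
proof (rule cadjoint_eqI)
  fix x y
  have "cinner (inv U x) (cadjoint S (inv U y)) = cinner x (U (cadjoint S (inv U y)))"
    using unitary_inv(3)[OF U, of "inv U x" "U (cadjoint S (inv U y))"] unitary_inv(1,2)[OF U] by simp
  then show "cinner ((U \<circ> S \<circ> inv U) x) y = cinner x ((U \<circ> cadjoint S \<circ> inv U) y)"
    by (simp add: unitary_inv(3)[OF U] cinner_cadjoint[OF b S])
qed

theorem mainTheorem1:
  fixes \<A> :: "'i set"
    and S :: "'i \<Rightarrow> 'h::complex_hilbert \<Rightarrow> 'h"
    and e :: "nat \<Rightarrow> 'h"
  assumes "separable_space (euclidean :: 'h topology)"
    and "\<And>\<alpha>. \<alpha> \<in> \<A> \<Longrightarrow> bounded_clinear (S \<alpha>)"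
    and "orthonormal_seq e"
    and "(\<lambda>n. SUP \<alpha>\<in>\<A>. ennreal (norm (cadjoint (S \<alpha>) (e n)))) \<longlonglongrightarrow> 0"
    and "(\<lambda>n. SUP \<alpha>\<in>\<A>. ennreal (norm (S \<alpha> (e n)))) \<longlonglongrightarrow> 0"
  shows "\<exists>U :: 'h \<Rightarrow> l2. unitary U \<and>
    (\<forall>\<alpha>\<in>\<A>. bi_carleman_mercer_operator (U \<circ> S \<alpha> \<circ> inv U)) \<and>
    (\<forall>F c. finite F \<and> F \<subseteq> \<A> \<longrightarrow>
       bi_carleman_mercer_operator (\<lambda>f. \<Sum>\<alpha>\<in>F. c \<alpha> *\<^sub>C (U \<circ> S \<alpha> \<circ> inv U) f))"
proof -
  obtain D M where D: "\<And>n. test_chain (D n)" "orthonormal_basis (\<lambda>n. abs_l2 (D n 0))"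
    and DM: "\<And>n i s. cmod (D n i s) \<le> M n i" and M_odd: "\<And>i. summable (\<lambda>k. M (2 * k + 1) i)"
    using exists_test_basis by metis
  have M_nonneg: "0 \<le> M n i" for n i using DM[of n i 0] norm_ge_zero order_trans by blast
  \<comment> \<open>A diagonal choice: for n = 2k the denominator dominates \<open>M n i\<close> for
    all i up to k, and the 1 in it keeps q at most 1. At odd n the sup norms are already summable,
    so weight 1 will do.\<close>
  define q where "q n = (if even n then (1/2) ^ (n div 2) / (1 + (\<Sum>i\<le>n div 2. M n i)) else 1)" for n
  have den: "1 \<le> 1 + (\<Sum>i\<le>k. M n i)" for n k by (simp add: sum_nonneg M_nonneg)
  have q_pos: "0 < q n" for n
    using den[of n "n div 2"] by (auto simp: q_def intro!: divide_pos_pos)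
  have q_le_1: "q n \<le> 1" for n
  proof -
    have "(1/2::real) ^ (n div 2) \<le> 1" by (simp add: power_le_one)
    also have "\<dots> \<le> 1 + (\<Sum>i\<le>n div 2. M n i)" by (rule den)
    finally show ?thesis using den[of n "n div 2"] by (simp add: q_def divide_le_eq_1)
  qed
  have "summable (\<lambda>n. q n * M n i)" for i
  proof (rule summable_even_odd)
    show "summable (\<lambda>k. q (2 * k) * M (2 * k) i)"
    \<comment> \<open>From k = i on, \<open>M (2 * k) i\<close> is one of the summands in the
      denominator.\<close>
    proof (rule summable_comparison_test'[where N = i])
      show "summable (\<lambda>k. (1/2::real) ^ k)" by (simp add: summable_geometric)
      fix k assume "i \<le> k"
      then have "M (2 * k) i \<le> 1 + (\<Sum>i\<le>k. M (2 * k) i)"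
        using member_le_sum[of i "{..k}" "M (2 * k)"] M_nonneg by simp
      then have "(1/2) ^ k * M (2 * k) i \<le> (1/2) ^ k * (1 + (\<Sum>i\<le>k. M (2 * k) i))"
        by (intro mult_left_mono) auto
      then show "norm (q (2 * k) * M (2 * k) i) \<le> (1/2) ^ k"
        using den[where n = "2 * k" and k = k] M_nonneg[of "2 * k" i]
        by (simp add: q_def abs_of_nonneg divide_le_eq)
    qed
    show "summable (\<lambda>k. q (2 * k + 1) * M (2 * k + 1) i)" using M_odd by (simp add: q_def)
  qed (use q_pos M_nonneg in \<open>simp add: less_imp_le\<close>)
  then interpret weighted_test_basis D M q
    using D DM q_pos q_le_1 by unfold_locales (auto intro: less_imp_le)
  \<comment> \<open>Strict positivity of the weight and the limit of the suprema give an index bound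
    uniform in \<alpha>, for S and its adjoint together.\<close>
  have "eventually (\<lambda>n. \<forall>\<alpha>\<in>\<A>. norm (S \<alpha> (e n)) \<le> (q (2 * k))\<^sup>2 \<and>
      norm (cadjoint (S \<alpha>) (e n)) \<le> (q (2 * k))\<^sup>2) sequentially" for k
  proof -
    have "0 < ennreal ((q (2 * k))\<^sup>2)" using q_pos[of "2 * k"] by simp
    from order_tendstoD(2)[OF assms(4) this] order_tendstoD(2)[OF assms(5) this]
    show ?thesis
    proof eventually_elim
      case (elim n)
      have "norm (S \<alpha> (e n)) \<le> (q (2 * k))\<^sup>2 \<and> norm (cadjoint (S \<alpha>) (e n)) \<le> (q (2 * k))\<^sup>2"
        if "\<alpha> \<in> \<A>" for \<alpha>
        using order.strict_trans1[OF SUP_upper[OF that] elim(1)]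
          order.strict_trans1[OF SUP_upper[OF that] elim(2)] by (simp add: ennreal_less_iff less_imp_le)
      then show ?case by blast
    qed
  qed
  then obtain r where r: "inj r" "\<And>k. even (r k)"
    and r_le: "\<And>k \<alpha>. \<alpha> \<in> \<A> \<Longrightarrow> norm (S \<alpha> (e (r k))) \<le> (q (2 * k))\<^sup>2 \<and>
      norm (cadjoint (S \<alpha>) (e (r k))) \<le> (q (2 * k))\<^sup>2"
    using exists_even_subsequence[of "\<lambda>k n. \<forall>\<alpha>\<in>\<A>. norm (S \<alpha> (e n)) \<le> (q (2 * k))\<^sup>2 \<and>
      norm (cadjoint (S \<alpha>) (e n)) \<le> (q (2 * k))\<^sup>2"] by blast
  \<comment> \<open>The fast subsequence of e occupies the even positions, opposite the basis
    functions without summable bounds.\<close>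
  obtain b where b: "orthonormal_basis b" and b_even: "\<And>k. b (2 * k) = e (r k)"
    using exists_basis_through_subsequence[OF assms(1,3) r] by blast
  obtain U where U: "unitary U" and Ub: "\<And>n. U (b n) = u n"
    using exists_unitary_between_bases[OF b basis] by blast
  note norm_b = orthonormal_seq_norm[OF orthonormal_basisD[OF b]]
  have bc_U: "bounded_clinear U" using U by (simp add: unitary_def)
  have inv_u: "inv U (u n) = b n" for n using unitary_inv(2)[OF U, of "b n"] by (simp add: Ub)
  \<comment> \<open>Even positions use the decay along r; odd positions have weight 1 and use the
    operator bound K. Keeping T general covers S and its adjoint.\<close>
  have le: "norm (T (b n)) \<le> (1 + K) * (q n)\<^sup>2"
    if "0 \<le> K" "\<And>x. norm (T x) \<le> K * norm x" "\<And>k. norm (T (e (r k))) \<le> (q (2 * k))\<^sup>2"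
    for T :: "'h \<Rightarrow> 'h" and K n
  proof (cases "even n")
    case True
    then have "norm (T (b n)) \<le> 1 * (q n)\<^sup>2" using that(3)[of "n div 2"] b_even[of "n div 2"] by simp
    also have "\<dots> \<le> (1 + K) * (q n)\<^sup>2" using that(1) by (intro mult_right_mono) auto
    finally show ?thesis .
  next
    case False
    then show ?thesis using that(2)[of "b n"] by (simp add: norm_b q_def)
  qed
  have small: "small (U \<circ> S \<alpha> \<circ> inv U)" if \<alpha>: "\<alpha> \<in> \<A>" for \<alpha>
  proof -
    note S = assms(2)[OF \<alpha>]
    obtain K where K: "0 \<le> K" "\<And>x. norm (S \<alpha> x) \<le> K * norm x"
      using bounded_clinear_bound[OF S] by blast
    obtain K' where K': "0 \<le> K'" "\<And>x. norm (cadjoint (S \<alpha>) x) \<le> K' * norm x"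
      using bounded_clinear_bound[OF bounded_clinear_cadjoint[OF b S]] by blast
    show ?thesis
    proof (rule smallI)
      show "bounded_clinear (U \<circ> S \<alpha> \<circ> inv U)"
        by (intro bounded_clinear_compose bc_U S unitary_inv(5)[OF U])
      show "norm ((U \<circ> S \<alpha> \<circ> inv U) (u n)) \<le> (1 + K) * (q n)\<^sup>2" for n
        using le[OF K] r_le[OF \<alpha>] by (simp add: inv_u unitary_inv(4)[OF U])
      show "norm (cadjoint (U \<circ> S \<alpha> \<circ> inv U) (u n)) \<le> (1 + K') * (q n)\<^sup>2" for n
        using le[OF K'] r_le[OF \<alpha>]
        by (simp add: cadjoint_unitary_conjugate[OF U b S] inv_u unitary_inv(4)[OF U])
    qed
  qed
  show ?thesis
  proof (intro exI[of _ U] conjI U ballI allI impI; (elim conjE)?)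
    show "bi_carleman_mercer_operator (U \<circ> S \<alpha> \<circ> inv U)" if "\<alpha> \<in> \<A>" for \<alpha>
      by (rule small_imp_bi_carleman_mercer_operator[OF small[OF that]])
    show "bi_carleman_mercer_operator (\<lambda>f. \<Sum>\<alpha>\<in>F. c \<alpha> *\<^sub>C (U \<circ> S \<alpha> \<circ> inv U) f)"
      if "finite F" "F \<subseteq> \<A>" for F c
      using that by (intro small_imp_bi_carleman_mercer_operator small_sum small) auto
  qed
qed

end
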